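(* Let $f:\Sigma\to\mathcal{Z}$ be a Legendre map projecting to $\mathfrak{f}:\Sigma\to\mathfrak{Q}^3$ in the space form determined by space form vector $\mathfrak{q}$ and point sphere complex $\mathfrak{p}$. Suppose that $\mathfrak{f}$ is an umbilic-free non-tubular linear Weingarten surface satisfying $aK+2bH+c=0$. Then $f$ is an $\Omega$-surface whose middle pencil admits a $2$-dimensional space of linear conserved quantities $P$ with $g_0\neq0$ and $g_\infty$ non-degenerate. Furthermore, the linear Weingarten condition $[W]$, $W=a\,\mathfrak{q}\odot\mathfrak{q}+2b\,\mathfrak{q}\odot\mathfrak{p}+c\,\mathfrak{p}\odot\mathfrak{p}$, is given by $[W]=[\phi_0\circ\phi_\infty^{-1}(g_\infty)]$.
   Context: $\mathbb{R}^{4,2}$ is a 6-dimensional real vector space with a non-degenerate symmetric bilinear form $(\,,\,)$ of signature $(4,2)$, $\mathcal{L}$ its lightcone; $\wedge^2\mathbb{R}^{4,2}\cong\mathfrak{o}(4,2)$ via $a\wedge b\,(c)=(a,c)b-(b,c)a$; $a\odot b=\frac12(a\otimes b+b\otimes a)$. $\Sigma$ is a smooth 2-manifold, $\underline{\mathbb{R}}^{4,2}=\Sigma\times\mathbb{R}^{4,2}$, $d$ its trivial connection; $W^{(1)}$ is spanned by sections of a subbundle $W$ and their derivatives. $\mathcal{Z}$ is the Grassmannian of isotropic 2-dimensional subspaces; a smooth $f:\Sigma\to\mathcal{Z}$ (a rank 2 subbundle) is a Legendre map if $f^{(1)}\le f^\perp$ and no non-zero $X\in T\Sigma$ satisfies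 $d_X\sigma\in f$ for all $\sigma\in\Gamma f$. A curvature sphere at $p$ is a line $s(p)\le f(p)$ killed by $\sigma\mapsto d_X\sigma\bmod f$ for all $X$ in some non-zero (maximal) subspace $T_{s(p)}\le T_p\Sigma$. $f$ is umbilic-free if there are exactly two curvature spheres at each point, forming rank 1 bundles $s_1,s_2$ with curvature subbundles $T_1,T_2$. A gauge potential is a closed $\eta\in\Omega^1(f\wedge f^\perp)$ with $[\eta\wedge\eta]=0$ such that $q(X,Y)=\mathrm{tr}(\sigma\mapsto\eta(X)d_Y\sigma:f\to f)$ is non-zero; $f$ is an $\Omega$-surface if $q$ is non-degenerate on a dense open set. The gauge orbit is $\{\eta-d\tau:\tau\in\Gamma(\wedge^2f)\}$. With $S_1=\langle\sigma_1,d_Y\sigma_1,d_Yd_Y\sigma_1\rangle$, $S_2=\langle\sigma_2,d_X\sigma_2,d_Xd_X\sigma_2\rangle$ ($\sigma_i\in\Gamma s_i$, $X\in\Gamma T_1$, $Y\in\Gamma T_2$), the middle potential $\eta^{mid}$ is the unique member of the gauge orbit whose $S_1\wedge S_2$-component takes values in $\wedge^2f$; the middle pencil is $\{d+t\eta^{mid}\}_{t\in\mathbb{R}}$. A linear conserved quantity is a degree 1 polynomial $p(t)=p_0+tp_1$, $p_0,p_1\in\Gamma\underline{\mathbb{R}}^{4,2}$, with $(d+t\eta^{mid})p(t)=0$ for all $t$. ($p_0$ is then constant.) A 2-dimensional space of linear conserved quantities is a 2-dimensional real vector space $P$ whose non-zero elements are linear conserved quantities; $P(t)=\{p(t):p\in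 P\}$. On $P$ define $g_t(\alpha,\beta)=(\alpha(t),\beta(t))$ for $t\in\mathbb{R}$ and $g_\infty(\alpha,\beta)=(\alpha_0,\beta_1)+(\beta_0,\alpha_1)$; then $g_t=g_0+tg_\infty$, and $g_t,g_\infty$ are constant over $\Sigma$. Let $S^2P$ be the symmetric square. Define $\phi_t:S^2P\to S^2P(t)$, $\alpha\odot\beta\mapsto\alpha(t)\odot\beta(t)$, and $\phi_\infty:\alpha\odot\beta\mapsto(\alpha\odot\beta)_\infty$ from $S^2P$ to symmetric bilinear forms on $P$, $(\alpha\odot\beta)_\infty(\gamma,\delta)=\frac12(g_\infty(\alpha,\gamma)g_\infty(\beta,\delta)+g_\infty(\alpha,\delta)g_\infty(\beta,\gamma))$, an isomorphism when $g_\infty$ is non-degenerate. Space forms: a point sphere complex $\mathfrak{p}$ with $(\mathfrak{p},\mathfrak{p})=\pm1$ and a non-zero space form vector $\mathfrak{q}\in\langle\mathfrak{p}\rangle^\perp$ give $\mathfrak{Q}^3=\{y\in\mathcal{L}:(y,\mathfrak{q})=-1,(y,\mathfrak{p})=0\}$, a (Riemannian or Lorentzian) space form of curvature $\kappa=-(\mathfrak{q},\mathfrak{q})$. The projection $\mathfrak{f}:\Sigma\to\mathfrak{Q}^3$ and tangent plane congruence $\mathfrak{t}$ of $f$ are the sections of $f$ with $(\mathfrak{f},\mathfrak{q})=-1,(\mathfrak{f},\mathfrak{p})=0$ and $(\mathfrak{t},\mathfrak{q})=0,(\mathfrak{t},\mathfrak{p})=-1$. Principal curvatures $\kappa_i$: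 $d_X\mathfrak{t}+\kappa_id_X\mathfrak{f}=0$ for $X\in T_i$; $K=\kappa_1\kappa_2$, $H=\frac12(\kappa_1+\kappa_2)$. $\mathfrak{f}$ (immersed) is linear Weingarten if $aK+2bH+c=0$ for constants $a,b,c\in\mathbb{R}$, not all zero; tubular if $b^2-ac=0$, non-tubular otherwise. $[\,\cdot\,]$ denotes the class in $\mathbb{P}(S^2\mathbb{R}^{4,2})$. *)

theory Defs
  imports "HOL-Analysis.Analysis" "HOL-Library.Function_Algebras"
begin

section \<open>Smooth maps between normed spaces\<close>

text \<open>Intended for open \<open>S\<close>.\<close>

primrec ck_on :: "nat \<Rightarrow> 'e::real_normed_vector set \<Rightarrow> ('e \<Rightarrow> 'w::real_normed_vector) \<Rightarrow> bool" where
  "ck_on 0 S g \<longleftrightarrow> continuous_on S g"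
| "ck_on (Suc k) S g \<longleftrightarrow> (\<forall>x\<in>S. g differentiable (at x)) \<and>
     (\<forall>v. ck_on k S (\<lambda>x. frechet_derivative g (at x) v))"

definition smooth_on :: "'e::real_normed_vector set \<Rightarrow> ('e \<Rightarrow> 'w::real_normed_vector) \<Rightarrow> bool" where
  "smooth_on S g \<longleftrightarrow> (\<forall>k. ck_on k S g)"


section \<open>Smooth surfaces\<close>

text \<open>A smooth 2-manifold is a Hausdorff, second countable type with an atlas indexed by its
  points: \<open>A p = (U, \<phi>)\<close> is a chart around \<open>p\<close>. Any atlas gives one of this form by choosing
  a chart at every point. The tangent space at \<open>p\<close> is \<open>real^2\<close>, a tangent
  vector being represented by its components in the chart \<open>A p\<close>.\<close>

type_synonym 'a chart = "'a set \<times> ('a \<Rightarrow> real^2)"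
type_synonym 'a atlas = "'a \<Rightarrow> 'a chart"
type_synonym ('a, 'w) form1 = "'a \<Rightarrow> real^2 \<Rightarrow> 'w"

definition chart_dom :: "'a atlas \<Rightarrow> 'a \<Rightarrow> 'a set" where
  "chart_dom A p = fst (A p)"

definition chart_map :: "'a atlas \<Rightarrow> 'a \<Rightarrow> 'a \<Rightarrow> real^2" where
  "chart_map A p = snd (A p)"

definition chart_inv :: "'a atlas \<Rightarrow> 'a \<Rightarrow> real^2 \<Rightarrow> 'a" where
  "chart_inv A p = inv_into (chart_dom A p) (chart_map A p)"

definition smooth_atlas :: "'a::{t2_space,second_countable_topology} atlas \<Rightarrow> bool" where
  "smooth_atlas A \<longleftrightarrow>
     (\<forall>p. p \<in> chart_dom A p \<and> open (chart_dom A p) \<and> open (chart_map A p ` chart_dom A p) \<and>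
          homeomorphism (chart_dom A p) (chart_map A p ` chart_dom A p) (chart_map A p) (chart_inv A p)) \<and>
     (\<forall>p q. smooth_on (chart_map A p ` (chart_dom A p \<inter> chart_dom A q))
                      (chart_map A q \<circ> chart_inv A p))"

definition smooth_map ::
    "'a::topological_space atlas \<Rightarrow> 'a set \<Rightarrow> ('a \<Rightarrow> 'w::real_normed_vector) \<Rightarrow> bool" where
  "smooth_map A U g \<longleftrightarrow>
     (\<forall>p. smooth_on (chart_map A p ` (chart_dom A p \<inter> U)) (g \<circ> chart_inv A p))"

text \<open>\<open>dd A g p X\<close> is \<open>d\<^sub>X g\<close> at \<open>p\<close>; it also serves as the trivial connection.\<close>

definition dd :: "'a atlas \<Rightarrow> ('a \<Rightarrow> 'w::real_normed_vector) \<Rightarrow> ('a, 'w) form1" where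
  "dd A g p X = frechet_derivative (g \<circ> chart_inv A p) (at (chart_map A p p)) X"

text \<open>For \<open>r\<close> in both chart domains, \<open>tchange A p q r\<close> turns the components of a tangent vector at
  \<open>r\<close> with respect to the chart \<open>A p\<close> into those with respect to \<open>A q\<close>. In particular
  \<open>tchange A p r r\<close> maps into the tangent space at \<open>r\<close>.\<close>

definition tchange :: "'a atlas \<Rightarrow> 'a \<Rightarrow> 'a \<Rightarrow> 'a \<Rightarrow> real^2 \<Rightarrow> real^2" where
  "tchange A p q r v = frechet_derivative (chart_map A q \<circ> chart_inv A p) (at (chart_map A p r)) v"

definition smooth_field :: "'a::topological_space atlas \<Rightarrow> 'a set \<Rightarrow> ('a \<Rightarrow> real^2) \<Rightarrow> bool" where
  "smooth_field A U X \<longleftrightarrow>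
     (\<forall>p. smooth_on (chart_map A p ` (chart_dom A p \<inter> U))
            ((\<lambda>r. tchange A r p r (X r)) \<circ> chart_inv A p))"

definition form_rep ::
    "'a atlas \<Rightarrow> ('a, 'w) form1 \<Rightarrow> 'a \<Rightarrow> real^2 \<Rightarrow> real^2 \<Rightarrow> 'w" where
  "form_rep A \<eta> p y v = (let r = chart_inv A p y in \<eta> r (tchange A p r r v))"

definition smooth_form1 :: "'a atlas \<Rightarrow> ('a, 'w::real_normed_vector) form1 \<Rightarrow> bool" where
  "smooth_form1 A \<eta> \<longleftrightarrow> (\<forall>p. linear (\<eta> p)) \<and>
     (\<forall>p v. smooth_on (chart_map A p ` chart_dom A p) (\<lambda>y. form_rep A \<eta> p y v))"

definition ext_deriv ::
    "'a atlas \<Rightarrow> ('a, 'w::real_normed_vector) form1 \<Rightarrow> 'a \<Rightarrow> real^2 \<Rightarrow> real^2 \<Rightarrow> 'w" where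
  "ext_deriv A \<eta> p X Y =
     frechet_derivative (\<lambda>y. form_rep A \<eta> p y Y) (at (chart_map A p p)) X -
     frechet_derivative (\<lambda>y. form_rep A \<eta> p y X) (at (chart_map A p p)) Y"

definition closed_form1 :: "'a atlas \<Rightarrow> ('a, 'w::real_normed_vector) form1 \<Rightarrow> bool" where
  "closed_form1 A \<eta> \<longleftrightarrow> (\<forall>p X Y. ext_deriv A \<eta> p X Y = 0)"

text \<open>A subbundle of a trivial bundle is given by its family of fibres.\<close>

definition smooth_subbundle ::
    "'a::topological_space atlas \<Rightarrow> nat \<Rightarrow> ('a \<Rightarrow> 'w::real_normed_vector set) \<Rightarrow> bool" where
  "smooth_subbundle A k W \<longleftrightarrow>
     (\<forall>p. \<exists>U \<sigma>. open U \<and> p \<in> U \<and> (\<forall>i<k. smooth_map A U (\<sigma> i)) \<and>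
        (\<forall>r\<in>U. W r = span ((\<lambda>i::nat. \<sigma> i r) ` {..<k}) \<and> dim (W r) = k))"

definition section_on ::
    "'a::topological_space atlas \<Rightarrow> ('a \<Rightarrow> 'w::real_normed_vector set) \<Rightarrow> 'a set \<Rightarrow> ('a \<Rightarrow> 'w) \<Rightarrow> bool" where
  "section_on A W U \<sigma> \<longleftrightarrow> open U \<and> smooth_map A U \<sigma> \<and> (\<forall>r\<in>U. \<sigma> r \<in> W r)"

definition field_on ::
    "'a::topological_space atlas \<Rightarrow> ('a \<Rightarrow> (real^2) set) \<Rightarrow> 'a set \<Rightarrow> ('a \<Rightarrow> real^2) \<Rightarrow> bool" where
  "field_on A T U X \<longleftrightarrow> open U \<and> smooth_field A U X \<and> (\<forall>r\<in>U. X r \<in> T r)"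

text \<open>The fibre at \<open>p\<close> of \<open>W\<^sup>(\<^sup>1\<^sup>)\<close>.\<close>

definition derived_bundle ::
    "'a::topological_space atlas \<Rightarrow> ('a \<Rightarrow> 'w::real_normed_vector set) \<Rightarrow> 'a \<Rightarrow> 'w set" where
  "derived_bundle A W p = span {v. \<exists>U \<sigma>. p \<in> U \<and> section_on A W U \<sigma> \<and>
     (v = \<sigma> p \<or> (\<exists>X. v = dd A \<sigma> p X))}"


section \<open>The space of signature (4, 2)\<close>

text \<open>The inner product inherited from \<^class>\<open>euclidean_space\<close> is auxiliary and only supplies the
  topology.\<close>

class lie_space = euclidean_space +
  fixes lform :: "'a \<Rightarrow> 'a \<Rightarrow> real" ("\<llangle>_, _\<rrangle>")
  assumes dim_6: "card (Basis :: 'a set) = 6"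
    and lform_add_left: "\<llangle>x + y, z\<rrangle> = \<llangle>x, z\<rrangle> + \<llangle>y, z\<rrangle>"
    and lform_scaleR_left: "\<llangle>r *\<^sub>R x, y\<rrangle> = r * \<llangle>x, y\<rrangle>"
    and lform_sym: "\<llangle>x, y\<rrangle> = \<llangle>y, x\<rrangle>"
    and lform_nondegenerate: "(\<And>y. \<llangle>x, y\<rrangle> = 0) \<Longrightarrow> x = 0"
    and lform_signature: "\<exists>e::nat \<Rightarrow> 'a. \<forall>i<6. \<forall>j<6.
          \<llangle>e i, e j\<rrangle> = (if i = j then (if i < 4 then 1 else -1) else 0)"

lemma lform_bilinear: "bilinear (lform :: 'v::lie_space \<Rightarrow> 'v \<Rightarrow> real)"
proof -
  have "linear (\<lambda>x. \<llangle>x, y\<rrangle>)" for y :: 'v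
    by (rule linearI) (simp_all add: lform_add_left lform_scaleR_left)
  moreover have "linear (\<lambda>y. \<llangle>x, y\<rrangle>)" for x :: 'v
    by (subst lform_sym) (rule calculation)
  ultimately show ?thesis by (simp add: bilinear_def)
qed

definition lightcone :: "'v::lie_space set" where
  "lightcone = {v. v \<noteq> 0 \<and> \<llangle>v, v\<rrangle> = 0}"

definition lperp :: "'v::lie_space set \<Rightarrow> 'v set" where
  "lperp W = {v. \<forall>w\<in>W. \<llangle>v, w\<rrangle> = 0}"

definition isotropic :: "'v::lie_space set \<Rightarrow> bool" where
  "isotropic W \<longleftrightarrow> (\<forall>v\<in>W. \<forall>w\<in>W. \<llangle>v, w\<rrangle> = 0)"

definition wedge :: "'v::lie_space \<Rightarrow> 'v \<Rightarrow> 'v \<Rightarrow>\<^sub>L 'v" where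
  "wedge a b = Blinfun (\<lambda>c. \<llangle>a, c\<rrangle> *\<^sub>R b - \<llangle>b, c\<rrangle> *\<^sub>R a)"

lemma wedge_apply: "blinfun_apply (wedge a b) c = \<llangle>a, c\<rrangle> *\<^sub>R b - \<llangle>b, c\<rrangle> *\<^sub>R a"
proof -
  have lin: "linear (\<lambda>c. \<llangle>x, c\<rrangle>)" for x :: 'a
    using lform_bilinear by (auto simp: bilinear_def)
  have "linear (\<lambda>c. \<llangle>a, c\<rrangle> *\<^sub>R b - \<llangle>b, c\<rrangle> *\<^sub>R a)"
    by (intro linearI) (auto simp: linear_add[OF lin] linear_scale[OF lin] algebra_simps)
  then show ?thesis
    unfolding wedge_def by (simp add: bounded_linear_Blinfun_apply linear_conv_bounded_linear)
qed

definition wedge_space :: "'v::lie_space set \<Rightarrow> 'v set \<Rightarrow> ('v \<Rightarrow>\<^sub>L 'v) set" where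
  "wedge_space W W' = span {wedge a b |a b. a \<in> W \<and> b \<in> W'}"


section \<open>Legendre maps and curvature spheres\<close>

definition legendre_map ::
    "'a::topological_space atlas \<Rightarrow> ('a \<Rightarrow> 'v::lie_space set) \<Rightarrow> bool" where
  "legendre_map A f \<longleftrightarrow> smooth_subbundle A 2 f \<and> (\<forall>p. isotropic (f p)) \<and>
     (\<forall>p. derived_bundle A f p \<subseteq> lperp (f p)) \<and>
     (\<forall>p X. (\<forall>U \<sigma>. p \<in> U \<and> section_on A f U \<sigma> \<longrightarrow> dd A \<sigma> p X \<in> f p) \<longrightarrow> X = 0)"

text \<open>The maximal space of tangent vectors \<open>X\<close> at \<open>p\<close> such that \<open>\<sigma> \<mapsto> d\<^sub>X \<sigma> mod f\<close> kills the line \<open>l\<close>.\<close>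

definition curvature_space ::
    "'a::topological_space atlas \<Rightarrow> ('a \<Rightarrow> 'v::lie_space set) \<Rightarrow> 'a \<Rightarrow> 'v set \<Rightarrow> (real^2) set" where
  "curvature_space A f p l =
     {X. \<forall>U \<sigma>. p \<in> U \<and> section_on A f U \<sigma> \<and> \<sigma> p \<in> l \<longrightarrow> dd A \<sigma> p X \<in> f p}"

definition curvature_sphere ::
    "'a::topological_space atlas \<Rightarrow> ('a \<Rightarrow> 'v::lie_space set) \<Rightarrow> 'a \<Rightarrow> 'v set \<Rightarrow> bool" where
  "curvature_sphere A f p l \<longleftrightarrow>
     subspace l \<and> dim l = 1 \<and> l \<subseteq> f p \<and> curvature_space A f p l \<noteq> {0}"

definition umbilic_free ::
    "'a::topological_space atlas \<Rightarrow> ('a \<Rightarrow> 'v::lie_space set) \<Rightarrow> ('a \<Rightarrow> 'v set) \<Rightarrow> ('a \<Rightarrow> 'v set) \<Rightarrow> bool"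
  where
  "umbilic_free A f s\<^sub>1 s\<^sub>2 \<longleftrightarrow> smooth_subbundle A 1 s\<^sub>1 \<and> smooth_subbundle A 1 s\<^sub>2 \<and>
     (\<forall>p. s\<^sub>1 p \<noteq> s\<^sub>2 p \<and> {l. curvature_sphere A f p l} = {s\<^sub>1 p, s\<^sub>2 p})"

definition curvature_subbundle ::
    "'a::topological_space atlas \<Rightarrow> ('a \<Rightarrow> 'v::lie_space set) \<Rightarrow> ('a \<Rightarrow> 'v set) \<Rightarrow> 'a \<Rightarrow> (real^2) set" where
  "curvature_subbundle A f s p = curvature_space A f p (s p)"

text \<open>\<open>\<langle>\<sigma>, d\<^sub>Y \<sigma>, d\<^sub>Y d\<^sub>Y \<sigma>\<rangle>\<close> for sections \<open>\<sigma>\<close> of \<open>s\<close> and \<open>Y\<close> of \<open>T\<close>.\<close>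

definition lie_cyclide ::
    "'a::topological_space atlas \<Rightarrow> ('a \<Rightarrow> 'v::lie_space set) \<Rightarrow> ('a \<Rightarrow> (real^2) set) \<Rightarrow> 'a \<Rightarrow> 'v set" where
  "lie_cyclide A s T p = span {v. \<exists>U \<sigma> Y. p \<in> U \<and> section_on A s U \<sigma> \<and> field_on A T U Y \<and>
     v \<in> {\<sigma> p, dd A \<sigma> p (Y p), dd A (\<lambda>r. dd A \<sigma> r (Y r)) p (Y p)}}"


section \<open>Gauge potentials\<close>

definition lie_bracket :: "('v::real_normed_vector \<Rightarrow>\<^sub>L 'v) \<Rightarrow> ('v \<Rightarrow>\<^sub>L 'v) \<Rightarrow> 'v \<Rightarrow>\<^sub>L 'v" where
  "lie_bracket \<xi> \<zeta> = \<xi> o\<^sub>L \<zeta> - \<zeta> o\<^sub>L \<xi>"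

definition bracket_wedge :: "('a, 'v::real_normed_vector \<Rightarrow>\<^sub>L 'v) form1 \<Rightarrow> ('a, 'v \<Rightarrow>\<^sub>L 'v) form1 \<Rightarrow>
    'a \<Rightarrow> real^2 \<Rightarrow> real^2 \<Rightarrow> 'v \<Rightarrow>\<^sub>L 'v" where
  "bracket_wedge \<eta> \<omega> p X Y = lie_bracket (\<eta> p X) (\<omega> p Y) - lie_bracket (\<eta> p Y) (\<omega> p X)"

text \<open>Trace of an endomorphism of a finite-dimensional subspace.\<close>

definition trace_on :: "'v::real_vector set \<Rightarrow> ('v \<Rightarrow> 'v) \<Rightarrow> real" where
  "trace_on W L = (let B = (SOME B. independent B \<and> span B = W) in
     \<Sum>b\<in>B. representation B (L b) b)"

text \<open>The quadratic differential \<open>q(X, Y) = tr(\<sigma> \<mapsto> \<eta>(X) d\<^sub>Y \<sigma>)\<close>. To evaluate it at \<open>v \<in> f p\<close>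
  a local section of \<open>f\<close> through \<open>v\<close> is chosen; \<open>d\<^sub>Y \<sigma>\<close> is determined by \<open>v\<close> modulo \<open>f p\<close>, which
  \<open>\<eta>(X)\<close> annihilates.\<close>

definition extension ::
    "'a::topological_space atlas \<Rightarrow> ('a \<Rightarrow> 'v::lie_space set) \<Rightarrow> 'a \<Rightarrow> 'v \<Rightarrow> 'a \<Rightarrow> 'v" where
  "extension A f p v = (SOME \<sigma>. (\<exists>U. p \<in> U \<and> section_on A f U \<sigma>) \<and> \<sigma> p = v)"

definition quad_diff :: "'a::topological_space atlas \<Rightarrow> ('a \<Rightarrow> 'v::lie_space set) \<Rightarrow>
    ('a, 'v \<Rightarrow>\<^sub>L 'v) form1 \<Rightarrow> 'a \<Rightarrow> real^2 \<Rightarrow> real^2 \<Rightarrow> real" where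
  "quad_diff A f \<eta> p X Y =
     trace_on (f p) (\<lambda>v. blinfun_apply (\<eta> p X) (dd A (extension A f p v) p Y))"

definition gauge_potential ::
    "'a::topological_space atlas \<Rightarrow> ('a \<Rightarrow> 'v::lie_space set) \<Rightarrow> ('a, 'v \<Rightarrow>\<^sub>L 'v) form1 \<Rightarrow> bool" where
  "gauge_potential A f \<eta> \<longleftrightarrow> smooth_form1 A \<eta> \<and>
     (\<forall>p X. \<eta> p X \<in> wedge_space (f p) (lperp (f p))) \<and>
     closed_form1 A \<eta> \<and> (\<forall>p X Y. bracket_wedge \<eta> \<eta> p X Y = 0) \<and>
     (\<exists>p X Y. quad_diff A f \<eta> p X Y \<noteq> 0)"

text \<open>\<open>f\<close> is an \<open>\<Omega>\<close>-surface iff such an \<open>\<eta>\<close> exists.\<close>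

definition omega_potential ::
    "'a::topological_space atlas \<Rightarrow> ('a \<Rightarrow> 'v::lie_space set) \<Rightarrow> ('a, 'v \<Rightarrow>\<^sub>L 'v) form1 \<Rightarrow> bool" where
  "omega_potential A f \<eta> \<longleftrightarrow> gauge_potential A f \<eta> \<and>
     (\<exists>U. open U \<and> closure U = UNIV \<and>
       (\<forall>p\<in>U. \<forall>X. (\<forall>Y. quad_diff A f \<eta> p X Y = 0) \<longrightarrow> X = 0))"

definition gauge_orbit :: "'a::topological_space atlas \<Rightarrow> ('a \<Rightarrow> 'v::lie_space set) \<Rightarrow>
    ('a, 'v \<Rightarrow>\<^sub>L 'v) form1 \<Rightarrow> ('a, 'v \<Rightarrow>\<^sub>L 'v) form1 set" where
  "gauge_orbit A f \<eta> = {\<lambda>p X. \<eta> p X - dd A \<tau> p X |\<tau>.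
     section_on A (\<lambda>p. wedge_space (f p) (f p)) UNIV \<tau>}"

definition mixed_component :: "'v::lie_space set \<Rightarrow> 'v set \<Rightarrow> ('v \<Rightarrow>\<^sub>L 'v) \<Rightarrow> ('v \<Rightarrow>\<^sub>L 'v) \<Rightarrow> bool" where
  "mixed_component S\<^sub>1 S\<^sub>2 \<omega> m \<longleftrightarrow> m \<in> wedge_space S\<^sub>1 S\<^sub>2 \<and>
     \<omega> - m \<in> span (wedge_space S\<^sub>1 S\<^sub>1 \<union> wedge_space S\<^sub>2 S\<^sub>2)"

definition middle_condition :: "'a::topological_space atlas \<Rightarrow> ('a \<Rightarrow> 'v::lie_space set) \<Rightarrow>
    ('a \<Rightarrow> 'v set) \<Rightarrow> ('a \<Rightarrow> 'v set) \<Rightarrow> ('a, 'v \<Rightarrow>\<^sub>L 'v) form1 \<Rightarrow> bool" where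
  "middle_condition A f s\<^sub>1 s\<^sub>2 \<eta> \<longleftrightarrow>
     (let S\<^sub>1 = lie_cyclide A s\<^sub>1 (curvature_subbundle A f s\<^sub>2);
          S\<^sub>2 = lie_cyclide A s\<^sub>2 (curvature_subbundle A f s\<^sub>1)
      in \<forall>p X. \<exists>m. mixed_component (S\<^sub>1 p) (S\<^sub>2 p) (\<eta> p X) m \<and> m \<in> wedge_space (f p) (f p))"

definition middle_potential :: "'a::topological_space atlas \<Rightarrow> ('a \<Rightarrow> 'v::lie_space set) \<Rightarrow>
    ('a \<Rightarrow> 'v set) \<Rightarrow> ('a \<Rightarrow> 'v set) \<Rightarrow> ('a, 'v \<Rightarrow>\<^sub>L 'v) form1 \<Rightarrow> ('a, 'v \<Rightarrow>\<^sub>L 'v) form1 \<Rightarrow> bool" where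
  "middle_potential A f s\<^sub>1 s\<^sub>2 \<eta> \<mu> \<longleftrightarrow>
     \<mu> \<in> gauge_orbit A f \<eta> \<and> middle_condition A f s\<^sub>1 s\<^sub>2 \<mu> \<and>
     (\<forall>\<nu>\<in>gauge_orbit A f \<eta>. middle_condition A f s\<^sub>1 s\<^sub>2 \<nu> \<longrightarrow> \<nu> = \<mu>)"


section \<open>Symmetric squares\<close>

instantiation "fun" :: (type, real_vector) real_vector
begin

definition scaleR_fun_def: "c *\<^sub>R g = (\<lambda>x. c *\<^sub>R g x)"

instance
  by standard (auto simp: scaleR_fun_def plus_fun_def fun_eq_iff algebra_simps)

end

text \<open>A vector \<open>\<Sum> a \<otimes> b\<close> of \<open>W \<otimes> W\<close> is identified with the bilinear form
  \<open>(u, v) \<mapsto> \<Sum> u a * v b\<close> on the dual of \<open>W\<close>. As the dual is not a type, the form is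
  set to \<open>0\<close> on arguments that are not linear.\<close>

type_synonym 'w tensor2 = "('w \<Rightarrow> real) \<Rightarrow> ('w \<Rightarrow> real) \<Rightarrow> real"

definition sym_prod :: "'w::real_vector \<Rightarrow> 'w \<Rightarrow> 'w tensor2" (infixl "\<odot>" 75) where
  "a \<odot> b = (\<lambda>u v. if linear u \<and> linear v then (u a * v b + u b * v a) / 2 else 0)"

definition sym_square :: "'w::real_vector set \<Rightarrow> 'w tensor2 set" where
  "sym_square W = span {a \<odot> b |a b. a \<in> W \<and> b \<in> W}"

definition proj_class :: "'w::real_vector \<Rightarrow> 'w set" where
  "proj_class w = {c *\<^sub>R w |c. c \<noteq> 0}"


section \<open>Linear conserved quantities\<close>

text \<open>The pair \<open>(p\<^sub>0, p\<^sub>1)\<close> stands for \<open>p(t) = p\<^sub>0 + t p\<^sub>1\<close>.\<close>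

type_synonym ('a, 'v) lin_poly = "('a \<Rightarrow> 'v) \<times> ('a \<Rightarrow> 'v)"

definition poly_at :: "real \<Rightarrow> 'a \<Rightarrow> ('a, 'v::real_vector) lin_poly \<Rightarrow> 'v" where
  "poly_at t x \<alpha> = fst \<alpha> x + t *\<^sub>R snd \<alpha> x"

definition linear_conserved_quantity ::
    "'a::topological_space atlas \<Rightarrow> ('a, 'v \<Rightarrow>\<^sub>L 'v) form1 \<Rightarrow> ('a, 'v::lie_space) lin_poly \<Rightarrow> bool" where
  "linear_conserved_quantity A \<mu> \<alpha> \<longleftrightarrow>
     smooth_map A UNIV (fst \<alpha>) \<and> smooth_map A UNIV (snd \<alpha>) \<and> snd \<alpha> \<noteq> (\<lambda>_. 0) \<and>
     (\<forall>t x X. dd A (\<lambda>y. poly_at t y \<alpha>) x X + t *\<^sub>R blinfun_apply (\<mu> x X) (poly_at t x \<alpha>) = 0)"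

definition conserved_plane ::
    "'a::topological_space atlas \<Rightarrow> ('a, 'v \<Rightarrow>\<^sub>L 'v) form1 \<Rightarrow> ('a, 'v::lie_space) lin_poly set \<Rightarrow> bool" where
  "conserved_plane A \<mu> P \<longleftrightarrow> subspace P \<and> dim P = 2 \<and>
     (\<forall>\<alpha>\<in>P. \<alpha> \<noteq> 0 \<longrightarrow> linear_conserved_quantity A \<mu> \<alpha>)"

text \<open>The forms \<open>g\<^sub>t\<close> and \<open>g\<^sub>\<infinity>\<close>, evaluated at the point \<open>x\<close>.\<close>

definition g_at :: "real \<Rightarrow> 'a \<Rightarrow> ('a, 'v::lie_space) lin_poly \<Rightarrow> ('a, 'v) lin_poly \<Rightarrow> real" where
  "g_at t x \<alpha> \<beta> = \<llangle>poly_at t x \<alpha>, poly_at t x \<beta>\<rrangle>"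

definition g_inf :: "'a \<Rightarrow> ('a, 'v::lie_space) lin_poly \<Rightarrow> ('a, 'v) lin_poly \<Rightarrow> real" where
  "g_inf x \<alpha> \<beta> = \<llangle>fst \<alpha> x, snd \<beta> x\<rrangle> + \<llangle>fst \<beta> x, snd \<alpha> x\<rrangle>"

definition nondegenerate_on :: "'p::real_vector set \<Rightarrow> ('p \<Rightarrow> 'p \<Rightarrow> real) \<Rightarrow> bool" where
  "nondegenerate_on P g \<longleftrightarrow> (\<forall>\<alpha>\<in>P. (\<forall>\<beta>\<in>P. g \<alpha> \<beta> = 0) \<longrightarrow> \<alpha> = 0)"

text \<open>Bilinear forms on \<open>P\<close> are extended by \<open>0\<close>.\<close>

definition form_on :: "'p set \<Rightarrow> ('p \<Rightarrow> 'p \<Rightarrow> real) \<Rightarrow> 'p \<Rightarrow> 'p \<Rightarrow> real" where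
  "form_on P g = (\<lambda>\<gamma> \<delta>. if \<gamma> \<in> P \<and> \<delta> \<in> P then g \<gamma> \<delta> else 0)"

text \<open>\<open>\<phi>\<^sub>t\<close> (at \<open>x\<close>) and \<open>\<phi>\<^sub>\<infinity>\<close>, the linear maps whose values on the generators \<open>\<alpha> \<odot> \<beta>\<close> are
  computed in the lemmas below.\<close>

definition phi_at :: "real \<Rightarrow> 'a \<Rightarrow> ('a, 'v::lie_space) lin_poly tensor2 \<Rightarrow> 'v tensor2" where
  "phi_at t x Q = (\<lambda>u v. if linear u \<and> linear v
     then Q (\<lambda>\<alpha>. u (poly_at t x \<alpha>)) (\<lambda>\<alpha>. v (poly_at t x \<alpha>)) else 0)"

definition phi_inf :: "('a, 'v::lie_space) lin_poly set \<Rightarrow> 'a \<Rightarrow> ('a, 'v) lin_poly tensor2 \<Rightarrow>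
    ('a, 'v) lin_poly \<Rightarrow> ('a, 'v) lin_poly \<Rightarrow> real" where
  "phi_inf P x Q = form_on P (\<lambda>\<gamma> \<delta>. Q (\<lambda>\<alpha>. g_inf x \<alpha> \<gamma>) (\<lambda>\<alpha>. g_inf x \<alpha> \<delta>))"

lemma linear_poly_at: "linear (poly_at t x)"
  by (rule linearI) (auto simp: poly_at_def scaleR_fun_def algebra_simps)

lemma linear_g_inf: "linear (\<lambda>\<alpha>. g_inf x \<alpha> \<gamma>)"
proof -
  have r: "linear (\<lambda>c. \<llangle>v, c\<rrangle>)" and l: "linear (\<lambda>c. \<llangle>c, v\<rrangle>)" for v :: 'b
    using lform_bilinear by (auto simp: bilinear_def)
  show ?thesis
    by (rule linearI)
      (auto simp: g_inf_def scaleR_fun_def linear_add[OF l] linear_scale[OF l]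
         linear_add[OF r] linear_scale[OF r] algebra_simps)
qed

lemma phi_at_sym_prod:
  fixes \<alpha> \<beta> :: "('a, 'v::lie_space) lin_poly"
  shows "phi_at t x (\<alpha> \<odot> \<beta>) = poly_at t x \<alpha> \<odot> poly_at t x \<beta>"
proof -
  have "linear (\<lambda>\<alpha>. u (poly_at t x \<alpha>))" if "linear u" for u :: "'v \<Rightarrow> real"
    using linear_compose[OF linear_poly_at that, of t x] by (simp add: o_def)
  then show ?thesis
    by (auto simp: phi_at_def sym_prod_def fun_eq_iff)
qed

lemma phi_inf_sym_prod:
  "phi_inf P x (\<alpha> \<odot> \<beta>) = form_on P (\<lambda>\<gamma> \<delta>.
     (g_inf x \<alpha> \<gamma> * g_inf x \<beta> \<delta> + g_inf x \<alpha> \<delta> * g_inf x \<beta> \<gamma>) / 2)"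
  by (simp add: phi_inf_def sym_prod_def linear_g_inf form_on_def fun_eq_iff mult.commute)

lemma linear_phi_at: "linear (phi_at t x)"
  by (rule linearI) (auto simp: phi_at_def scaleR_fun_def fun_eq_iff)

lemma linear_phi_inf: "linear (phi_inf P x)"
  by (rule linearI) (auto simp: phi_inf_def form_on_def scaleR_fun_def fun_eq_iff)

text \<open>\<open>\<phi>\<^sub>0 \<circ> \<phi>\<^sub>\<infinity>\<^sup>-\<^sup>1 (g\<^sub>\<infinity>)\<close> at \<open>x\<close>.\<close>

definition conserved_weingarten :: "('a, 'v::lie_space) lin_poly set \<Rightarrow> 'a \<Rightarrow> 'v tensor2" where
  "conserved_weingarten P x =
     phi_at 0 x (inv_into (sym_square P) (phi_inf P x) (form_on P (g_inf x)))"


section \<open>Surfaces in space forms\<close>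

definition space_form :: "'v::lie_space \<Rightarrow> 'v \<Rightarrow> 'v set" where
  "space_form \<qq> \<pp> = {y \<in> lightcone. \<llangle>y, \<qq>\<rrangle> = -1 \<and> \<llangle>y, \<pp>\<rrangle> = 0}"

definition space_form_data :: "'v::lie_space \<Rightarrow> 'v \<Rightarrow> bool" where
  "space_form_data \<qq> \<pp> \<longleftrightarrow>
     (\<llangle>\<pp>, \<pp>\<rrangle> = 1 \<or> \<llangle>\<pp>, \<pp>\<rrangle> = -1) \<and> \<qq> \<noteq> 0 \<and> \<llangle>\<qq>, \<pp>\<rrangle> = 0"

definition space_form_projection :: "'a::topological_space atlas \<Rightarrow> ('a \<Rightarrow> 'v::lie_space set) \<Rightarrow>
    'v \<Rightarrow> 'v \<Rightarrow> ('a \<Rightarrow> 'v) \<Rightarrow> bool" where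
  "space_form_projection A f \<qq> \<pp> \<ff> \<longleftrightarrow>
     section_on A f UNIV \<ff> \<and> (\<forall>x. \<ff> x \<in> space_form \<qq> \<pp>)"

definition tangent_plane_congruence :: "'a::topological_space atlas \<Rightarrow> ('a \<Rightarrow> 'v::lie_space set) \<Rightarrow>
    'v \<Rightarrow> 'v \<Rightarrow> ('a \<Rightarrow> 'v) \<Rightarrow> bool" where
  "tangent_plane_congruence A f \<qq> \<pp> \<tt> \<longleftrightarrow>
     section_on A f UNIV \<tt> \<and> (\<forall>x. \<llangle>\<tt> x, \<qq>\<rrangle> = 0 \<and> \<llangle>\<tt> x, \<pp>\<rrangle> = -1)"

definition immersed :: "'a atlas \<Rightarrow> ('a \<Rightarrow> 'w::real_normed_vector) \<Rightarrow> bool" where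
  "immersed A g \<longleftrightarrow> (\<forall>x. inj (dd A g x))"

definition principal_curvature :: "'a atlas \<Rightarrow> ('a \<Rightarrow> (real^2) set) \<Rightarrow>
    ('a \<Rightarrow> 'v::real_normed_vector) \<Rightarrow> ('a \<Rightarrow> 'v) \<Rightarrow> ('a \<Rightarrow> real) \<Rightarrow> bool" where
  "principal_curvature A T \<ff> \<tt> \<kappa> \<longleftrightarrow> (\<forall>x. \<forall>X\<in>T x. dd A \<tt> x X + \<kappa> x *\<^sub>R dd A \<ff> x X = 0)"

definition linear_weingarten ::
    "real \<Rightarrow> real \<Rightarrow> real \<Rightarrow> ('a \<Rightarrow> real) \<Rightarrow> ('a \<Rightarrow> real) \<Rightarrow> bool" where
  "linear_weingarten a b c \<kappa>\<^sub>1 \<kappa>\<^sub>2 \<longleftrightarrow> \<not> (a = 0 \<and> b = 0 \<and> c = 0) \<and>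
     (\<forall>x. let K = \<kappa>\<^sub>1 x * \<kappa>\<^sub>2 x; H = (\<kappa>\<^sub>1 x + \<kappa>\<^sub>2 x) / 2 in a * K + 2 * b * H + c = 0)"

definition tubular :: "real \<Rightarrow> real \<Rightarrow> real \<Rightarrow> bool" where
  "tubular a b c \<longleftrightarrow> b\<^sup>2 - a * c = 0"

end

theory Submission
  imports Defs
begin

text \<open>Write \<open>f = span {\<ff>, \<tt>}\<close>. The differentials \<open>d\<ff>\<close> and \<open>d\<tt>\<close> take values in \<open>f\<^sup>\<bottom>\<close> and are orthogonal
  to \<open>\<qq>\<close> and \<open>\<pp>\<close>; as the form is positive definite on \<open>f\<^sup>\<bottom>/f\<close>, they behave as in Riemannian
  geometry: \<open>d\<tt> = -\<kappa>\<^sub>i d\<ff>\<close> on \<open>T\<^sub>i\<close>, the directions \<open>T\<^sub>1\<close> and \<open>T\<^sub>2\<close> are transversal with orthogonal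
  images under \<open>d\<ff>\<close>, and \<open>s\<^sub>i\<close> is spanned by \<open>\<tt> + \<kappa>\<^sub>i\<ff>\<close>. The potential and its conserved quantities can be
  written down: put
  \<open>\<pp>\<^sub>1 = a\<tt> - b\<ff>\<close>, \<open>\<qq>\<^sub>1 = c\<ff> - b\<tt>\<close> and \<open>\<eta> = \<ff> \<and> d\<qq>\<^sub>1 + \<tt> \<and> d\<pp>\<^sub>1\<close>.

  As \<open>d\<^sup>2 = 0\<close>, evaluating \<open>d\<eta>\<close> on a pair of curvature directions gives
  \<open>2(a\<kappa>\<^sub>1\<kappa>\<^sub>2 + b(\<kappa>\<^sub>1 + \<kappa>\<^sub>2) + c)\<close> times \<open>d\<^sub>X\<ff> \<and> d\<^sub>Y\<ff>\<close>, so \<open>\<eta>\<close> is closed by the Weingarten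
  equation (\<open>potential_closed\<close>). Its quadratic differential is diagonal in curvature directions with
  entries proportional to \<open>a\<kappa>\<^sub>i\<^sup>2 + 2b\<kappa>\<^sub>i + c\<close>, which do not vanish by the Weingarten equation, since
  \<open>\<kappa>\<^sub>1 \<noteq> \<kappa>\<^sub>2\<close> and \<open>b\<^sup>2 \<noteq> ac\<close> (\<open>weingarten_polynomial_nonzero\<close>). Hence \<open>\<eta>\<close> shows that \<open>f\<close> is an \<open>\<Omega>\<close>-surface.

  This \<open>\<eta>\<close> is already the middle potential: on \<open>T\<^sub>1\<close> it equals
  \<open>-(a\<kappa>\<^sub>1 + b)(\<tt> + \<kappa>\<^sub>2\<ff>) \<and> d\<ff>\<close>, which lies in \<open>\<and>\<^sup>2S\<^sub>2 + \<and>\<^sup>2f\<close> (\<open>potential_T1\<close>), and symmetrically on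
  \<open>T\<^sub>2\<close>. It is the only middle potential of its orbit, because a gauge transformation that preserves
  the middle condition is trivial (\<open>middle_condition_unique\<close>). That argument rests on the Lie
  cyclides being of rank at most 3, i.e. on \<open>S\<^sub>1\<close> being spanned by one triple
  \<open>\<sigma>, \<sigma>\<^sub>Y, \<sigma>\<^sub>Y\<^sub>Y\<close> (\<open>lie_cyclide_subset_span\<close>).

  Since \<open>\<eta>\<close> annihilates \<open>f\<close> and maps \<open>\<pp>\<close> to \<open>-d\<pp>\<^sub>1\<close> and \<open>\<qq>\<close> to \<open>-d\<qq>\<^sub>1\<close>, the polynomials
  \<open>\<pp> + t\<pp>\<^sub>1\<close> and \<open>\<qq> + t\<qq>\<^sub>1\<close> are conserved. In this basis \<open>g\<^sub>\<infinity>\<close> has the Gram matrix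
  \<open>-2 (a, -b; -b, c)\<close>, and the coefficients of \<open>\<phi>\<^sub>\<infinity>\<^sup>-\<^sup>1(g\<^sub>\<infinity>)\<close> form the inverse matrix, a multiple of
  \<open>(c, b; b, a)\<close>. Its image under \<open>\<phi>\<^sub>0\<close> is therefore a multiple of
  \<open>a \<qq> \<odot> \<qq> + 2b \<qq> \<odot> \<pp> + c \<pp> \<odot> \<pp>\<close> (\<open>conserved_weingarten_eq\<close>).\<close>


section \<open>Calculus of smooth maps\<close>

lemma ck_on_mono_Suc: "ck_on (Suc k) S g \<Longrightarrow> ck_on k S g"
proof (induction k arbitrary: g)
  case 0
  then show ?case
    by (auto intro!: continuous_at_imp_continuous_on differentiable_imp_continuous_within)
next
  case (Suc k)
  then have "\<forall>x\<in>S. g differentiable at x" "\<forall>v. ck_on k S (\<lambda>x. frechet_derivative g (at x) v)"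
    unfolding ck_on.simps(2)[of "Suc k"] by (blast, auto intro: Suc.IH)
  then show ?case unfolding ck_on.simps by blast
qed

lemma ck_on_subset: "ck_on k S g \<Longrightarrow> S' \<subseteq> S \<Longrightarrow> ck_on k S' g"
proof (induction k arbitrary: g)
  case 0
  then show ?case by (auto intro: continuous_on_subset)
next
  case (Suc k)
  then show ?case by (auto simp: subset_iff)
qed

lemma ck_on_cong:
  assumes "open S" "\<And>x. x \<in> S \<Longrightarrow> g x = h x" "ck_on k S g"
  shows "ck_on k S h"
  using assms(2,3)
proof (induction k arbitrary: g h)
  case 0
  then show ?case by (simp cong: continuous_on_cong)
next
  case (Suc k)
  have "h differentiable at x" if "x \<in> S" for x
    using Suc.prems that assms(1)
    by (metis (no_types, lifting) ck_on.simps(2) differentiable_def has_derivative_transform_within_open)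
  moreover have "ck_on k S (\<lambda>x. frechet_derivative h (at x) v)" for v
  proof (rule Suc.IH)
    show "frechet_derivative g (at x) v = frechet_derivative h (at x) v" if "x \<in> S" for x
      using frechet_derivative_transform_within_open[of g x S h] Suc.prems that assms(1) by auto
    show "ck_on k S (\<lambda>x. frechet_derivative g (at x) v)"
      using Suc.prems by simp
  qed
  ultimately show ?case by simp
qed

lemma ck_on_const [simp]: "ck_on k S (\<lambda>_. c)"
  by (induction k arbitrary: c) simp_all

lemma frechet_derivativeI:
  "(g has_derivative g') (at x) \<Longrightarrow> frechet_derivative g (at x) = g'"
  by (rule frechet_derivative_at[symmetric])

lemma has_frechet_derivative:
  "g differentiable at x \<Longrightarrow> (g has_derivative frechet_derivative g (at x)) (at x)"
  by (simp add: frechet_derivative_works)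

lemma ck_on_add:
  assumes "open S" "ck_on k S g" "ck_on k S h"
  shows "ck_on k S (\<lambda>x. g x + h x)"
  using assms(2,3)
proof (induction k arbitrary: g h)
  case 0
  then show ?case by (simp add: continuous_on_add)
next
  case (Suc k)
  have D: "((\<lambda>x. g x + h x) has_derivative
      (\<lambda>v. frechet_derivative g (at x) v + frechet_derivative h (at x) v)) (at x)" if "x \<in> S" for x
    using Suc.prems that by (auto intro!: has_derivative_add has_frechet_derivative)
  have "ck_on k S (\<lambda>x. frechet_derivative (\<lambda>x. g x + h x) (at x) v)" for v
    by (rule ck_on_cong[OF assms(1) _ Suc.IH[of "\<lambda>x. frechet_derivative g (at x) v" "\<lambda>x. frechet_derivative h (at x) v"]])
      (use Suc.prems D frechet_derivativeI[OF D] in auto)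
  then show ?case
    using D by (auto simp: differentiable_def)
qed

lemma ck_on_bilinear:
  assumes "open S" "bounded_bilinear B" "ck_on k S g" "ck_on k S h"
  shows "ck_on k S (\<lambda>x. B (g x) (h x))"
  using assms(3,4)
proof (induction k arbitrary: g h)
  case 0
  then show ?case by (simp add: bounded_bilinear.continuous_on[OF assms(2)])
next
  case (Suc k)
  have D: "((\<lambda>x. B (g x) (h x)) has_derivative
      (\<lambda>v. B (g x) (frechet_derivative h (at x) v) + B (frechet_derivative g (at x) v) (h x))) (at x)"
    if "x \<in> S" for x
    using Suc.prems that
    by (intro bounded_bilinear.FDERIV[OF assms(2)] has_frechet_derivative) auto
  have "ck_on k S (\<lambda>x. frechet_derivative (\<lambda>x. B (g x) (h x)) (at x) v)" for v
  proof (rule ck_on_cong[OF assms(1)])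
    show "ck_on k S (\<lambda>x. B (g x) (frechet_derivative h (at x) v) + B (frechet_derivative g (at x) v) (h x))"
      using Suc.prems ck_on_mono_Suc[OF Suc.prems(1)] ck_on_mono_Suc[OF Suc.prems(2)]
      by (intro ck_on_add[OF assms(1)] Suc.IH) auto
  qed (simp add: frechet_derivativeI[OF D])
  then show ?case
    using D by (auto simp: differentiable_def)
qed

lemma ck_on_bounded_linear:
  assumes "open S" "bounded_linear L" "ck_on k S g"
  shows "ck_on k S (\<lambda>x. L (g x))"
proof -
  have "bounded_bilinear (\<lambda>(r::real) y. r *\<^sub>R L y)"
    using bounded_bilinear.comp[OF bounded_bilinear_scaleR bounded_linear_ident assms(2)] .
  from ck_on_bilinear[OF assms(1) this ck_on_const[of k S 1] assms(3)] show ?thesis by simp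
qed

lemma ck_on_sum:
  assumes "open S" "\<And>i. i \<in> I \<Longrightarrow> ck_on k S (g i)"
  shows "ck_on k S (\<lambda>x. \<Sum>i\<in>I. g i x)"
  using assms(2) by (induction I rule: infinite_finite_induct) (auto intro!: ck_on_add assms(1))

lemma frechet_derivative_Basis_expansion:
  fixes g :: "'e::euclidean_space \<Rightarrow> 'w::real_normed_vector"
  assumes "g differentiable at x"
  shows "frechet_derivative g (at x) v = (\<Sum>i\<in>Basis. (v \<bullet> i) *\<^sub>R frechet_derivative g (at x) i)"
proof -
  have L: "linear (frechet_derivative g (at x))"
    by (rule linear_frechet_derivative[OF assms])
  have "frechet_derivative g (at x) v = frechet_derivative g (at x) (\<Sum>i\<in>Basis. (v \<bullet> i) *\<^sub>R i)"
    by (simp add: euclidean_representation)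
  also have "\<dots> = (\<Sum>i\<in>Basis. (v \<bullet> i) *\<^sub>R frechet_derivative g (at x) i)"
    by (simp add: linear_sum[OF L] linear_scale[OF L])
  finally show ?thesis .
qed

text \<open>Expanding the inner derivative in the basis turns the chain rule into a finite sum of products of a
  function \<open>C\<^sup>k\<close> by assumption with a composition to which the induction hypothesis applies.\<close>

lemma ck_on_compose:
  fixes h :: "'e::real_normed_vector \<Rightarrow> 'f::euclidean_space"
  assumes "open S" "ck_on k S h" "ck_on k R g" "h ` S \<subseteq> R"
  shows "ck_on k S (\<lambda>x. g (h x))"
  using assms(2,3)
proof (induction k arbitrary: g)
  case 0
  then show ?case using continuous_on_compose2[OF _ _ assms(4), of g] by simp
next
  case (Suc k)
  have D: "((\<lambda>x. g (h x)) has_derivative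
      (\<lambda>v. frechet_derivative g (at (h x)) (frechet_derivative h (at x) v))) (at x)"
    if "x \<in> S" for x
    using Suc.prems that assms(4)
    by (intro has_derivative_compose[of h _ x UNIV g] has_frechet_derivative) auto
  have hk: "ck_on k S h" using ck_on_mono_Suc[OF Suc.prems(1)] .
  have "ck_on k S (\<lambda>x. frechet_derivative (\<lambda>x. g (h x)) (at x) v)" for v
  proof (rule ck_on_cong[OF assms(1)])
    show "ck_on k S (\<lambda>x. \<Sum>i\<in>Basis. (frechet_derivative h (at x) v \<bullet> i) *\<^sub>R
        frechet_derivative g (at (h x)) i)"
      using Suc.prems
      by (intro ck_on_sum ck_on_bilinear[OF _ bounded_bilinear_scaleR] assms(1) Suc.IH hk
          ck_on_bounded_linear[OF _ bounded_linear_inner_left]) auto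
    show "(\<Sum>i\<in>Basis. (frechet_derivative h (at x) v \<bullet> i) *\<^sub>R frechet_derivative g (at (h x)) i) =
        frechet_derivative (\<lambda>x. g (h x)) (at x) v" if "x \<in> S" for x
      using Suc.prems(2) that assms(4)
      by (auto simp: frechet_derivativeI[OF D[OF that]] frechet_derivative_Basis_expansion[of g, symmetric])
  qed
  then show ?case
    using D by (auto simp: differentiable_def)
qed

lemma ck_on_inverse:
  fixes g :: "'e::real_normed_vector \<Rightarrow> real"
  assumes "open S" "ck_on k S g" "\<And>x. x \<in> S \<Longrightarrow> g x \<noteq> 0"
  shows "ck_on k S (\<lambda>x. inverse (g x))"
  using assms(2)
proof (induction k)
  case 0
  then show ?case using assms(3) by (auto intro!: continuous_on_inverse)
next
  case (Suc k)
  have D: "((\<lambda>x. inverse (g x)) has_derivative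
      (\<lambda>v. - (inverse (g x) * frechet_derivative g (at x) v * inverse (g x)))) (at x)"
    if "x \<in> S" for x
    using Suc.prems that assms(3)
    by (intro Deriv.has_derivative_inverse has_frechet_derivative) auto
  have "ck_on k S (\<lambda>x. frechet_derivative (\<lambda>x. inverse (g x)) (at x) v)" for v
  proof (rule ck_on_cong[OF assms(1)])
    show "ck_on k S (\<lambda>x. - (inverse (g x) * frechet_derivative g (at x) v * inverse (g x)))"
      using Suc.prems Suc.IH ck_on_mono_Suc[OF Suc.prems]
      by (intro ck_on_bounded_linear[OF assms(1) bounded_linear_minus[OF bounded_linear_ident]]
          ck_on_bilinear[OF assms(1) bounded_bilinear_mult]) auto
  qed (simp add: frechet_derivativeI[OF D])
  then show ?case
    using D by (auto simp: differentiable_def)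
qed

lemma smooth_on_Suc:
  "smooth_on S g \<longleftrightarrow> (\<forall>x\<in>S. g differentiable (at x)) \<and>
     (\<forall>v. smooth_on S (\<lambda>x. frechet_derivative g (at x) v))"
proof
  assume g: "smooth_on S g"
  then have "ck_on (Suc k) S g" for k unfolding smooth_on_def by blast
  then show "(\<forall>x\<in>S. g differentiable (at x)) \<and> (\<forall>v. smooth_on S (\<lambda>x. frechet_derivative g (at x) v))"
    unfolding smooth_on_def ck_on.simps by blast
next
  assume "(\<forall>x\<in>S. g differentiable (at x)) \<and> (\<forall>v. smooth_on S (\<lambda>x. frechet_derivative g (at x) v))"
  then have "ck_on (Suc k) S g" for k unfolding smooth_on_def ck_on.simps by blast
  then show "smooth_on S g" unfolding smooth_on_def using ck_on_mono_Suc by blast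
qed

lemma smooth_on_differentiable: "smooth_on S g \<Longrightarrow> x \<in> S \<Longrightarrow> g differentiable (at x)"
  using smooth_on_Suc by blast

lemma smooth_on_frechet_derivative:
  "smooth_on S g \<Longrightarrow> smooth_on S (\<lambda>x. frechet_derivative g (at x) v)"
  using smooth_on_Suc by blast

lemma smooth_on_continuous: "smooth_on S g \<Longrightarrow> continuous_on S g"
  unfolding smooth_on_def using ck_on.simps(1)[of S g] by blast

lemma smooth_on_subset: "smooth_on S g \<Longrightarrow> S' \<subseteq> S \<Longrightarrow> smooth_on S' g"
  unfolding smooth_on_def using ck_on_subset by blast

lemma smooth_on_cong:
  "open S \<Longrightarrow> (\<And>x. x \<in> S \<Longrightarrow> g x = h x) \<Longrightarrow> smooth_on S g \<Longrightarrow> smooth_on S h"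
  unfolding smooth_on_def using ck_on_cong by metis

lemma smooth_on_const: "smooth_on S (\<lambda>_. c)"
  unfolding smooth_on_def by simp

lemma smooth_on_add:
  "open S \<Longrightarrow> smooth_on S g \<Longrightarrow> smooth_on S h \<Longrightarrow> smooth_on S (\<lambda>x. g x + h x)"
  unfolding smooth_on_def using ck_on_add by blast

lemma smooth_on_sum:
  "open S \<Longrightarrow> (\<And>i. i \<in> I \<Longrightarrow> smooth_on S (g i)) \<Longrightarrow> smooth_on S (\<lambda>x. \<Sum>i\<in>I. g i x)"
  unfolding smooth_on_def by (auto intro: ck_on_sum)

lemma smooth_on_bilinear:
  "open S \<Longrightarrow> bounded_bilinear B \<Longrightarrow> smooth_on S g \<Longrightarrow> smooth_on S h \<Longrightarrow>
    smooth_on S (\<lambda>x. B (g x) (h x))"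
  unfolding smooth_on_def using ck_on_bilinear by blast

lemma smooth_on_bounded_linear:
  "open S \<Longrightarrow> bounded_linear L \<Longrightarrow> smooth_on S g \<Longrightarrow> smooth_on S (\<lambda>x. L (g x))"
  unfolding smooth_on_def using ck_on_bounded_linear by blast

lemma smooth_on_compose:
  fixes h :: "'e::real_normed_vector \<Rightarrow> 'f::euclidean_space"
  shows "open S \<Longrightarrow> smooth_on S h \<Longrightarrow> smooth_on R g \<Longrightarrow> h ` S \<subseteq> R \<Longrightarrow> smooth_on S (\<lambda>x. g (h x))"
  unfolding smooth_on_def by (auto intro: ck_on_compose)

lemma smooth_on_inverse:
  fixes g :: "'e::real_normed_vector \<Rightarrow> real"
  shows "open S \<Longrightarrow> smooth_on S g \<Longrightarrow> (\<And>x. x \<in> S \<Longrightarrow> g x \<noteq> 0) \<Longrightarrow> smooth_on S (\<lambda>x. inverse (g x))"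
  unfolding smooth_on_def by (auto intro: ck_on_inverse)

lemma smooth_on_directional_derivative:
  fixes g :: "'e::euclidean_space \<Rightarrow> 'w::real_normed_vector"
  assumes "open S" "smooth_on S g" "smooth_on S Y"
  shows "smooth_on S (\<lambda>x. frechet_derivative g (at x) (Y x))"
proof (rule smooth_on_cong[OF assms(1)])
  show "smooth_on S (\<lambda>x. \<Sum>i\<in>Basis. (Y x \<bullet> i) *\<^sub>R frechet_derivative g (at x) i)"
    by (intro smooth_on_sum smooth_on_bilinear[OF _ bounded_bilinear_scaleR] assms
        smooth_on_bounded_linear[OF _ bounded_linear_inner_left] smooth_on_frechet_derivative)
  show "(\<Sum>i\<in>Basis. (Y x \<bullet> i) *\<^sub>R frechet_derivative g (at x) i) =
      frechet_derivative g (at x) (Y x)" if "x \<in> S" for x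
    by (rule frechet_derivative_Basis_expansion[OF smooth_on_differentiable[OF assms(2) that], symmetric])
qed

text \<open>Applying the mean value theorem once in each direction writes the second difference of \<open>g\<close>
  over a small parallelogram as \<open>h\<^sup>2\<close> times a mixed second derivative at an intermediate point.\<close>

lemma second_difference_mean_value:
  fixes g :: "'e::real_normed_vector \<Rightarrow> real"
  assumes "h > 0"
    and S: "\<And>s t. \<lbrakk>0 \<le> s; s \<le> h; 0 \<le> t; t \<le> h\<rbrakk> \<Longrightarrow> x + s *\<^sub>R u + t *\<^sub>R v \<in> S"
    and g: "\<And>y. y \<in> S \<Longrightarrow> g differentiable (at y)"
    and gu: "\<And>y. y \<in> S \<Longrightarrow> (\<lambda>y. frechet_derivative g (at y) u) differentiable (at y)"
  obtains \<xi> \<zeta> where "0 < \<xi>" "\<xi> < h" "0 < \<zeta>" "\<zeta> < h"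
    "g (x + h *\<^sub>R u + h *\<^sub>R v) - g (x + h *\<^sub>R u) - g (x + h *\<^sub>R v) + g x =
     h\<^sup>2 * frechet_derivative (\<lambda>y. frechet_derivative g (at y) u) (at (x + \<xi> *\<^sub>R u + \<zeta> *\<^sub>R v)) v"
proof -
  have du: "((\<lambda>s. k (y + s *\<^sub>R w)) has_real_derivative frechet_derivative k (at (y + s *\<^sub>R w)) w) (at s)"
    if "k differentiable (at (y + s *\<^sub>R w))" for y w :: 'e and s and k :: "'e \<Rightarrow> real"
  proof -
    have "((\<lambda>s. k (y + s *\<^sub>R w)) has_derivative
        (\<lambda>r. frechet_derivative k (at (y + s *\<^sub>R w)) (r *\<^sub>R w))) (at s)"
    proof (rule has_derivative_compose[of "\<lambda>s. y + s *\<^sub>R w" _ s UNIV k])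
      show "((\<lambda>s. y + s *\<^sub>R w) has_derivative (\<lambda>r. r *\<^sub>R w)) (at s)"
        by (auto intro!: derivative_eq_intros)
    qed (rule has_frechet_derivative[OF that])
    moreover have "frechet_derivative k (at (y + s *\<^sub>R w)) (r *\<^sub>R w) =
        frechet_derivative k (at (y + s *\<^sub>R w)) w * r" for r
      by (simp add: linear_scale[OF linear_frechet_derivative[OF that]] mult.commute)
    ultimately show ?thesis
      by (simp add: has_field_derivative_def)
  qed
  let ?D = "\<lambda>y. frechet_derivative g (at y) u"
  have "\<exists>z. 0 < z \<and> z < h \<and>
     (g (x + h *\<^sub>R v + h *\<^sub>R u) - g (x + h *\<^sub>R u)) - (g (x + h *\<^sub>R v + 0 *\<^sub>R u) - g (x + 0 *\<^sub>R u)) =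
     (h - 0) * (?D (x + h *\<^sub>R v + z *\<^sub>R u) - ?D (x + z *\<^sub>R u))"
  proof (rule MVT2[where f = "\<lambda>s. g (x + h *\<^sub>R v + s *\<^sub>R u) - g (x + s *\<^sub>R u)", OF \<open>h > 0\<close>])
    fix s assume s: "0 \<le> s" "s \<le> h"
    have "x + h *\<^sub>R v + s *\<^sub>R u \<in> S" "x + s *\<^sub>R u \<in> S"
      using S[of s h] S[of s 0] s \<open>h > 0\<close> by (auto simp: algebra_simps)
    then show "((\<lambda>s. g (x + h *\<^sub>R v + s *\<^sub>R u) - g (x + s *\<^sub>R u)) has_real_derivative
        ?D (x + h *\<^sub>R v + s *\<^sub>R u) - ?D (x + s *\<^sub>R u)) (at s)"
      by (intro DERIV_diff du g)
  qed
  then obtain \<xi> where \<xi>: "0 < \<xi>" "\<xi> < h" and 1: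
     "(g (x + h *\<^sub>R v + h *\<^sub>R u) - g (x + h *\<^sub>R u)) - (g (x + h *\<^sub>R v) - g x) =
     h * (?D (x + h *\<^sub>R v + \<xi> *\<^sub>R u) - ?D (x + \<xi> *\<^sub>R u))" by auto
  have "\<exists>z. 0 < z \<and> z < h \<and> ?D (x + \<xi> *\<^sub>R u + h *\<^sub>R v) - ?D (x + \<xi> *\<^sub>R u + 0 *\<^sub>R v) =
     (h - 0) * frechet_derivative ?D (at (x + \<xi> *\<^sub>R u + z *\<^sub>R v)) v"
  proof (rule MVT2[where f = "\<lambda>t. ?D (x + \<xi> *\<^sub>R u + t *\<^sub>R v)", OF \<open>h > 0\<close>])
    fix t assume "0 \<le> t" "t \<le> h"
    then have "x + \<xi> *\<^sub>R u + t *\<^sub>R v \<in> S" using S \<xi> by auto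
    then show "((\<lambda>t. ?D (x + \<xi> *\<^sub>R u + t *\<^sub>R v)) has_real_derivative
        frechet_derivative ?D (at (x + \<xi> *\<^sub>R u + t *\<^sub>R v)) v) (at t)"
      by (intro du gu)
  qed
  then obtain \<zeta> where \<zeta>: "0 < \<zeta>" "\<zeta> < h" and 2:
     "?D (x + \<xi> *\<^sub>R u + h *\<^sub>R v) - ?D (x + \<xi> *\<^sub>R u) =
     h * frechet_derivative ?D (at (x + \<xi> *\<^sub>R u + \<zeta> *\<^sub>R v)) v" by auto
  have "x + h *\<^sub>R v + \<xi> *\<^sub>R u = x + \<xi> *\<^sub>R u + h *\<^sub>R v" "x + h *\<^sub>R v + h *\<^sub>R u = x + h *\<^sub>R u + h *\<^sub>R v"
    by (simp_all add: algebra_simps)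
  with 1 2 have "g (x + h *\<^sub>R u + h *\<^sub>R v) - g (x + h *\<^sub>R u) - g (x + h *\<^sub>R v) + g x =
     h\<^sup>2 * frechet_derivative ?D (at (x + \<xi> *\<^sub>R u + \<zeta> *\<^sub>R v)) v"
    by (simp add: power2_eq_square)
  with \<xi> \<zeta> that show ?thesis by blast
qed

text \<open>The second difference is symmetric in \<open>u\<close> and \<open>v\<close>, so the two mixed second derivatives agree up
  to a displacement of the point that tends to zero with the parallelogram.\<close>

lemma second_derivative_symmetric_real:
  fixes g :: "'e::real_normed_vector \<Rightarrow> real"
  assumes "open S" "smooth_on S g" "x \<in> S"
  shows "frechet_derivative (\<lambda>y. frechet_derivative g (at y) u) (at x) v =
         frechet_derivative (\<lambda>y. frechet_derivative g (at y) v) (at x) u"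
proof (rule ccontr)
  let ?H = "\<lambda>u v y. frechet_derivative (\<lambda>y. frechet_derivative g (at y) u) (at y) v"
  define e where "e = \<bar>?H u v x - ?H v u x\<bar> / 2"
  assume "\<not> ?thesis"
  then have "e > 0" by (simp add: e_def)
  have cont: "isCont (?H u v) x" for u v
    using smooth_on_continuous[OF smooth_on_frechet_derivative[OF smooth_on_frechet_derivative[OF assms(2), of u], of v]]
    unfolding continuous_on_eq_continuous_at[OF assms(1)] by (rule bspec) (rule assms(3))
  obtain d1 where d1: "d1 > 0" "\<And>y. dist y x < d1 \<Longrightarrow> dist (?H u v y) (?H u v x) < e"
    using cont[of u v] \<open>e > 0\<close> unfolding continuous_at_eps_delta by blast
  obtain d2 where d2: "d2 > 0" "\<And>y. dist y x < d2 \<Longrightarrow> dist (?H v u y) (?H v u x) < e"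
    using cont[of v u] \<open>e > 0\<close> unfolding continuous_at_eps_delta by blast
  obtain d3 where d3: "d3 > 0" "ball x d3 \<subseteq> S"
    using assms by (meson open_contains_ball)
  define d where "d = min d1 (min d2 d3)"
  \<comment> \<open>small enough for the parallelogram spanned by \<open>h u\<close> and \<open>h v\<close> at \<open>x\<close> to stay within distance \<open>d\<close>\<close>
  define h where "h = d / (2 * (norm u + norm v + 1))"
  have "d > 0" using d1 d2 d3 by (simp add: d_def)
  have pos: "norm u + norm v + 1 > 0" by (simp add: add_nonneg_pos)
  have "h > 0" unfolding h_def using \<open>d > 0\<close> pos by simp
  have hd: "h * (norm u + norm v) < d"
  proof -
    have "h * (norm u + norm v) \<le> h * (norm u + norm v + 1)" using \<open>h > 0\<close> by simp
    also have "\<dots> = d / 2" using pos by (simp add: h_def field_simps)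
    finally show ?thesis using \<open>d > 0\<close> by simp
  qed
  have near: "dist (x + s *\<^sub>R w + t *\<^sub>R w') x < d"
    if "0 \<le> s" "s \<le> h" "0 \<le> t" "t \<le> h" "norm w + norm w' = norm u + norm v" for s t w w'
  proof -
    have "dist (x + s *\<^sub>R w + t *\<^sub>R w') x = norm (s *\<^sub>R w + t *\<^sub>R w')" by (simp add: dist_norm algebra_simps)
    also have "\<dots> \<le> s * norm w + t * norm w'"
      using that norm_triangle_ineq[of "s *\<^sub>R w" "t *\<^sub>R w'"] by simp
    also have "\<dots> \<le> h * norm w + h * norm w'" using that by (intro add_mono mult_right_mono) auto
    also have "\<dots> = h * (norm u + norm v)" using that by (simp flip: distrib_left)
    finally show ?thesis using hd by simp
  qed
  have inS: "y \<in> S" if "dist y x < d" for y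
    using that d3 by (auto simp: d_def dist_commute)
  have mv: "\<exists>y. dist y x < d \<and> g (x + h *\<^sub>R w + h *\<^sub>R w') - g (x + h *\<^sub>R w) - g (x + h *\<^sub>R w') + g x = h\<^sup>2 * ?H w w' y"
    if n: "norm w + norm w' = norm u + norm v" for w w'
  proof -
    obtain \<xi> \<zeta> where "0 < \<xi>" "\<xi> < h" "0 < \<zeta>" "\<zeta> < h"
      "g (x + h *\<^sub>R w + h *\<^sub>R w') - g (x + h *\<^sub>R w) - g (x + h *\<^sub>R w') + g x = h\<^sup>2 * ?H w w' (x + \<xi> *\<^sub>R w + \<zeta> *\<^sub>R w')"
      by (rule second_difference_mean_value[OF \<open>h > 0\<close>, of x w w' S g])
        (use \<open>h > 0\<close> inS[OF near[OF _ _ _ _ n]] smooth_on_differentiable[OF assms(2)]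
          smooth_on_differentiable[OF smooth_on_frechet_derivative[OF assms(2)]] in auto)
    with near[of \<xi> \<zeta> w w'] n show ?thesis by auto
  qed
  obtain y where y: "dist y x < d"
     "g (x + h *\<^sub>R u + h *\<^sub>R v) - g (x + h *\<^sub>R u) - g (x + h *\<^sub>R v) + g x = h\<^sup>2 * ?H u v y"
    using mv[of u v] by auto
  obtain z where z: "dist z x < d"
     "g (x + h *\<^sub>R v + h *\<^sub>R u) - g (x + h *\<^sub>R v) - g (x + h *\<^sub>R u) + g x = h\<^sup>2 * ?H v u z"
    using mv[of v u] by auto
  have "g (x + h *\<^sub>R u + h *\<^sub>R v) = g (x + h *\<^sub>R v + h *\<^sub>R u)" by (simp add: algebra_simps)
  with y(2) z(2) have "h\<^sup>2 * ?H u v y = h\<^sup>2 * ?H v u z" by linarith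
  then have "?H u v y = ?H v u z" using \<open>h > 0\<close> by simp
  moreover have "dist (?H u v y) (?H u v x) < e" "dist (?H v u z) (?H v u x) < e"
    using d1(2)[of y] d2(2)[of z] y(1) z(1) by (auto simp: d_def)
  ultimately have "\<bar>?H u v x - ?H v u x\<bar> < 2 * e" by (simp add: dist_real_def)
  then show False by (simp add: e_def)
qed

lemma second_derivative_symmetric:
  fixes g :: "'e::real_normed_vector \<Rightarrow> 'w::euclidean_space"
  assumes "open S" "smooth_on S g" "x \<in> S"
  shows "frechet_derivative (\<lambda>y. frechet_derivative g (at y) u) (at x) v =
         frechet_derivative (\<lambda>y. frechet_derivative g (at y) v) (at x) u"
proof (rule euclidean_eqI)
  fix b :: 'w assume "b \<in> Basis"
  have comp: "frechet_derivative (\<lambda>y. k y \<bullet> b) (at y) w = frechet_derivative k (at y) w \<bullet> b"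
    if "k differentiable at y" for k :: "'e \<Rightarrow> 'w" and y w
    by (rule fun_cong[OF frechet_derivativeI])
      (intro bounded_linear.has_derivative[OF bounded_linear_inner_left] has_frechet_derivative that)
  have two: "frechet_derivative (\<lambda>y. frechet_derivative (\<lambda>y. g y \<bullet> b) (at y) u) (at x) v =
      frechet_derivative (\<lambda>y. frechet_derivative g (at y) u) (at x) v \<bullet> b" for u v
  proof -
    have d: "(\<lambda>y. frechet_derivative g (at y) u) differentiable at x"
      using smooth_on_differentiable[OF smooth_on_frechet_derivative[OF assms(2)]] assms(3) by blast
    then have d': "(\<lambda>y. frechet_derivative g (at y) u \<bullet> b) differentiable at x"
      by (auto simp: differentiable_def intro: bounded_linear.has_derivative[OF bounded_linear_inner_left])
    have "frechet_derivative (\<lambda>y. frechet_derivative g (at y) u \<bullet> b) (at x) =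
        frechet_derivative (\<lambda>y. frechet_derivative (\<lambda>y. g y \<bullet> b) (at y) u) (at x)"
      by (rule frechet_derivative_transform_within_open[OF d' assms(1,3)])
        (simp add: comp smooth_on_differentiable[OF assms(2)])
    from fun_cong[OF this, of v] comp[OF d, of v] show ?thesis by simp
  qed
  have "smooth_on S (\<lambda>y. g y \<bullet> b)"
    by (intro smooth_on_bounded_linear[OF _ bounded_linear_inner_left] assms)
  from second_derivative_symmetric_real[OF assms(1) this assms(3)]
  show "frechet_derivative (\<lambda>y. frechet_derivative g (at y) u) (at x) v \<bullet> b =
      frechet_derivative (\<lambda>y. frechet_derivative g (at y) v) (at x) u \<bullet> b"
    by (simp add: two)
qed


section \<open>Derivatives on a surface\<close>

locale smooth_surface =
  fixes A :: "'a::{t2_space,second_countable_topology} atlas"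
  assumes atlas: "smooth_atlas A"
begin

lemma chart_center [simp]: "p \<in> chart_dom A p"
  and chart_open [simp]: "open (chart_dom A p)"
  and chart_image_open: "open (chart_map A p ` chart_dom A p)"
  and chart_homeomorphism:
    "homeomorphism (chart_dom A p) (chart_map A p ` chart_dom A p) (chart_map A p) (chart_inv A p)"
  and transition_smooth:
    "smooth_on (chart_map A p ` (chart_dom A p \<inter> chart_dom A q)) (chart_map A q \<circ> chart_inv A p)"
  using atlas unfolding smooth_atlas_def by blast+

lemma chart_inv_map [simp]: "r \<in> chart_dom A p \<Longrightarrow> chart_inv A p (chart_map A p r) = r"
  using homeomorphism_apply1[OF chart_homeomorphism] .

lemma open_chart_image: "open W \<Longrightarrow> open (chart_map A p ` (chart_dom A p \<inter> W))"
  using homeomorphism_imp_open_map[OF chart_homeomorphism, of p "chart_dom A p \<inter> W"]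
  by (meson chart_image_open chart_open open_Int open_openin_trans openin_open_trans Int_lower1 openin_open_Int)

text \<open>Transition maps being smooth, one chart that contains the domain suffices to test smoothness.\<close>

lemma smooth_map_single_chart:
  assumes "open W" "W \<subseteq> chart_dom A p" "smooth_on (chart_map A p ` W) (g \<circ> chart_inv A p)"
  shows "smooth_map A W g"
  unfolding smooth_map_def
proof
  fix q
  let ?S = "chart_map A q ` (chart_dom A q \<inter> W)"
  have op: "open ?S" using assms(1) by (rule open_chart_image)
  have "smooth_on ?S (chart_map A p \<circ> chart_inv A q)"
    using transition_smooth[of q p] by (rule smooth_on_subset) (use assms(2) in auto)
  then have "smooth_on ?S (\<lambda>y. (g \<circ> chart_inv A p) ((chart_map A p \<circ> chart_inv A q) y))"
    by (rule smooth_on_compose[OF op _ assms(3)]) auto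
  then show "smooth_on ?S (g \<circ> chart_inv A q)"
    by (rule smooth_on_cong[OF op, rotated]) (use assms(2) in auto)
qed

lemma smooth_map_chart:
  "smooth_map A W g \<Longrightarrow> smooth_on (chart_map A p ` (chart_dom A p \<inter> W)) (g \<circ> chart_inv A p)"
  unfolding smooth_map_def by blast

lemma smooth_map_subset: "smooth_map A W g \<Longrightarrow> W' \<subseteq> W \<Longrightarrow> smooth_map A W' g"
  unfolding smooth_map_def using smooth_on_subset by (metis Int_mono image_mono order_refl)

lemma smooth_map_const: "smooth_map A W (\<lambda>_. c)"
  unfolding smooth_map_def o_def by (simp add: smooth_on_const)

lemma smooth_map_add:
  "open W \<Longrightarrow> smooth_map A W g \<Longrightarrow> smooth_map A W h \<Longrightarrow> smooth_map A W (\<lambda>x. g x + h x)"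
  unfolding smooth_map_def o_def by (simp add: smooth_on_add open_chart_image)

lemma smooth_map_bilinear:
  "open W \<Longrightarrow> bounded_bilinear B \<Longrightarrow> smooth_map A W g \<Longrightarrow> smooth_map A W h \<Longrightarrow>
    smooth_map A W (\<lambda>x. B (g x) (h x))"
  unfolding smooth_map_def o_def by (metis open_chart_image smooth_on_bilinear)

lemma smooth_map_bounded_linear:
  "open W \<Longrightarrow> bounded_linear L \<Longrightarrow> smooth_map A W g \<Longrightarrow> smooth_map A W (\<lambda>x. L (g x))"
  unfolding smooth_map_def o_def by (metis open_chart_image smooth_on_bounded_linear)

lemma smooth_map_divide:
  fixes g h :: "'a \<Rightarrow> real"
  assumes "open W" "smooth_map A W g" "smooth_map A W h" "\<And>x. x \<in> W \<Longrightarrow> h x \<noteq> 0"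
  shows "smooth_map A W (\<lambda>x. g x / h x)"
proof -
  have "smooth_map A W (\<lambda>x. inverse (h x))"
    using assms unfolding smooth_map_def o_def
    by (auto intro!: smooth_on_inverse open_chart_image)
  from smooth_map_bilinear[OF assms(1) bounded_bilinear_mult assms(2) this]
  show ?thesis by (simp add: divide_inverse)
qed

lemma smooth_map_has_derivative:
  assumes "open W" "smooth_map A W g" "r \<in> W" "r \<in> chart_dom A p"
  shows "((g \<circ> chart_inv A p) has_derivative
    frechet_derivative (g \<circ> chart_inv A p) (at (chart_map A p r))) (at (chart_map A p r))"
  by (intro has_frechet_derivative smooth_on_differentiable[OF smooth_map_chart[OF assms(2)]])
    (use assms in auto)

lemma has_derivative_dd:
  assumes "open W" "smooth_map A W g" "p \<in> W"
  shows "((g \<circ> chart_inv A p) has_derivative dd A g p) (at (chart_map A p p))"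
  using smooth_map_has_derivative[OF assms, of p] unfolding dd_def by simp

lemma dd_eqI:
  assumes "((g \<circ> chart_inv A p) has_derivative D) (at (chart_map A p p))"
  shows "dd A g p X = D X"
  unfolding dd_def by (simp add: frechet_derivativeI[OF assms])

lemma linear_dd: "open W \<Longrightarrow> smooth_map A W g \<Longrightarrow> p \<in> W \<Longrightarrow> linear (dd A g p)"
  using has_derivative_dd by (rule has_derivative_linear)

lemma dd_const [simp]: "dd A (\<lambda>_. c) p X = 0"
  unfolding dd_def o_def by simp

lemma dd_cong:
  assumes W: "open W" "p \<in> W" and g: "smooth_map A W g" and eq: "\<And>r. r \<in> W \<Longrightarrow> g r = h r"
  shows "dd A h p X = dd A g p X"
proof (rule dd_eqI, rule has_derivative_transform_within_open[OF has_derivative_dd[OF W(1) g W(2)]])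
  show "open (chart_map A p ` (chart_dom A p \<inter> W))" using W(1) by (rule open_chart_image)
qed (use W eq in auto)

lemma dd_bilinear:
  assumes "open W" "p \<in> W" "bounded_bilinear B" "smooth_map A W g" "smooth_map A W h"
  shows "dd A (\<lambda>r. B (g r) (h r)) p X = B (g p) (dd A h p X) + B (dd A g p X) (h p)"
proof (rule dd_eqI)
  show "((\<lambda>r. B (g r) (h r)) \<circ> chart_inv A p has_derivative
      (\<lambda>X. B (g p) (dd A h p X) + B (dd A g p X) (h p))) (at (chart_map A p p))"
    using bounded_bilinear.FDERIV[OF assms(3) has_derivative_dd[OF assms(1,4,2)]
        has_derivative_dd[OF assms(1,5,2)]]
    by (simp add: o_def)
qed

lemma dd_bounded_linear:
  assumes "open W" "p \<in> W" "bounded_linear L" "smooth_map A W g"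
  shows "dd A (\<lambda>r. L (g r)) p X = L (dd A g p X)"
  using bounded_linear.has_derivative[OF assms(3) has_derivative_dd[OF assms(1,4,2)]]
  by (intro dd_eqI) (simp add: o_def)

lemma dd_add:
  assumes "open W" "p \<in> W" "smooth_map A W g" "smooth_map A W h"
  shows "dd A (\<lambda>r. g r + h r) p X = dd A g p X + dd A h p X"
  using has_derivative_add[OF has_derivative_dd[OF assms(1,3,2)] has_derivative_dd[OF assms(1,4,2)]]
  by (intro dd_eqI) (simp add: o_def)

lemma has_derivative_transition:
  assumes "r \<in> chart_dom A p" "r \<in> chart_dom A q"
  shows "((chart_map A q \<circ> chart_inv A p) has_derivative tchange A p q r) (at (chart_map A p r))"
proof -
  have "(chart_map A q \<circ> chart_inv A p) differentiable (at (chart_map A p r))"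
    using smooth_on_differentiable[OF transition_smooth] assms by auto
  then show ?thesis unfolding tchange_def by (rule has_frechet_derivative)
qed

text \<open>Tangent vectors at \<open>r\<close> refer to the chart centred at \<open>r\<close>, which changes from point to point. The
  chain rule expresses a derivative at \<open>r\<close> in a chart that is kept fixed.\<close>

lemma derivative_chart_change:
  assumes "open W" "smooth_map A W g" "r \<in> W" "r \<in> chart_dom A p" "r \<in> chart_dom A q"
  shows "frechet_derivative (g \<circ> chart_inv A q) (at (chart_map A q r)) (tchange A p q r v) =
    frechet_derivative (g \<circ> chart_inv A p) (at (chart_map A p r)) v"
proof -
  let ?D = "frechet_derivative (g \<circ> chart_inv A q) (at (chart_map A q r))"
  have "((g \<circ> chart_inv A q) has_derivative ?D) (at ((chart_map A q \<circ> chart_inv A p) (chart_map A p r)))"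
    using smooth_map_has_derivative[OF assms(1-3) assms(5)] assms(4) by simp
  from diff_chain_at[OF has_derivative_transition[OF assms(4,5)] this]
  have "((g \<circ> chart_inv A q) \<circ> (chart_map A q \<circ> chart_inv A p) has_derivative ?D \<circ> tchange A p q r)
      (at (chart_map A p r))" .
  then have "((g \<circ> chart_inv A p) has_derivative ?D \<circ> tchange A p q r) (at (chart_map A p r))"
    by (rule has_derivative_transform_within_open[OF _
          open_chart_image[OF open_Int[OF assms(1) chart_open[of q]], of p]])
      (use assms in auto)
  from frechet_derivativeI[OF this] show ?thesis by simp
qed

lemma dd_tchange:
  assumes "open W" "smooth_map A W g" "r \<in> W" "r \<in> chart_dom A p"
  shows "dd A g r (tchange A p r r v) = frechet_derivative (g \<circ> chart_inv A p) (at (chart_map A p r)) v"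
  unfolding dd_def using assms by (intro derivative_chart_change) auto

lemma smooth_chart_map: "smooth_map A (chart_dom A s) (chart_map A s)"
  unfolding smooth_map_def using transition_smooth by auto

lemma tchange_tchange:
  assumes "r \<in> chart_dom A p" "r \<in> chart_dom A q" "r \<in> chart_dom A s"
  shows "tchange A q s r (tchange A p q r v) = tchange A p s r v"
  using derivative_chart_change[OF chart_open smooth_chart_map, of r s p q v] assms
  unfolding tchange_def[of A q s] tchange_def[of A p s] by simp

lemma tchange_same:
  assumes "r \<in> chart_dom A p"
  shows "tchange A p p r v = v"
proof -
  have "((chart_map A p \<circ> chart_inv A p) has_derivative (\<lambda>v. v)) (at (chart_map A p r))"
    by (rule has_derivative_transform_within_open[OF has_derivative_ident chart_image_open[of p]])
      (use assms in auto)
  then show ?thesis unfolding tchange_def by (simp add: frechet_derivativeI)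
qed

lemma linear_tchange: "r \<in> chart_dom A p \<Longrightarrow> r \<in> chart_dom A q \<Longrightarrow> linear (tchange A p q r)"
  using has_derivative_transition by (rule has_derivative_linear)

lemma dd_in_chart:
  assumes "open W" "smooth_map A W g" "r \<in> W" "r \<in> chart_dom A p"
  shows "dd A g r v = frechet_derivative (g \<circ> chart_inv A p) (at (chart_map A p r)) (tchange A r p r v)"
  using dd_tchange[OF assms, of "tchange A r p r v"] assms by (simp add: tchange_tchange tchange_same)

lemma smooth_map_dd:
  assumes "open W" "smooth_map A W g" "smooth_field A W Y"
  shows "smooth_map A W (\<lambda>r. dd A g r (Y r))"
  unfolding smooth_map_def
proof
  fix p
  let ?S = "chart_map A p ` (chart_dom A p \<inter> W)"
  have op: "open ?S" using assms(1) by (rule open_chart_image)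
  show "smooth_on ?S ((\<lambda>r. dd A g r (Y r)) \<circ> chart_inv A p)"
  proof (rule smooth_on_cong[OF op])
    show "smooth_on ?S (\<lambda>y. frechet_derivative (g \<circ> chart_inv A p) (at y)
        (((\<lambda>r. tchange A r p r (Y r)) \<circ> chart_inv A p) y))"
      using assms(3) unfolding smooth_field_def
      by (intro smooth_on_directional_derivative[OF op] smooth_map_chart[OF assms(2)]) blast
  qed (use assms in \<open>auto simp: dd_in_chart\<close>)
qed

text \<open>Vector fields are built from their components in one chart. In any other chart the components are
  the derivative of the transition map, applied to the given ones.\<close>

lemma smooth_field_single_chart:
  assumes "open W" "W \<subseteq> chart_dom A p" "smooth_on (chart_map A p ` W) Z"
  shows "smooth_field A W (\<lambda>r. tchange A p r r (Z (chart_map A p r)))"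
  unfolding smooth_field_def
proof
  fix q
  let ?S = "chart_map A q ` (chart_dom A q \<inter> W)" and ?T = "chart_map A p ` (chart_dom A p \<inter> (chart_dom A q \<inter> W))"
  have op: "open ?S" "open ?T" using assms(1) by (auto intro!: open_chart_image)
  have 1: "smooth_on ?T (\<lambda>z. frechet_derivative (chart_map A q \<circ> chart_inv A p) (at z) (Z z))"
    by (intro smooth_on_directional_derivative op smooth_on_subset[OF transition_smooth]
        smooth_on_subset[OF assms(3)]) auto
  have "smooth_on ?S (chart_map A p \<circ> chart_inv A q)"
    by (rule smooth_on_subset[OF transition_smooth]) (use assms(2) in auto)
  have "(chart_map A p \<circ> chart_inv A q) ` ?S \<subseteq> ?T"
    using assms(2) by auto
  from smooth_on_compose[OF op(1) \<open>smooth_on ?S (chart_map A p \<circ> chart_inv A q)\<close> 1 this]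
  have "smooth_on ?S (\<lambda>y. frechet_derivative (chart_map A q \<circ> chart_inv A p)
      (at ((chart_map A p \<circ> chart_inv A q) y)) (Z ((chart_map A p \<circ> chart_inv A q) y)))" .
  then show "smooth_on ?S ((\<lambda>r. tchange A r q r (tchange A p r r (Z (chart_map A p r)))) \<circ> chart_inv A q)"
  proof (rule smooth_on_cong[OF op(1), rotated])
    fix y assume "y \<in> ?S"
    then obtain r where r: "r \<in> chart_dom A q" "r \<in> W" "y = chart_map A q r" by auto
    then have "tchange A r q r (tchange A p r r (Z (chart_map A p r))) = tchange A p q r (Z (chart_map A p r))"
      using assms(2) by (intro tchange_tchange) auto
    with r show "frechet_derivative (chart_map A q \<circ> chart_inv A p)
      (at ((chart_map A p \<circ> chart_inv A q) y)) (Z ((chart_map A p \<circ> chart_inv A q) y)) =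
      ((\<lambda>r. tchange A r q r (tchange A p r r (Z (chart_map A p r)))) \<circ> chart_inv A q) y"
      by (simp add: tchange_def[of A p q])
  qed
qed

lemma form_rep_bilinear:
  assumes "smooth_map A UNIV h" "y \<in> chart_map A p ` chart_dom A p"
  shows "form_rep A (\<lambda>p X. B (g p) (dd A h p X)) p y v =
    B ((g \<circ> chart_inv A p) y) (frechet_derivative (h \<circ> chart_inv A p) (at y) v)"
proof -
  obtain r where r: "r \<in> chart_dom A p" "y = chart_map A p r" using assms(2) by auto
  then show ?thesis
    using dd_tchange[OF open_UNIV assms(1) UNIV_I r(1), of v] by (simp add: form_rep_def)
qed

lemma smooth_form1_bilinear:
  assumes "bounded_bilinear B" "smooth_map A UNIV g" "smooth_map A UNIV h"
  shows "smooth_form1 A (\<lambda>p X. B (g p) (dd A h p X))"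
  unfolding smooth_form1_def
proof (intro conjI allI)
  fix p
  interpret B: bounded_bilinear B by fact
  show "linear (\<lambda>X. B (g p) (dd A h p X))"
    using linear_dd[OF open_UNIV assms(3) UNIV_I, of p]
    by (intro linearI) (simp_all add: linear_add linear_scale B.add_right B.scaleR_right)
next
  fix p v
  show "smooth_on (chart_map A p ` chart_dom A p) (\<lambda>y. form_rep A (\<lambda>p X. B (g p) (dd A h p X)) p y v)"
    using smooth_map_chart[OF assms(2), of p] smooth_map_chart[OF assms(3), of p]
    by (intro smooth_on_cong[OF chart_image_open form_rep_bilinear[OF assms(3), symmetric]]
        smooth_on_bilinear[OF chart_image_open assms(1)] smooth_on_frechet_derivative)
      (simp_all add: o_def)
qed

text \<open>Both terms of the exterior derivative of \<open>B(g, dh)\<close> differentiate \<open>h\<close> twice; by the symmetry of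
  second derivatives only the products of first derivatives survive.\<close>

lemma ext_deriv_bilinear:
  fixes h :: "'a \<Rightarrow> 'w::euclidean_space"
  assumes "bounded_bilinear B" "smooth_map A UNIV g" "smooth_map A UNIV h"
  shows "ext_deriv A (\<lambda>p X. B (g p) (dd A h p X)) p X Y =
    B (dd A g p X) (dd A h p Y) - B (dd A g p Y) (dd A h p X)"
proof -
  let ?S = "chart_map A p ` chart_dom A p" and ?y = "chart_map A p p"
  let ?g = "g \<circ> chart_inv A p" and ?h = "h \<circ> chart_inv A p"
  have y: "?y \<in> ?S" by simp
  have g: "smooth_on ?S ?g" and h: "smooth_on ?S ?h"
    using smooth_map_chart[OF assms(2), of p] smooth_map_chart[OF assms(3), of p] by auto
  have D: "frechet_derivative (\<lambda>y. form_rep A (\<lambda>p X. B (g p) (dd A h p X)) p y v) (at ?y) u =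
      B (?g ?y) (frechet_derivative (\<lambda>y. frechet_derivative ?h (at y) v) (at ?y) u) +
      B (dd A g p u) (dd A h p v)" for u v
  proof -
    have "((\<lambda>y. B (?g y) (frechet_derivative ?h (at y) v)) has_derivative
      (\<lambda>u. B (?g ?y) (frechet_derivative (\<lambda>y. frechet_derivative ?h (at y) v) (at ?y) u) +
      B (dd A g p u) (dd A h p v))) (at ?y)"
      unfolding dd_def
      by (intro bounded_bilinear.FDERIV[OF assms(1)] has_frechet_derivative
          smooth_on_differentiable[OF g y] smooth_on_differentiable[OF smooth_on_frechet_derivative[OF h] y])
    then have "((\<lambda>y. form_rep A (\<lambda>p X. B (g p) (dd A h p X)) p y v) has_derivative
      (\<lambda>u. B (?g ?y) (frechet_derivative (\<lambda>y. frechet_derivative ?h (at y) v) (at ?y) u) +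
      B (dd A g p u) (dd A h p v))) (at ?y)"
      by (rule has_derivative_transform_within_open[OF _ chart_image_open y])
        (simp add: form_rep_bilinear[OF assms(3)])
    then show ?thesis by (simp add: frechet_derivativeI)
  qed
  show ?thesis
    unfolding ext_deriv_def D second_derivative_symmetric[OF chart_image_open h y, of X Y] by simp
qed

lemma form_rep_add: "form_rep A (\<lambda>p X. \<eta> p X + \<omega> p X) p y v = form_rep A \<eta> p y v + form_rep A \<omega> p y v"
  by (simp add: form_rep_def Let_def)

lemma smooth_form1_add:
  assumes "smooth_form1 A \<eta>" "smooth_form1 A \<omega>"
  shows "smooth_form1 A (\<lambda>p X. \<eta> p X + \<omega> p X)"
  using assms unfolding smooth_form1_def
  by (auto simp: form_rep_add intro: linear_compose_add smooth_on_add chart_image_open)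

lemma ext_deriv_add:
  assumes "smooth_form1 A \<eta>" "smooth_form1 A \<omega>"
  shows "ext_deriv A (\<lambda>p X. \<eta> p X + \<omega> p X) p X Y = ext_deriv A \<eta> p X Y + ext_deriv A \<omega> p X Y"
proof -
  have d: "((\<lambda>y. form_rep A \<theta> p y v) has_derivative
      frechet_derivative (\<lambda>y. form_rep A \<theta> p y v) (at (chart_map A p p))) (at (chart_map A p p))"
    if "smooth_form1 A \<theta>" for \<theta> :: "('a, 'b) form1" and v
    using that unfolding smooth_form1_def
    by (auto intro!: has_frechet_derivative smooth_on_differentiable)
  show ?thesis
    unfolding ext_deriv_def form_rep_add
    by (simp add: frechet_derivativeI[OF has_derivative_add[OF d[OF assms(1)] d[OF assms(2)]]])
qed

end


section \<open>Linear algebra in signature (4, 2)\<close>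

lemma bounded_bilinear_lform: "bounded_bilinear (lform :: 'v::lie_space \<Rightarrow> 'v \<Rightarrow> real)"
  using lform_bilinear bilinear_conv_bounded_bilinear by blast

lemma lform_add_right: "\<llangle>x, y + z\<rrangle> = \<llangle>x, y\<rrangle> + \<llangle>x, z\<rrangle>"
  and lform_scaleR_right: "\<llangle>x, r *\<^sub>R y\<rrangle> = r * \<llangle>x, y\<rrangle>"
  and lform_diff_left: "\<llangle>x - y, z\<rrangle> = \<llangle>x, z\<rrangle> - \<llangle>y, z\<rrangle>"
  and lform_diff_right: "\<llangle>x, y - z\<rrangle> = \<llangle>x, y\<rrangle> - \<llangle>x, z\<rrangle>"
  and lform_minus_left: "\<llangle>- x, y\<rrangle> = - \<llangle>x, y\<rrangle>"
  and lform_minus_right: "\<llangle>x, - y\<rrangle> = - \<llangle>x, y\<rrangle>"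
  and lform_zero_left: "\<llangle>0, y\<rrangle> = 0"
  and lform_zero_right: "\<llangle>x, 0\<rrangle> = 0"
  for x y z :: "'v::lie_space"
  using bounded_bilinear.add_right[OF bounded_bilinear_lform, of x y z]
    bounded_bilinear.scaleR_right[OF bounded_bilinear_lform, of x r y]
    bounded_bilinear.diff_left[OF bounded_bilinear_lform, of x y z]
    bounded_bilinear.diff_right[OF bounded_bilinear_lform, of x y z]
    bounded_bilinear.minus_left[OF bounded_bilinear_lform, of x y]
    bounded_bilinear.minus_right[OF bounded_bilinear_lform, of x y]
    bounded_bilinear.zero_left[OF bounded_bilinear_lform, of y]
    bounded_bilinear.zero_right[OF bounded_bilinear_lform, of x]
  by simp_all

lemmas lform_linear_simps = lform_add_left lform_add_right lform_scaleR_left lform_scaleR_right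
  lform_diff_left lform_diff_right lform_minus_left lform_minus_right lform_zero_left lform_zero_right

lemma lform_sum_left: "\<llangle>\<Sum>i\<in>I. g i, y\<rrangle> = (\<Sum>i\<in>I. \<llangle>g i, y\<rrangle>)" for y :: "'v::lie_space"
  using bounded_bilinear.sum_left[OF bounded_bilinear_lform] .

lemma bounded_linear_lform_left: "bounded_linear (\<lambda>x. \<llangle>x, y\<rrangle>)" for y :: "'v::lie_space"
  by (rule bounded_bilinear.bounded_linear_left[OF bounded_bilinear_lform])

lemma bounded_bilinear_wedge: "bounded_bilinear (wedge :: 'v::lie_space \<Rightarrow> 'v \<Rightarrow> 'v \<Rightarrow>\<^sub>L 'v)"
proof -
  have "linear (wedge a)" "linear (\<lambda>a. wedge a b)" for a b :: 'v
    by (auto intro!: linearI blinfun_eqI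
        simp: wedge_apply lform_linear_simps blinfun.add_left blinfun.scaleR_left algebra_simps)
  then show ?thesis by (simp add: bilinear_def flip: bilinear_conv_bounded_bilinear)
qed

lemma wedge_self: "wedge a a = 0" for a :: "'v::lie_space"
  by (rule blinfun_eqI) (simp add: wedge_apply)

lemma wedge_swap: "wedge a b = - wedge b a" for a b :: "'v::lie_space"
  by (rule blinfun_eqI) (simp add: wedge_apply blinfun.minus_left)

lemma wedge_add_left: "wedge (x + y) z = wedge x z + wedge y z"
  and wedge_add_right: "wedge x (y + z) = wedge x y + wedge x z"
  and wedge_scaleR_left: "wedge (r *\<^sub>R x) y = r *\<^sub>R wedge x y"
  and wedge_scaleR_right: "wedge x (r *\<^sub>R y) = r *\<^sub>R wedge x y"
  and wedge_diff_left: "wedge (x - y) z = wedge x z - wedge y z"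
  and wedge_diff_right: "wedge x (y - z) = wedge x y - wedge x z"
  and wedge_minus_left: "wedge (- x) y = - wedge x y"
  and wedge_minus_right: "wedge x (- y) = - wedge x y"
  and wedge_zero_left: "wedge 0 y = 0"
  and wedge_zero_right: "wedge x 0 = 0"
  for x y z :: "'v::lie_space"
  using bounded_bilinear.add_left[OF bounded_bilinear_wedge, of x y z]
    bounded_bilinear.add_right[OF bounded_bilinear_wedge, of x y z]
    bounded_bilinear.scaleR_left[OF bounded_bilinear_wedge, of r x y]
    bounded_bilinear.scaleR_right[OF bounded_bilinear_wedge, of x r y]
    bounded_bilinear.diff_left[OF bounded_bilinear_wedge, of x y z]
    bounded_bilinear.diff_right[OF bounded_bilinear_wedge, of x y z]
    bounded_bilinear.minus_left[OF bounded_bilinear_wedge, of x y]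
    bounded_bilinear.minus_right[OF bounded_bilinear_wedge, of x y]
    bounded_bilinear.zero_left[OF bounded_bilinear_wedge, of y]
    bounded_bilinear.zero_right[OF bounded_bilinear_wedge, of x]
  by simp_all

lemmas wedge_linear_simps = wedge_add_left wedge_add_right wedge_scaleR_left wedge_scaleR_right
  wedge_diff_left wedge_diff_right wedge_minus_left wedge_minus_right wedge_zero_left wedge_zero_right

lemma subspace_wedge_space: "subspace (wedge_space W W')"
  unfolding wedge_space_def by (rule subspace_span)

lemma wedge_in_wedge_space: "a \<in> W \<Longrightarrow> b \<in> W' \<Longrightarrow> wedge a b \<in> wedge_space W W'"
  unfolding wedge_space_def by (rule span_base) blast

lemma wedge_space_eq_line:
  fixes F T :: "'v::lie_space"
  shows "wedge_space (span {F, T}) (span {F, T}) = {h *\<^sub>R wedge F T |h. True}"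
proof
  have "{wedge a b |a b. a \<in> span {F, T} \<and> b \<in> span {F, T}} \<subseteq> span {wedge F T}"
  proof clarify
    fix a b assume "a \<in> span {F, T}" "b \<in> span {F, T}"
    then obtain r s r' s' where "a = r *\<^sub>R F + s *\<^sub>R T" "b = r' *\<^sub>R F + s' *\<^sub>R T"
      by (auto simp: span_insert span_singleton algebra_simps)
    then have "wedge a b = (r * s' - s * r') *\<^sub>R wedge F T"
      by (simp add: wedge_linear_simps wedge_self wedge_swap[of T F] algebra_simps)
    then show "wedge a b \<in> span {wedge F T}" by (simp add: span_base span_scale)
  qed
  then have "wedge_space (span {F, T}) (span {F, T}) \<subseteq> span {wedge F T}"
    unfolding wedge_space_def by (rule span_minimal[OF _ subspace_span])
  then show "wedge_space (span {F, T}) (span {F, T}) \<subseteq> {h *\<^sub>R wedge F T |h. True}"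
    by (auto simp: span_singleton)
  show "{h *\<^sub>R wedge F T |h. True} \<subseteq> wedge_space (span {F, T}) (span {F, T})"
    by (auto intro!: subspace_scale[OF subspace_wedge_space] wedge_in_wedge_space span_base)
qed

text \<open>Non-degeneracy turns every linear functional into a pairing with a vector.\<close>

lemma lform_separation:
  fixes v :: "'v::lie_space"
  assumes "subspace W" "v \<notin> W"
  obtains x where "\<And>w. w \<in> W \<Longrightarrow> \<llangle>w, x\<rrangle> = 0" "\<llangle>v, x\<rrangle> \<noteq> 0"
proof -
  define J where "J x = (\<Sum>b\<in>Basis. \<llangle>x, b\<rrangle> *\<^sub>R b)" for x :: 'v
  have J: "J x \<bullet> y = \<llangle>x, y\<rrangle>" for x y
  proof -
    have "\<llangle>x, y\<rrangle> = \<llangle>\<Sum>b\<in>Basis. (y \<bullet> b) *\<^sub>R b, x\<rrangle>"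
      by (simp add: euclidean_representation lform_sym)
    also have "\<dots> = (\<Sum>b\<in>Basis. (y \<bullet> b) * \<llangle>x, b\<rrangle>)"
      by (simp add: lform_sum_left lform_scaleR_left lform_sym[of x])
    also have "\<dots> = J x \<bullet> y"
      by (simp add: J_def inner_sum_left mult.commute inner_commute[of y])
    finally show ?thesis by simp
  qed
  have "linear J"
    by (rule linearI) (simp_all add: J_def lform_linear_simps scaleR_add_left sum.distrib scaleR_sum_right)
  moreover have "inj J"
    unfolding linear_injective_0[OF \<open>linear J\<close>]
    using J lform_nondegenerate by (metis inner_zero_left)
  ultimately have "surj J"
    by (rule linear_injective_imp_surjective) simp
  obtain y z where yz: "y \<in> span W" "\<And>w. w \<in> span W \<Longrightarrow> orthogonal z w" "v = y + z"
    using orthogonal_subspace_decomp_exists[of W v] by metis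
  obtain x where x: "J x = z" using \<open>surj J\<close> by (metis surjD)
  have "z \<noteq> 0" using yz assms by (metis add.right_neutral span_eq_iff)
  show ?thesis
  proof
    show "\<llangle>w, x\<rrangle> = 0" if "w \<in> W" for w
      using yz(2)[of w] that J[of x w] x by (simp add: span_base orthogonal_def lform_sym)
    have "v \<bullet> z = z \<bullet> z" using yz(2)[OF yz(1)] yz(3) by (simp add: inner_add_right orthogonal_def inner_commute)
    moreover have "z \<bullet> z \<noteq> 0" using \<open>z \<noteq> 0\<close> by simp
    ultimately show "\<llangle>v, x\<rrangle> \<noteq> 0"
      using J[of x v] unfolding x inner_commute[of z v] lform_sym[of v x] by linarith
  qed
qed

lemma positive_definite_4_space:
  obtains E :: "'v::lie_space set"
  where "subspace E" "dim E = 4" "\<And>w. w \<in> E \<Longrightarrow> w \<noteq> 0 \<Longrightarrow> \<llangle>w, w\<rrangle> > 0"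
proof -
  obtain e :: "nat \<Rightarrow> 'v" where "\<forall>i<6. \<forall>j<6. \<llangle>e i, e j\<rrangle> = (if i = j then (if i < 4 then 1 else -1) else 0)"
    using lform_signature by blast
  then have e: "\<llangle>e i, e j\<rrangle> = (if i = j then 1 else 0)" if "i < 4" "j < 4" for i j
    using that by simp
  let ?I = "{..<4::nat}"
  have inj: "inj_on e ?I"
    by (rule inj_onI) (metis e lessThan_iff zero_neq_one)
  have pair: "\<llangle>\<Sum>i\<in>?I. c i *\<^sub>R e i, e j\<rrangle> = c j" if "j \<in> ?I" for c j
  proof -
    have "\<llangle>\<Sum>i\<in>?I. c i *\<^sub>R e i, e j\<rrangle> = (\<Sum>i\<in>?I. if i = j then c i else 0)"
      unfolding lform_sum_left by (rule sum.cong) (use e that in \<open>auto simp: lform_scaleR_left\<close>)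
    then show ?thesis using that by simp
  qed
  have ind: "independent (e ` ?I)"
  proof (rule independent_if_scalars_zero)
    fix u x assume 0: "(\<Sum>x\<in>e ` ?I. u x *\<^sub>R x) = 0" and "x \<in> e ` ?I"
    then obtain j where j: "j \<in> ?I" "x = e j" by blast
    have "(\<Sum>i\<in>?I. u (e i) *\<^sub>R e i) = 0" using 0 by (simp add: sum.reindex[OF inj])
    with pair[OF j(1), of "\<lambda>i. u (e i)"] j(2) show "u x = 0" by (simp add: lform_zero_left)
  qed simp
  show ?thesis
  proof
    show "dim (span (e ` ?I)) = 4"
      using dim_eq_card_independent[OF ind] card_image[OF inj] by simp
    fix w assume "w \<in> span (e ` ?I)" "w \<noteq> 0"
    then obtain u where "w = (\<Sum>x\<in>e ` ?I. u x *\<^sub>R x)" by (auto simp: span_finite)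
    then have w: "w = (\<Sum>i\<in>?I. u (e i) *\<^sub>R e i)" by (simp add: sum.reindex[OF inj])
    have "\<llangle>w, w\<rrangle> = (\<Sum>i\<in>?I. u (e i) * \<llangle>e i, w\<rrangle>)"
      by (subst (1) w) (simp add: lform_sum_left lform_scaleR_left)
    also have "\<dots> = (\<Sum>i\<in>?I. (u (e i))\<^sup>2)"
      using pair[of _ "\<lambda>i. u (e i)"] by (intro sum.cong) (simp_all add: w[symmetric] lform_sym power2_eq_square)
    finally have *: "\<llangle>w, w\<rrangle> = (\<Sum>i\<in>?I. (u (e i))\<^sup>2)" .
    have "\<exists>i\<in>?I. u (e i) \<noteq> 0"
    proof (rule ccontr)
      assume "\<not> ?thesis"
      then have "w = 0" by (subst w) simp
      with \<open>w \<noteq> 0\<close> show False by contradiction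
    qed
    then show "\<llangle>w, w\<rrangle> > 0"
      unfolding * using sum_pos2[of ?I _ "\<lambda>i. (u (e i))\<^sup>2"] by auto
  qed simp
qed

text \<open>An isotropic plane together with a non-positive vector of its orthogonal complement would span a
  3-space on which the form is negative semidefinite, and this 3-space would meet a positive
  definite 4-space non-trivially.\<close>

lemma lperp_isotropic_positive:
  fixes v :: "'v::lie_space"
  assumes W: "subspace W" "dim W = 2" "isotropic W" and v: "v \<in> lperp W" "v \<notin> W"
  shows "\<llangle>v, v\<rrangle> > 0"
proof (rule ccontr)
  assume neg: "\<not> \<llangle>v, v\<rrangle> > 0"
  obtain E :: "'v set" where E: "subspace E" "dim E = 4" "\<And>w. w \<in> E \<Longrightarrow> w \<noteq> 0 \<Longrightarrow> \<llangle>w, w\<rrangle> > 0"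
    using positive_definite_4_space[where 'v='v] by metis
  let ?N = "span (insert v W)"
  have "dim ?N = 3" using W v by (simp add: dim_insert span_eq_iff[THEN iffD2])
  moreover have "dim {x + y |x y. x \<in> ?N \<and> y \<in> E} + dim (?N \<inter> E) = dim ?N + dim E"
    by (rule dim_sums_Int) (simp_all add: E(1))
  moreover have "dim {x + y |x y. x \<in> ?N \<and> y \<in> E} \<le> 6"
    using dim_subset_UNIV[of "{x + y |x y. x \<in> ?N \<and> y \<in> E}"] dim_6[where 'a='v] by simp
  ultimately have "dim (?N \<inter> E) \<noteq> 0" using E(2) by linarith
  then obtain w where w: "w \<in> ?N" "w \<in> E" "w \<noteq> 0" by (auto simp: dim_eq_0)
  obtain k where "w - k *\<^sub>R v \<in> span W" using w(1) by (auto simp: span_breakdown_eq)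
  then have u: "w - k *\<^sub>R v \<in> W" using W(1) by (simp add: span_eq_iff[THEN iffD2])
  have "\<llangle>w, w\<rrangle> = \<llangle>(w - k *\<^sub>R v) + k *\<^sub>R v, (w - k *\<^sub>R v) + k *\<^sub>R v\<rrangle>" by simp
  also have "\<dots> = \<llangle>w - k *\<^sub>R v, w - k *\<^sub>R v\<rrangle> + 2 * k * \<llangle>v, w - k *\<^sub>R v\<rrangle> + k\<^sup>2 * \<llangle>v, v\<rrangle>"
    unfolding lform_add_left lform_add_right lform_sym[of "w - k *\<^sub>R v" "k *\<^sub>R v"]
    by (simp only: lform_scaleR_left lform_scaleR_right) (simp add: power2_eq_square)
  also have "\<dots> = k\<^sup>2 * \<llangle>v, v\<rrangle>"
    using u W(3) v(1) by (simp add: isotropic_def lperp_def)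
  finally have "\<llangle>w, w\<rrangle> \<le> 0"
    using neg by (simp add: mult_nonneg_nonpos)
  with E(3)[OF w(2,3)] show False by simp
qed

text \<open>The trace is computed in an unspecified basis \<open>B\<close>. Expanding \<open>w\<close> in \<open>B\<close> and applying \<open>l\<close> shows that
  the endomorphism \<open>v \<mapsto> l(v) w\<close> contributes \<open>l(w)\<close> for any \<open>B\<close>.\<close>

lemma trace_on_rank_two:
  fixes W :: "'v::euclidean_space set"
  assumes W: "subspace W" and w: "w\<^sub>1 \<in> W" "w\<^sub>2 \<in> W" and l: "linear l\<^sub>1" "linear l\<^sub>2"
    and L: "\<And>v. v \<in> W \<Longrightarrow> L v = l\<^sub>1 v *\<^sub>R w\<^sub>1 + l\<^sub>2 v *\<^sub>R w\<^sub>2"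
  shows "trace_on W L = l\<^sub>1 w\<^sub>1 + l\<^sub>2 w\<^sub>2"
proof -
  define B where "B = (SOME B. independent B \<and> span B = W)"
  have "\<exists>B. independent B \<and> span B = W"
    using basis_exists[of W] W by (metis span_subspace)
  then have B: "independent B" "span B = W"
    unfolding B_def by (metis (mono_tags, lifting) someI_ex)+
  have tr: "(\<Sum>b\<in>B. l b * representation B w b) = l w" if "w \<in> W" "linear l" for l :: "'v \<Rightarrow> real" and w
  proof -
    have "w = (\<Sum>b\<in>B. representation B w b *\<^sub>R b)"
      by (rule sum_representation_eq[symmetric]) (use B that independent_imp_finite in auto)
    then have "l w = (\<Sum>b\<in>B. l (representation B w b *\<^sub>R b))"
      by (metis linear_sum[OF that(2)])
    then show ?thesis by (simp add: linear_scale[OF that(2)] mult.commute)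
  qed
  have "trace_on W L = (\<Sum>b\<in>B. representation B (l\<^sub>1 b *\<^sub>R w\<^sub>1 + l\<^sub>2 b *\<^sub>R w\<^sub>2) b)"
    unfolding trace_on_def B_def[symmetric] Let_def
    using L B(2) span_superset[of B] by (intro sum.cong) auto
  also have "\<dots> = (\<Sum>b\<in>B. l\<^sub>1 b * representation B w\<^sub>1 b + l\<^sub>2 b * representation B w\<^sub>2 b)"
    using B(1) w[folded B(2)] by (simp add: representation_add representation_scale span_scale)
  finally show ?thesis by (simp add: sum.distrib tr w l)
qed


section \<open>Lie cyclides\<close>

context smooth_surface
begin

lemma smooth_field_subset: "smooth_field A W Y \<Longrightarrow> W' \<subseteq> W \<Longrightarrow> smooth_field A W' Y"
  unfolding smooth_field_def by (blast intro: smooth_on_subset)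

text \<open>Any other section of the line bundle is a multiple \<open>g \<sigma>\<close>, any other field a multiple \<open>k Y\<close>, and
  by the product rule the derivatives of \<open>g\<close> and \<open>k\<close> only contribute lower order terms. The factors
  are smooth because they are quotients of inner products.\<close>

lemma lie_cyclide_subset_span:
  fixes \<sigma> :: "'a \<Rightarrow> 'v::lie_space"
  assumes W: "open W" "p \<in> W"
    and \<sigma>: "smooth_map A W \<sigma>" "\<And>r. r \<in> W \<Longrightarrow> \<sigma> r \<noteq> 0" "\<And>r. r \<in> W \<Longrightarrow> s r \<subseteq> span {\<sigma> r}"
    and Y: "smooth_field A W Y" "\<And>r. r \<in> W \<Longrightarrow> Y r \<noteq> 0" "\<And>r. r \<in> W \<Longrightarrow> T r \<subseteq> span {Y r}"
  shows "lie_cyclide A s T p \<subseteq>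
    span {\<sigma> p, dd A \<sigma> p (Y p), dd A (\<lambda>r. dd A \<sigma> r (Y r)) p (Y p)}" (is "_ \<subseteq> ?S")
  unfolding lie_cyclide_def
proof (rule span_minimal[OF _ subspace_span], clarify)
  fix v U \<sigma>' Y'
  assume U: "p \<in> U" "section_on A s U \<sigma>'" "field_on A T U Y'"
    and v: "v \<in> {\<sigma>' p, dd A \<sigma>' p (Y' p), dd A (\<lambda>r. dd A \<sigma>' r (Y' r)) p (Y' p)}"
  define V where "V = U \<inter> W \<inter> chart_dom A p"
  have V: "open V" "p \<in> V" "V \<subseteq> U" "V \<subseteq> W" "V \<subseteq> chart_dom A p"
    using U W by (auto simp: V_def section_on_def)
  have sm: "smooth_map A V \<sigma>" "smooth_map A V \<sigma>'" "smooth_field A V Y"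
    using U(2) V \<sigma>(1) Y(1)
    by (auto simp: section_on_def intro: smooth_map_subset smooth_field_subset)
  let ?y = "\<lambda>Y r. tchange A r p r (Y r)"
  have smy: "smooth_map A V (?y Z)" if "smooth_field A U' Z" "V \<subseteq> U'" for U' Z
  proof (rule smooth_map_single_chart[OF V(1) V(5)])
    have "smooth_on (chart_map A p ` (chart_dom A p \<inter> U')) (?y Z \<circ> chart_inv A p)"
      using that(1) unfolding smooth_field_def by blast
    then show "smooth_on (chart_map A p ` V) (?y Z \<circ> chart_inv A p)"
      by (rule smooth_on_subset) (use V that in auto)
  qed
  have y0: "?y Y r \<noteq> 0" if "r \<in> V" for r
  proof
    assume 0: "?y Y r = 0"
    have r: "r \<in> chart_dom A p" using that V by auto
    have "Y r = tchange A p r r (?y Y r)"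
      using r by (simp add: tchange_tchange tchange_same)
    also have "\<dots> = 0" using 0 linear_0[OF linear_tchange[of r p r]] r by simp
    finally show False using Y(2) that V by auto
  qed
  define g where "g r = (\<sigma>' r \<bullet> \<sigma> r) / (\<sigma> r \<bullet> \<sigma> r)" for r
  define k where "k r = (?y Y' r \<bullet> ?y Y r) / (?y Y r \<bullet> ?y Y r)" for r
  have smY: "smooth_map A V (?y Y)" "smooth_map A V (?y Y')"
    using smy U(3) V(3,4) Y(1) unfolding field_on_def by blast+
  have g: "smooth_map A V g"
    unfolding g_def
    using \<sigma>(2) V
    by (intro smooth_map_divide smooth_map_bilinear[OF _ bounded_bilinear_inner] sm V) auto
  have k: "smooth_map A V k"
    unfolding k_def
    using y0
    by (intro smooth_map_divide smooth_map_bilinear[OF _ bounded_bilinear_inner] smY V) auto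
  have g_eq: "\<sigma>' r = g r *\<^sub>R \<sigma> r" if "r \<in> V" for r
  proof -
    have "\<sigma>' r \<in> span {\<sigma> r}" using that U(2) V(3,4) \<sigma>(3)[of r] unfolding section_on_def by blast
    then obtain c where "\<sigma>' r = c *\<^sub>R \<sigma> r" by (auto simp: span_singleton)
    then show ?thesis using \<sigma>(2)[of r] that V by (auto simp: g_def)
  qed
  have k_eq: "Y' r = k r *\<^sub>R Y r" if "r \<in> V" for r
  proof -
    have "Y' r \<in> span {Y r}" using that U(3) V(3,4) Y(3)[of r] unfolding field_on_def by blast
    then obtain c where c: "Y' r = c *\<^sub>R Y r" by (auto simp: span_singleton)
    then have "?y Y' r = c *\<^sub>R ?y Y r"
      using linear_scale[OF linear_tchange[of r r p]] that V by auto
    then show ?thesis using y0[OF that] c by (simp add: k_def)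
  qed
  let ?s = "\<lambda>r. dd A \<sigma> r (Y r)" and ?g = "\<lambda>r. dd A g r (Y r)"
  have sm2: "smooth_map A V ?s" "smooth_map A V ?g"
    using sm g V by (auto intro: smooth_map_dd)
  let ?h = "\<lambda>r. k r *\<^sub>R (g r *\<^sub>R ?s r + ?g r *\<^sub>R \<sigma> r)"
  note sc = bounded_bilinear_scaleR
  note smooth_intros = smooth_map_add smooth_map_bilinear[OF _ sc] V(1) g k sm sm2
  have d1: "dd A \<sigma>' r (Y' r) = ?h r" if "r \<in> V" for r
  proof -
    have "dd A \<sigma>' r X = dd A (\<lambda>r. g r *\<^sub>R \<sigma> r) r X" for X
      by (rule dd_cong[OF V(1) that]) (intro smooth_intros, simp add: g_eq)
    also have "dd A (\<lambda>r. g r *\<^sub>R \<sigma> r) r X = g r *\<^sub>R dd A \<sigma> r X + dd A g r X *\<^sub>R \<sigma> r" for X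
      by (rule dd_bilinear[OF V(1) that sc g sm(1)])
    finally show ?thesis
      by (simp add: k_eq[OF that] linear_scale[OF linear_dd[OF V(1) sm(1) that]]
          linear_scale[OF linear_dd[OF V(1) g that]] algebra_simps)
  qed
  have inS: "\<sigma> p \<in> ?S" "?s p \<in> ?S" "dd A ?s p (Y p) \<in> ?S"
    by (auto intro: span_base)
  have h_smooth: "smooth_map A V ?h" by (intro smooth_intros)
  have "dd A (\<lambda>r. dd A \<sigma>' r (Y' r)) p (Y' p) = dd A ?h p (Y' p)"
    by (rule dd_cong[OF V(1,2) h_smooth]) (simp add: d1)
  also have "\<dots> = k p *\<^sub>R dd A ?h p (Y p)"
    by (simp add: k_eq[OF V(2)] linear_scale[OF linear_dd[OF V(1) h_smooth V(2)]])
  also have "dd A ?h p (Y p) = k p *\<^sub>R ((g p *\<^sub>R dd A ?s p (Y p) + dd A g p (Y p) *\<^sub>R ?s p) +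
      (?g p *\<^sub>R dd A \<sigma> p (Y p) + dd A ?g p (Y p) *\<^sub>R \<sigma> p)) +
      dd A k p (Y p) *\<^sub>R (g p *\<^sub>R ?s p + ?g p *\<^sub>R \<sigma> p)"
  proof -
    have 1: "smooth_map A V (\<lambda>r. g r *\<^sub>R ?s r)" and 2: "smooth_map A V (\<lambda>r. ?g r *\<^sub>R \<sigma> r)"
      by (intro smooth_intros)+
    show ?thesis
      unfolding dd_bilinear[OF V(1,2) sc k smooth_map_add[OF V(1) 1 2]] dd_add[OF V(1,2) 1 2]
        dd_bilinear[OF V(1,2) sc g sm2(1)] dd_bilinear[OF V(1,2) sc sm2(2) sm(1)] ..
  qed
  finally have d2: "dd A (\<lambda>r. dd A \<sigma>' r (Y' r)) p (Y' p) \<in> ?S"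
    using inS by (auto intro!: span_add span_scale)
  from v show "v \<in> ?S"
    using d2 inS d1[OF V(2)] g_eq[OF V(2)] by (auto intro!: span_add span_scale)
qed

lemma subspace_lie_cyclide: "subspace (lie_cyclide A s T p)"
  unfolding lie_cyclide_def by (rule subspace_span)

lemma lie_cyclide_contains:
  assumes "p \<in> U" "section_on A s U \<sigma>" "field_on A T U Y"
  shows "\<sigma> p \<in> lie_cyclide A s T p" "dd A \<sigma> p (Y p) \<in> lie_cyclide A s T p"
  unfolding lie_cyclide_def by (rule span_base; use assms in blast)+

end


section \<open>Curvature directions of an umbilic-free surface in a space form\<close>

locale principal_surface = smooth_surface A
  for A :: "'a::{t2_space,second_countable_topology} atlas" +
  fixes f s\<^sub>1 s\<^sub>2 :: "'a \<Rightarrow> 'v::lie_space set"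
    and \<qq> \<pp> :: 'v
    and \<ff> \<tt> :: "'a \<Rightarrow> 'v"
    and \<kappa>\<^sub>1 \<kappa>\<^sub>2 :: "'a \<Rightarrow> real"
  assumes legendre: "legendre_map A f"
    and space_form_data: "space_form_data \<qq> \<pp>"
    and projection: "space_form_projection A f \<qq> \<pp> \<ff>"
    and congruence: "tangent_plane_congruence A f \<qq> \<pp> \<tt>"
    and immersed: "immersed A \<ff>"
    and umbilic_free: "umbilic_free A f s\<^sub>1 s\<^sub>2"
    and principal\<^sub>1: "principal_curvature A (curvature_subbundle A f s\<^sub>1) \<ff> \<tt> \<kappa>\<^sub>1"
    and principal\<^sub>2: "principal_curvature A (curvature_subbundle A f s\<^sub>2) \<ff> \<tt> \<kappa>\<^sub>2"
begin

abbreviation T\<^sub>1 :: "'a \<Rightarrow> (real^2) set" where "T\<^sub>1 \<equiv> curvature_subbundle A f s\<^sub>1"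
abbreviation T\<^sub>2 :: "'a \<Rightarrow> (real^2) set" where "T\<^sub>2 \<equiv> curvature_subbundle A f s\<^sub>2"
abbreviation S\<^sub>1 :: "'a \<Rightarrow> 'v set" where "S\<^sub>1 \<equiv> lie_cyclide A s\<^sub>1 T\<^sub>2"
abbreviation S\<^sub>2 :: "'a \<Rightarrow> 'v set" where "S\<^sub>2 \<equiv> lie_cyclide A s\<^sub>2 T\<^sub>1"

text \<open>Whatever is proved for one family of curvature spheres holds for the other one.\<close>

lemma exchanged: "principal_surface A f s\<^sub>2 s\<^sub>1 \<qq> \<pp> \<ff> \<tt> \<kappa>\<^sub>2 \<kappa>\<^sub>1"
proof unfold_locales
  show "umbilic_free A f s\<^sub>2 s\<^sub>1"
    using umbilic_free unfolding umbilic_free_def by (simp add: insert_commute) metis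
qed (fact legendre space_form_data projection congruence immersed principal\<^sub>1 principal\<^sub>2)+

lemma smooth_ff: "smooth_map A UNIV \<ff>" and ff_section: "section_on A f UNIV \<ff>"
  and ff_in [simp]: "\<ff> x \<in> f x"
  using projection by (auto simp: space_form_projection_def section_on_def)

lemma smooth_tt: "smooth_map A UNIV \<tt>" and tt_section: "section_on A f UNIV \<tt>"
  and tt_in [simp]: "\<tt> x \<in> f x"
  using congruence by (auto simp: tangent_plane_congruence_def section_on_def)

lemma ff_qq [simp]: "\<llangle>\<ff> x, \<qq>\<rrangle> = -1" and ff_pp [simp]: "\<llangle>\<ff> x, \<pp>\<rrangle> = 0"
  and tt_qq [simp]: "\<llangle>\<tt> x, \<qq>\<rrangle> = 0" and tt_pp [simp]: "\<llangle>\<tt> x, \<pp>\<rrangle> = -1"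
  using projection congruence
  by (auto simp: space_form_projection_def space_form_def tangent_plane_congruence_def)

lemma qq_ff [simp]: "\<llangle>\<qq>, \<ff> x\<rrangle> = -1" and pp_ff [simp]: "\<llangle>\<pp>, \<ff> x\<rrangle> = 0"
  and qq_tt [simp]: "\<llangle>\<qq>, \<tt> x\<rrangle> = 0" and pp_tt [simp]: "\<llangle>\<pp>, \<tt> x\<rrangle> = -1"
  by (simp_all add: lform_sym[of \<qq>] lform_sym[of \<pp>])

lemma subspace_f: "subspace (f x)" and dim_f: "dim (f x) = 2" and isotropic_f: "isotropic (f x)"
proof -
  show "isotropic (f x)" using legendre by (simp add: legendre_map_def)
  obtain U \<sigma> where "x \<in> U" "\<forall>r\<in>U. f r = span ((\<lambda>i::nat. \<sigma> i r) ` {..<2}) \<and> dim (f r) = 2"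
    using legendre unfolding legendre_map_def smooth_subbundle_def by meson
  then show "subspace (f x)" "dim (f x) = 2" by (metis subspace_span, blast)
qed

lemma f_isotropic: "v \<in> f x \<Longrightarrow> w \<in> f x \<Longrightarrow> \<llangle>v, w\<rrangle> = 0"
  using isotropic_f unfolding isotropic_def by blast

lemma f_eq_span: "f x = span {\<ff> x, \<tt> x}"
proof -
  have "\<ff> x \<notin> span {\<tt> x}"
  proof
    assume "\<ff> x \<in> span {\<tt> x}"
    then obtain c where "\<ff> x = c *\<^sub>R \<tt> x" by (auto simp: span_singleton)
    then have "\<llangle>\<ff> x, \<qq>\<rrangle> = \<llangle>c *\<^sub>R \<tt> x, \<qq>\<rrangle>" by simp
    then show False by (simp add: lform_scaleR_left)
  qed
  moreover have "\<tt> x \<noteq> 0" using tt_pp[of x] by (metis lform_zero_left neg_equal_0_iff_equal zero_neq_one)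
  ultimately have ind: "independent {\<ff> x, \<tt> x}" and "\<ff> x \<noteq> \<tt> x"
    by (auto simp: independent_insert span_base)
  then have "dim (span {\<ff> x, \<tt> x}) = 2" by (simp add: dim_eq_card_independent)
  moreover have "span {\<ff> x, \<tt> x} \<subseteq> f x" by (rule span_minimal) (simp_all add: subspace_f)
  ultimately show ?thesis
    using subspace_dim_equal[of "span {\<ff> x, \<tt> x}" "f x"] subspace_f dim_f by auto
qed

lemma f_decomposition: 
  assumes "v \<in> f x"
  shows "v = - \<llangle>v, \<qq>\<rrangle> *\<^sub>R \<ff> x - \<llangle>v, \<pp>\<rrangle> *\<^sub>R \<tt> x"
proof -
  obtain r s where "v = r *\<^sub>R \<ff> x + s *\<^sub>R \<tt> x"
    using assms unfolding f_eq_span by (auto simp: span_insert span_singleton algebra_simps)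
  then show ?thesis by (simp add: lform_linear_simps)
qed

lemma f_eq_0: "v \<in> f x \<Longrightarrow> \<llangle>v, \<qq>\<rrangle> = 0 \<Longrightarrow> \<llangle>v, \<pp>\<rrangle> = 0 \<Longrightarrow> v = 0"
  using f_decomposition[of v x] by simp

lemma f_combination: "a *\<^sub>R \<ff> x + b *\<^sub>R \<tt> x \<in> f x"
  by (intro subspace_add[OF subspace_f] subspace_scale[OF subspace_f] ff_in tt_in)

lemma section_derivative_perp:
  assumes "section_on A f U \<sigma>" "x \<in> U" "w \<in> f x"
  shows "\<llangle>dd A \<sigma> x X, w\<rrangle> = 0"
proof -
  have "dd A \<sigma> x X \<in> derived_bundle A f x"
    unfolding derived_bundle_def by (rule span_base) (use assms in blast)
  then show ?thesis using legendre assms(3) unfolding legendre_map_def lperp_def by blast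
qed

lemma dd_lform:
  assumes "open U" "smooth_map A U \<sigma>" "x \<in> U"
  shows "dd A (\<lambda>r. \<llangle>\<sigma> r, w\<rrangle>) x X = \<llangle>dd A \<sigma> x X, w\<rrangle>"
  using dd_bounded_linear[OF assms(1,3) bounded_linear_lform_left assms(2)] .

lemma dd_ff_perp [simp]: "w \<in> f x \<Longrightarrow> \<llangle>dd A \<ff> x X, w\<rrangle> = 0"
  and dd_tt_perp [simp]: "w \<in> f x \<Longrightarrow> \<llangle>dd A \<tt> x X, w\<rrangle> = 0"
  by (auto intro: section_derivative_perp[OF ff_section] section_derivative_perp[OF tt_section])

lemma dd_ff_qq [simp]: "\<llangle>dd A \<ff> x X, \<qq>\<rrangle> = 0" and dd_ff_pp [simp]: "\<llangle>dd A \<ff> x X, \<pp>\<rrangle> = 0"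
  and dd_tt_qq [simp]: "\<llangle>dd A \<tt> x X, \<qq>\<rrangle> = 0" and dd_tt_pp [simp]: "\<llangle>dd A \<tt> x X, \<pp>\<rrangle> = 0"
  using dd_lform[OF open_UNIV smooth_ff UNIV_I, of \<qq> x X] dd_lform[OF open_UNIV smooth_ff UNIV_I, of \<pp> x X]
    dd_lform[OF open_UNIV smooth_tt UNIV_I, of \<qq> x X] dd_lform[OF open_UNIV smooth_tt UNIV_I, of \<pp> x X]
  by simp_all

lemma linear_dd_ff: "linear (dd A \<ff> x)" and linear_dd_tt: "linear (dd A \<tt> x)"
  by (auto intro: linear_dd[OF open_UNIV] smooth_ff smooth_tt)

lemma dd_ff_positive:
  assumes "X \<noteq> 0"
  shows "\<llangle>dd A \<ff> x X, dd A \<ff> x X\<rrangle> > 0"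
proof (rule lperp_isotropic_positive[OF subspace_f dim_f isotropic_f])
  show "dd A \<ff> x X \<in> lperp (f x)" by (simp add: lperp_def)
  have "dd A \<ff> x X \<noteq> 0"
    using immersed assms linear_dd_ff[of x] unfolding immersed_def
    by (metis linear_injective_0)
  then show "dd A \<ff> x X \<notin> f x" using f_eq_0[of "dd A \<ff> x X" x] by auto
qed

text \<open>This is the product rule for \<open>\<sigma> = -(\<sigma>, \<qq>)\<ff> - (\<sigma>, \<pp>)\<tt>\<close>, with the part in \<open>f\<close> split off.\<close>

lemma section_derivative:
  assumes "section_on A f U \<sigma>" "x \<in> U"
  shows "dd A \<sigma> x X = (- \<llangle>dd A \<sigma> x X, \<qq>\<rrangle> *\<^sub>R \<ff> x - \<llangle>dd A \<sigma> x X, \<pp>\<rrangle> *\<^sub>R \<tt> x)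
    - (\<llangle>\<sigma> x, \<qq>\<rrangle> *\<^sub>R dd A \<ff> x X + \<llangle>\<sigma> x, \<pp>\<rrangle> *\<^sub>R dd A \<tt> x X)"
proof -
  have U: "open U" and \<sigma>: "smooth_map A U \<sigma>" using assms(1) by (auto simp: section_on_def)
  have bl: "bounded_linear (\<lambda>v. - \<llangle>v, w\<rrangle>)" for w :: 'v
    by (intro bounded_linear_minus bounded_linear_lform_left)
  have sm: "smooth_map A U (\<lambda>r. - \<llangle>\<sigma> r, w\<rrangle>)" for w
    by (rule smooth_map_bounded_linear[OF U bl \<sigma>])
  have d: "dd A (\<lambda>r. - \<llangle>\<sigma> r, w\<rrangle>) x X = - \<llangle>dd A \<sigma> x X, w\<rrangle>" for w
    by (rule dd_bounded_linear[OF U assms(2) bl \<sigma>])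
  have ft: "smooth_map A U \<ff>" "smooth_map A U \<tt>"
    using smooth_map_subset[OF smooth_ff] smooth_map_subset[OF smooth_tt] by auto
  note B = smooth_map_bilinear[OF U bounded_bilinear_scaleR sm]
  have "dd A \<sigma> x X = dd A (\<lambda>r. (- \<llangle>\<sigma> r, \<qq>\<rrangle>) *\<^sub>R \<ff> r + (- \<llangle>\<sigma> r, \<pp>\<rrangle>) *\<^sub>R \<tt> r) x X"
  proof (rule dd_cong[OF U assms(2) smooth_map_add[OF U B[OF ft(1)] B[OF ft(2)]]])
    fix r assume "r \<in> U"
    then have "\<sigma> r \<in> f r" using assms(1) by (auto simp: section_on_def)
    from f_decomposition[OF this]
    show "(- \<llangle>\<sigma> r, \<qq>\<rrangle>) *\<^sub>R \<ff> r + (- \<llangle>\<sigma> r, \<pp>\<rrangle>) *\<^sub>R \<tt> r = \<sigma> r" by simp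
  qed
  also have "\<dots> = - \<llangle>\<sigma> x, \<qq>\<rrangle> *\<^sub>R dd A \<ff> x X + - \<llangle>dd A \<sigma> x X, \<qq>\<rrangle> *\<^sub>R \<ff> x +
      (- \<llangle>\<sigma> x, \<pp>\<rrangle> *\<^sub>R dd A \<tt> x X + - \<llangle>dd A \<sigma> x X, \<pp>\<rrangle> *\<^sub>R \<tt> x)"
    unfolding dd_add[OF U assms(2) B[OF ft(1)] B[OF ft(2)]]
      dd_bilinear[OF U assms(2) bounded_bilinear_scaleR sm ft(1)]
      dd_bilinear[OF U assms(2) bounded_bilinear_scaleR sm ft(2)] d ..
  also have "\<dots> = (- \<llangle>dd A \<sigma> x X, \<qq>\<rrangle> *\<^sub>R \<ff> x - \<llangle>dd A \<sigma> x X, \<pp>\<rrangle> *\<^sub>R \<tt> x)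
    - (\<llangle>\<sigma> x, \<qq>\<rrangle> *\<^sub>R dd A \<ff> x X + \<llangle>\<sigma> x, \<pp>\<rrangle> *\<^sub>R dd A \<tt> x X)" by simp
  finally show ?thesis .
qed

text \<open>The part of \<open>d\<sigma>\<close> that is not visibly in \<open>f\<close> is orthogonal to \<open>\<qq>\<close> and \<open>\<pp>\<close>, and only the zero vector
  of \<open>f\<close> is.\<close>

lemma section_derivative_in_f_iff:
  assumes "section_on A f U \<sigma>" "x \<in> U"
  shows "dd A \<sigma> x X \<in> f x \<longleftrightarrow> \<llangle>\<sigma> x, \<qq>\<rrangle> *\<^sub>R dd A \<ff> x X + \<llangle>\<sigma> x, \<pp>\<rrangle> *\<^sub>R dd A \<tt> x X = 0"
    (is "_ \<longleftrightarrow> ?w = 0")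
proof -
  let ?u = "- \<llangle>dd A \<sigma> x X, \<qq>\<rrangle> *\<^sub>R \<ff> x - \<llangle>dd A \<sigma> x X, \<pp>\<rrangle> *\<^sub>R \<tt> x"
  have u: "?u \<in> f x" by (intro subspace_diff[OF subspace_f] subspace_scale[OF subspace_f] ff_in tt_in)
  have eq: "dd A \<sigma> x X = ?u - ?w" by (rule section_derivative[OF assms])
  show ?thesis
  proof
    assume "dd A \<sigma> x X \<in> f x"
    then have "?u - dd A \<sigma> x X \<in> f x" using subspace_diff[OF subspace_f u] by blast
    moreover have "?u - dd A \<sigma> x X = ?w" using eq by (simp add: algebra_simps)
    ultimately have "?w \<in> f x" by simp
    then show "?w = 0" by (rule f_eq_0) (simp_all add: lform_linear_simps)
  next
    assume "?w = 0"
    with eq u show "dd A \<sigma> x X \<in> f x" by simp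
  qed
qed

lemma curvature_space_line:
  assumes v: "v \<in> f x"
  shows "curvature_space A f x (span {v}) =
    {X. \<llangle>v, \<qq>\<rrangle> *\<^sub>R dd A \<ff> x X + \<llangle>v, \<pp>\<rrangle> *\<^sub>R dd A \<tt> x X = 0}"
proof (rule set_eqI, rule iffI)
  fix X assume X: "X \<in> curvature_space A f x (span {v})"
  let ?\<sigma> = "\<lambda>r. (- \<llangle>v, \<qq>\<rrangle>) *\<^sub>R \<ff> r + (- \<llangle>v, \<pp>\<rrangle>) *\<^sub>R \<tt> r"
  have sec: "section_on A f UNIV ?\<sigma>"
    unfolding section_on_def
    by (intro conjI ballI open_UNIV f_combination smooth_map_add
        smooth_map_bounded_linear[OF _ bounded_linear_scaleR_right] smooth_ff smooth_tt)
  have x: "?\<sigma> x = v" using f_decomposition[OF v] by simp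
  then have "?\<sigma> x \<in> span {v}" by (simp only: span_base singletonI)
  then have "dd A ?\<sigma> x X \<in> f x"
    using X sec UNIV_I unfolding curvature_space_def by blast
  then show "X \<in> {X. \<llangle>v, \<qq>\<rrangle> *\<^sub>R dd A \<ff> x X + \<llangle>v, \<pp>\<rrangle> *\<^sub>R dd A \<tt> x X = 0}"
    using section_derivative_in_f_iff[OF sec UNIV_I, of x X] x by simp
next
  fix X assume X: "X \<in> {X. \<llangle>v, \<qq>\<rrangle> *\<^sub>R dd A \<ff> x X + \<llangle>v, \<pp>\<rrangle> *\<^sub>R dd A \<tt> x X = 0}"
  show "X \<in> curvature_space A f x (span {v})"
    unfolding curvature_space_def
  proof clarify
    fix U \<sigma> assume "x \<in> U" "section_on A f U \<sigma>" "\<sigma> x \<in> span {v}"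
    moreover from this(3) obtain c where "\<sigma> x = c *\<^sub>R v" by (auto simp: span_singleton)
    moreover have "\<llangle>c *\<^sub>R v, \<qq>\<rrangle> *\<^sub>R dd A \<ff> x X + \<llangle>c *\<^sub>R v, \<pp>\<rrangle> *\<^sub>R dd A \<tt> x X =
        c *\<^sub>R (\<llangle>v, \<qq>\<rrangle> *\<^sub>R dd A \<ff> x X + \<llangle>v, \<pp>\<rrangle> *\<^sub>R dd A \<tt> x X)"
      by (simp add: lform_scaleR_left algebra_simps)
    ultimately show "dd A \<sigma> x X \<in> f x"
      using X section_derivative_in_f_iff[of U \<sigma> x X] by simp
  qed
qed

lemma s1_curvature_sphere: "curvature_sphere A f x (s\<^sub>1 x)" and spheres_differ: "s\<^sub>1 x \<noteq> s\<^sub>2 x"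
  using umbilic_free unfolding umbilic_free_def by blast+

text \<open>For \<open>v\<close> in \<open>s\<^sub>1\<close> and a non-zero \<open>X\<close> in \<open>T\<^sub>1\<close> the relations \<open>(v, \<qq>)d\<^sub>X\<ff> + (v, \<pp>)d\<^sub>X\<tt> = 0\<close> and
  \<open>d\<^sub>X\<tt> = -\<kappa>\<^sub>1d\<^sub>X\<ff>\<close> yield \<open>(v, \<qq>) = \<kappa>\<^sub>1(v, \<pp>)\<close>, as \<open>\<ff>\<close> is an immersion.\<close>

lemma curvature_sphere\<^sub>1:
  shows s1_eq: "s\<^sub>1 x = span {\<tt> x + \<kappa>\<^sub>1 x *\<^sub>R \<ff> x}"
    and T1_nontrivial: "\<exists>X\<in>T\<^sub>1 x. X \<noteq> 0"
proof -
  have s: "subspace (s\<^sub>1 x)" "dim (s\<^sub>1 x) = 1" "s\<^sub>1 x \<subseteq> f x" "T\<^sub>1 x \<noteq> {0}"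
    using s1_curvature_sphere by (auto simp: curvature_sphere_def curvature_subbundle_def)
  obtain B where B: "B \<subseteq> s\<^sub>1 x" "independent B" "s\<^sub>1 x \<subseteq> span B" "card B = 1"
    using basis_exists[of "s\<^sub>1 x"] s(2) by metis
  obtain v where v: "B = {v}" using B(4) by (auto simp: card_1_singleton_iff)
  have v0: "v \<noteq> 0" using B(2) v by (simp add: dependent_single)
  have sv: "s\<^sub>1 x = span {v}" using B v s(1) span_subspace by blast
  have vf: "v \<in> f x" using B(1) v s(3) by auto
  have T: "T\<^sub>1 x = {X. \<llangle>v, \<qq>\<rrangle> *\<^sub>R dd A \<ff> x X + \<llangle>v, \<pp>\<rrangle> *\<^sub>R dd A \<tt> x X = 0}"
    unfolding curvature_subbundle_def sv by (rule curvature_space_line[OF vf])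
  have "0 \<in> T\<^sub>1 x" unfolding T by (simp add: linear_0[OF linear_dd_ff] linear_0[OF linear_dd_tt])
  with s(4) show "\<exists>X\<in>T\<^sub>1 x. X \<noteq> 0" by blast
  then obtain X where X: "X \<in> T\<^sub>1 x" "X \<noteq> 0" by blast
  have "dd A \<tt> x X = - \<kappa>\<^sub>1 x *\<^sub>R dd A \<ff> x X"
    using principal\<^sub>1 X(1) unfolding principal_curvature_def by (simp add: eq_neg_iff_add_eq_0)
  with X(1) T have "(\<llangle>v, \<qq>\<rrangle> - \<kappa>\<^sub>1 x * \<llangle>v, \<pp>\<rrangle>) *\<^sub>R dd A \<ff> x X = 0"
    by (simp add: algebra_simps)
  moreover have "dd A \<ff> x X \<noteq> 0" using dd_ff_positive[OF X(2), of x] by (auto simp: lform_zero_left)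
  ultimately have "\<llangle>v, \<qq>\<rrangle> = \<kappa>\<^sub>1 x * \<llangle>v, \<pp>\<rrangle>" by simp
  then have v_eq: "v = (- \<llangle>v, \<pp>\<rrangle>) *\<^sub>R (\<tt> x + \<kappa>\<^sub>1 x *\<^sub>R \<ff> x)" (is "v = ?c *\<^sub>R ?w")
  proof -
    have "- \<llangle>v, \<qq>\<rrangle> *\<^sub>R \<ff> x - \<llangle>v, \<pp>\<rrangle> *\<^sub>R \<tt> x = ?c *\<^sub>R ?w"
      using \<open>\<llangle>v, \<qq>\<rrangle> = \<kappa>\<^sub>1 x * \<llangle>v, \<pp>\<rrangle>\<close> by (simp add: algebra_simps)
    with f_decomposition[OF vf] show ?thesis by (rule trans)
  qed
  with v0 have "?c \<noteq> 0" by auto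
  have "?w = (1 / ?c) *\<^sub>R v" using \<open>?c \<noteq> 0\<close> by (subst v_eq) simp
  then have "?w \<in> span {v}" by (metis span_base span_scale singletonI)
  moreover have "v \<in> span {?w}" by (subst v_eq) (metis span_base span_scale singletonI)
  ultimately show "s\<^sub>1 x = span {?w}"
    unfolding sv by (intro subset_antisym span_minimal subspace_span) simp_all
qed

lemmas s2_eq = principal_surface.s1_eq[OF exchanged]
  and T2_nontrivial = principal_surface.T1_nontrivial[OF exchanged]

lemma T1_eq: "T\<^sub>1 x = {X. dd A \<tt> x X = - \<kappa>\<^sub>1 x *\<^sub>R dd A \<ff> x X}"
proof -
  have "\<tt> x + \<kappa>\<^sub>1 x *\<^sub>R \<ff> x \<in> f x" using f_combination[of "\<kappa>\<^sub>1 x" x 1] by (simp add: add.commute)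
  note T = curvature_space_line[OF this]
  have pair: "\<llangle>\<tt> x + \<kappa>\<^sub>1 x *\<^sub>R \<ff> x, \<qq>\<rrangle> = - \<kappa>\<^sub>1 x" "\<llangle>\<tt> x + \<kappa>\<^sub>1 x *\<^sub>R \<ff> x, \<pp>\<rrangle> = -1"
    by (simp_all add: lform_linear_simps)
  have "- \<kappa>\<^sub>1 x *\<^sub>R v + (- 1) *\<^sub>R w = 0 \<longleftrightarrow> w = - \<kappa>\<^sub>1 x *\<^sub>R v" for v w :: 'v
    by auto
  then show ?thesis
    unfolding curvature_subbundle_def s1_eq T pair by (simp only:)
qed

lemmas T2_eq = principal_surface.T1_eq[OF exchanged]

lemma subspace_T1: "subspace (T\<^sub>1 x)"
  unfolding T1_eq
  by (auto simp: subspace_def linear_0[OF linear_dd_ff] linear_0[OF linear_dd_tt]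
      linear_add[OF linear_dd_ff] linear_add[OF linear_dd_tt]
      linear_scale[OF linear_dd_ff] linear_scale[OF linear_dd_tt] scaleR_add_right)

lemmas subspace_T2 = principal_surface.subspace_T1[OF exchanged]

lemma T1_tt: "X \<in> T\<^sub>1 x \<Longrightarrow> dd A \<tt> x X = - \<kappa>\<^sub>1 x *\<^sub>R dd A \<ff> x X"
  and T2_tt: "X \<in> T\<^sub>2 x \<Longrightarrow> dd A \<tt> x X = - \<kappa>\<^sub>2 x *\<^sub>R dd A \<ff> x X"
  by (simp_all add: T1_eq T2_eq)

lemma curvatures_differ: "\<kappa>\<^sub>1 x \<noteq> \<kappa>\<^sub>2 x"
  using spheres_differ[of x] unfolding s1_eq s2_eq by auto

lemma dd_ff_eq_0: "dd A \<ff> x X = 0 \<Longrightarrow> X = 0"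
  using dd_ff_positive[of X x] by (auto simp: lform_zero_left)

lemma T1_T2_trivial:
  assumes "X \<in> T\<^sub>1 x" "X \<in> T\<^sub>2 x"
  shows "X = 0"
proof -
  have "(\<kappa>\<^sub>1 x - \<kappa>\<^sub>2 x) *\<^sub>R dd A \<ff> x X = 0"
    using T1_tt[OF assms(1)] T2_tt[OF assms(2)] by (auto simp: algebra_simps)
  then show ?thesis using curvatures_differ dd_ff_eq_0 by auto
qed

lemma curvature_directions_span:
  assumes e: "e\<^sub>1 \<in> T\<^sub>1 x" "e\<^sub>1 \<noteq> 0" "e\<^sub>2 \<in> T\<^sub>2 x" "e\<^sub>2 \<noteq> 0"
  obtains c\<^sub>1 c\<^sub>2 where "X = c\<^sub>1 *\<^sub>R e\<^sub>1 + c\<^sub>2 *\<^sub>R e\<^sub>2"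
proof -
  have "e\<^sub>1 \<notin> span {e\<^sub>2}"
  proof
    assume "e\<^sub>1 \<in> span {e\<^sub>2}"
    then obtain c where c: "e\<^sub>1 = c *\<^sub>R e\<^sub>2" by (auto simp: span_singleton)
    then have "e\<^sub>1 \<in> T\<^sub>2 x"
      using subspace_scale[OF subspace_T2 e(3)] by simp
    with T1_T2_trivial e(1,2) show False by blast
  qed
  then have "independent {e\<^sub>1, e\<^sub>2}" "e\<^sub>1 \<noteq> e\<^sub>2" using e by (auto simp: independent_insert span_base)
  then have "UNIV \<subseteq> span {e\<^sub>1, e\<^sub>2}"
    by (intro card_ge_dim_independent) auto
  then have "X \<in> span {e\<^sub>1, e\<^sub>2}" by blast
  then show ?thesis
    using that by (auto simp: span_insert span_singleton algebra_simps)
qed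

lemma T1_line:
  assumes X: "X \<in> T\<^sub>1 x" "X \<noteq> 0"
  shows "T\<^sub>1 x \<subseteq> span {X}"
proof
  fix Z assume Z: "Z \<in> T\<^sub>1 x"
  obtain e where e: "e \<in> T\<^sub>2 x" "e \<noteq> 0" using T2_nontrivial by blast
  obtain c d where cd: "Z = c *\<^sub>R X + d *\<^sub>R e" using curvature_directions_span[OF X e] .
  have "d *\<^sub>R e \<in> T\<^sub>1 x"
    using subspace_diff[OF subspace_T1 Z subspace_scale[OF subspace_T1 X(1), of c]] cd by simp
  moreover have "d *\<^sub>R e \<in> T\<^sub>2 x"
    using subspace_scale[OF subspace_T2 e(1)] .
  ultimately have "d *\<^sub>R e = 0" by (rule T1_T2_trivial)
  with cd show "Z \<in> span {X}" by (simp add: span_base span_scale)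
qed

text \<open>The two sides differ by the exterior derivative of the 1-form \<open>(\<tt>, d\<ff>)\<close>, which is zero.\<close>

lemma second_fundamental_form_symmetric:
  "\<llangle>dd A \<tt> x X, dd A \<ff> x Y\<rrangle> = \<llangle>dd A \<tt> x Y, dd A \<ff> x X\<rrangle>"
proof -
  have "(\<lambda>x X. \<llangle>\<tt> x, dd A \<ff> x X\<rrangle>) = (\<lambda>_ _. 0)"
    by (auto simp: fun_eq_iff lform_sym[of "\<tt> _"])
  then have "ext_deriv A (\<lambda>x X. \<llangle>\<tt> x, dd A \<ff> x X\<rrangle>) x X Y = 0"
    by (simp add: ext_deriv_def form_rep_def)
  then show ?thesis
    unfolding ext_deriv_bilinear[OF bounded_bilinear_lform smooth_tt smooth_ff] by simp
qed

lemma curvature_directions_orthogonal: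
  assumes "X \<in> T\<^sub>1 x" "Y \<in> T\<^sub>2 x"
  shows "\<llangle>dd A \<ff> x X, dd A \<ff> x Y\<rrangle> = 0"
proof -
  have "(\<kappa>\<^sub>1 x - \<kappa>\<^sub>2 x) * \<llangle>dd A \<ff> x X, dd A \<ff> x Y\<rrangle> = 0"
    using second_fundamental_form_symmetric[of x X Y] T1_tt[OF assms(1)] T2_tt[OF assms(2)]
    by (simp add: lform_linear_simps lform_sym[of "dd A \<ff> x Y"] algebra_simps)
  then show ?thesis using curvatures_differ by simp
qed

end


section \<open>Lie cyclides of a surface in a space form\<close>

context principal_surface
begin

lemma s1_subset_f: "s\<^sub>1 x \<subseteq> f x"
  using s1_curvature_sphere unfolding curvature_sphere_def by blast

lemma s1_section_is_f_section: "section_on A s\<^sub>1 U \<sigma> \<Longrightarrow> section_on A f U \<sigma>"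
  using s1_subset_f unfolding section_on_def by blast

lemma s1_eq_span:
  assumes "v \<in> s\<^sub>1 x" "v \<noteq> 0"
  shows "s\<^sub>1 x = span {v}"
proof -
  obtain c where c: "v = c *\<^sub>R (\<tt> x + \<kappa>\<^sub>1 x *\<^sub>R \<ff> x)"
    using assms(1) unfolding s1_eq by (auto simp: span_singleton)
  then have "(1 / c) *\<^sub>R v = \<tt> x + \<kappa>\<^sub>1 x *\<^sub>R \<ff> x" using assms(2) by auto
  then have "\<tt> x + \<kappa>\<^sub>1 x *\<^sub>R \<ff> x \<in> span {v}" by (metis span_base span_scale singletonI)
  then have "s\<^sub>1 x \<subseteq> span {v}" unfolding s1_eq by (intro span_minimal subspace_span) simp
  moreover have "span {v} \<subseteq> s\<^sub>1 x"
    using assms(1) unfolding s1_eq by (intro span_minimal subspace_span) simp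
  ultimately show ?thesis by (rule subset_antisym)
qed

lemma s1_combination:
  assumes "v \<in> s\<^sub>1 x"
  shows "v = (- \<llangle>v, \<pp>\<rrangle>) *\<^sub>R (\<tt> x + \<kappa>\<^sub>1 x *\<^sub>R \<ff> x)"
proof -
  obtain c where "v = c *\<^sub>R (\<tt> x + \<kappa>\<^sub>1 x *\<^sub>R \<ff> x)"
    using assms unfolding s1_eq by (auto simp: span_singleton)
  then show ?thesis by (simp add: lform_linear_simps)
qed

lemma reference_section:
  obtains U \<sigma> where "x \<in> U" "section_on A s\<^sub>1 U \<sigma>" "\<And>r. r \<in> U \<Longrightarrow> \<sigma> r \<noteq> 0"
proof -
  have "smooth_subbundle A 1 s\<^sub>1" using umbilic_free by (simp add: umbilic_free_def)
  then have "\<exists>U \<sigma>. open U \<and> x \<in> U \<and> (\<forall>i<1. smooth_map A U (\<sigma> i)) \<and>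
      (\<forall>r\<in>U. s\<^sub>1 r = span ((\<lambda>i::nat. \<sigma> i r) ` {..<1}) \<and> dim (s\<^sub>1 r) = 1)"
    unfolding smooth_subbundle_def by (rule spec)
  then obtain U \<sigma> where U: "open U" "x \<in> U" "\<forall>i<1. smooth_map A U (\<sigma> i)"
      "\<forall>r\<in>U. s\<^sub>1 r = span ((\<lambda>i::nat. \<sigma> i r) ` {..<1}) \<and> dim (s\<^sub>1 r) = 1"
    by (elim exE conjE) (rule that)
  have s: "s\<^sub>1 r = span {\<sigma> 0 r}" "dim (s\<^sub>1 r) = 1" if "r \<in> U" for r
    using U(4) that by (auto simp: lessThan_Suc)
  show ?thesis
  proof
    show "section_on A s\<^sub>1 U (\<sigma> 0)"
      using U(1,3) s(1) by (auto simp: section_on_def span_base)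
    show "\<sigma> 0 r \<noteq> 0" if "r \<in> U" for r
      using s[OF that] by auto
  qed (fact U(2))
qed

text \<open>On \<open>T\<^sub>1\<close> the linear map \<open>\<theta>(X) = (\<sigma>, \<qq>) d\<^sub>X\<ff> + (\<sigma>, \<pp>) d\<^sub>X\<tt>\<close> vanishes, where \<open>\<sigma>\<close> is a section
  of \<open>s\<^sub>1\<close>. A component \<open>(m\<^sub>1, m\<^sub>2)\<close> of \<open>\<theta>\<close> in the chart that does not vanish at \<open>x\<close> provides the smooth
  field \<open>(m\<^sub>2, -m\<^sub>1)\<close>, which spans its kernel.\<close>

lemma reference_field:
  obtains W Y where "x \<in> W" "field_on A T\<^sub>1 W Y" "\<And>r. r \<in> W \<Longrightarrow> Y r \<noteq> 0"
proof -
  obtain U \<sigma> where U: "x \<in> U" "section_on A s\<^sub>1 U \<sigma>" "\<And>r. r \<in> U \<Longrightarrow> \<sigma> r \<noteq> 0"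
    by (rule reference_section[of x]) (rule that)
  have opU: "open U" and sm: "smooth_map A U \<sigma>" using U(2) by (auto simp: section_on_def)
  let ?a = "\<lambda>r. \<llangle>\<sigma> r, \<qq>\<rrangle>" and ?b = "\<lambda>r. \<llangle>\<sigma> r, \<pp>\<rrangle>"
  have T: "T\<^sub>1 r = {X. ?a r *\<^sub>R dd A \<ff> r X + ?b r *\<^sub>R dd A \<tt> r X = 0}" if "r \<in> U" for r
  proof -
    have "\<sigma> r \<in> s\<^sub>1 r" using U(2) that by (auto simp: section_on_def)
    from curvature_space_line[of "\<sigma> r" r] s1_eq_span[OF this U(3)[OF that]] this s1_subset_f[of r]
    show ?thesis unfolding curvature_subbundle_def by auto
  qed
  let ?V = "chart_dom A x \<inter> U"
  let ?S = "chart_map A x ` ?V" and ?i = "chart_inv A x"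
  have opV: "open ?V" and opS: "open ?S" using opU by (auto intro: open_chart_image)
  define \<theta> where "\<theta> y v = ?a (?i y) *\<^sub>R frechet_derivative (\<ff> \<circ> ?i) (at y) v +
    ?b (?i y) *\<^sub>R frechet_derivative (\<tt> \<circ> ?i) (at y) v" for y v
  have \<theta>: "\<theta> (chart_map A x r) v = ?a r *\<^sub>R dd A \<ff> r (tchange A x r r v) + ?b r *\<^sub>R dd A \<tt> r (tchange A x r r v)"
    if "r \<in> ?V" for r v
    using that dd_tchange[OF open_UNIV smooth_ff UNIV_I, of r x v]
      dd_tchange[OF open_UNIV smooth_tt UNIV_I, of r x v] by (simp add: \<theta>_def)
  have lin_\<theta>: "linear (\<theta> (chart_map A x r))" if "r \<in> ?V" for r
  proof -
    have r: "r \<in> chart_dom A x" using that by simp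
    have "linear (frechet_derivative (\<ff> \<circ> ?i) (at (chart_map A x r)))"
      "linear (frechet_derivative (\<tt> \<circ> ?i) (at (chart_map A x r)))"
      using has_derivative_linear[OF smooth_map_has_derivative[OF open_UNIV smooth_ff UNIV_I r]]
        has_derivative_linear[OF smooth_map_has_derivative[OF open_UNIV smooth_tt UNIV_I r]] .
    then show ?thesis unfolding \<theta>_def
      by (intro linear_compose_add linear_compose_scale_right)
  qed
  obtain e where e: "e \<in> T\<^sub>2 x" "e \<noteq> 0" using T2_nontrivial by blast
  define w where "w = \<theta> (chart_map A x x) e"
  have w0: "w \<noteq> 0"
  proof
    assume "w = 0"
    then have "e \<in> T\<^sub>1 x" using \<theta>[of x e] U(1) T[OF U(1)] by (simp add: w_def tchange_same)
    with T1_T2_trivial e show False by blast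
  qed
  define m where "m v y = w \<bullet> \<theta> y v" for v y
  have sm_ab: "smooth_map A U ?a" "smooth_map A U ?b"
    using smooth_map_bounded_linear[OF opU bounded_linear_lform_left sm] by auto
  have ft: "smooth_on ?S (\<ff> \<circ> ?i)" "smooth_on ?S (\<tt> \<circ> ?i)"
    using smooth_map_chart[OF smooth_map_subset[OF smooth_ff], of U x]
      smooth_map_chart[OF smooth_map_subset[OF smooth_tt], of U x] by auto
  have "smooth_on ?S (\<lambda>y. \<theta> y v)" for v
    unfolding \<theta>_def
    using smooth_map_chart[OF sm_ab(1), of x] smooth_map_chart[OF sm_ab(2), of x]
    by (intro smooth_on_add smooth_on_bilinear[OF _ bounded_bilinear_scaleR] opS smooth_on_frechet_derivative ft)
      (simp_all add: o_def)
  then have sm_m: "smooth_on ?S (m v)" for v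
    unfolding m_def by (rule smooth_on_bounded_linear[OF opS bounded_linear_inner_right])
  let ?i1 = "axis 1 1 :: real^2" and ?i2 = "axis 2 1 :: real^2"
  define Z where "Z y = m ?i2 y *\<^sub>R ?i1 + (- m ?i1 y) *\<^sub>R ?i2" for y
  have sm_Z: "smooth_on ?S Z"
    unfolding Z_def
    by (intro smooth_on_add[OF opS]
        smooth_on_bounded_linear[OF opS bounded_linear_scaleR_left]
        smooth_on_bounded_linear[OF opS bounded_linear_minus[OF bounded_linear_ident]] sm_m)
  have basis: "v = v $ 1 *\<^sub>R ?i1 + v $ 2 *\<^sub>R ?i2" for v :: "real^2"
    by (simp add: vec_eq_iff axis_def forall_2)
  have m_basis: "m v y = v $ 1 * m ?i1 y + v $ 2 * m ?i2 y" if y: "y \<in> ?S" for v y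
  proof -
    obtain r where "r \<in> ?V" "y = chart_map A x r" using y by blast
    then have lin: "linear (\<theta> y)" using lin_\<theta> by simp
    have "\<theta> y v = v $ 1 *\<^sub>R \<theta> y ?i1 + v $ 2 *\<^sub>R \<theta> y ?i2"
      by (subst basis[of v]) (simp only: linear_add[OF lin] linear_scale[OF lin])
    then show ?thesis by (simp add: m_def inner_add_right)
  qed
  have Z0: "Z y = 0 \<longleftrightarrow> m ?i1 y = 0 \<and> m ?i2 y = 0" for y
    by (auto simp: Z_def vec_eq_iff axis_def forall_2)
  have xS: "chart_map A x x \<in> ?S" using U(1) by auto
  have "m e (chart_map A x x) \<noteq> 0" using w0 by (simp add: m_def w_def)
  then have Zx: "Z (chart_map A x x) \<noteq> 0" unfolding Z0 m_basis[OF xS, of e] by auto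
  define W where "W = {r \<in> ?V. Z (chart_map A x r) \<noteq> 0}"
  have "continuous_on ?V (\<lambda>r. Z (chart_map A x r))"
    by (rule continuous_on_compose2[OF smooth_on_continuous[OF sm_Z]
          continuous_on_subset[OF homeomorphism_cont1[OF chart_homeomorphism]]]) auto
  from continuous_open_preimage[OF this opV open_Compl[OF closed_singleton[of 0]]]
  have opW: "open W" by (simp add: W_def vimage_def Int_def)
  have WV: "W \<subseteq> ?V" by (auto simp: W_def)
  define Y where "Y r = tchange A x r r (Z (chart_map A x r))" for r
  have sm_Y: "smooth_field A W Y"
    unfolding Y_def using WV
    by (intro smooth_field_single_chart opW smooth_on_subset[OF sm_Z]) auto
  have Y: "Y r \<in> T\<^sub>1 r" "Y r \<noteq> 0" if "r \<in> W" for r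
  proof -
    have rV: "r \<in> ?V" and Zr: "Z (chart_map A x r) \<noteq> 0" using that by (auto simp: W_def)
    then have r: "r \<in> chart_dom A x" "r \<in> U" by auto
    let ?y = "chart_map A x r"
    have y: "?y \<in> ?S" using rV by blast
    show "Y r \<noteq> 0"
    proof
      assume "Y r = 0"
      then have "tchange A r x r (Y r) = 0" using linear_0[OF linear_tchange[of r r x]] r by simp
      moreover have "tchange A r x r (Y r) = Z ?y"
        unfolding Y_def using r by (simp add: tchange_tchange tchange_same)
      ultimately show False using Zr by simp
    qed
    obtain E where E: "E \<in> T\<^sub>1 r" "E \<noteq> 0" using T1_nontrivial by blast
    define v where "v = tchange A r x r E"
    have Ev: "tchange A x r r v = E" using r by (simp add: v_def tchange_tchange tchange_same)
    have v0: "v \<noteq> 0"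
    proof
      assume "v = 0"
      with Ev linear_0[OF linear_tchange[of r x r]] r have "E = 0" by simp
      with E(2) show False ..
    qed
    have \<theta>v: "\<theta> ?y v = 0" using \<theta>[OF rV, of v] E(1) T[OF r(2)] unfolding Ev by simp
    then have mv: "v $ 1 * m ?i1 ?y + v $ 2 * m ?i2 ?y = 0"
      using m_basis[OF y, of v] by (simp add: m_def)
    have "\<exists>k. Z ?y = k *\<^sub>R v"
    proof (cases "v $ 1 = 0")
      case True
      then have "v $ 2 \<noteq> 0" using v0 by (auto simp: vec_eq_iff forall_2)
      with mv True have "Z ?y = (- m ?i1 ?y / v $ 2) *\<^sub>R v"
        by (auto simp: Z_def vec_eq_iff axis_def forall_2)
      then show ?thesis by blast
    next
      case False
      with mv have "m ?i1 ?y = - v $ 2 * m ?i2 ?y / v $ 1" by (simp add: field_simps)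
      with False have "Z ?y = (m ?i2 ?y / v $ 1) *\<^sub>R v"
        by (auto simp: Z_def vec_eq_iff axis_def forall_2)
      then show ?thesis by blast
    qed
    then obtain k where "Z ?y = k *\<^sub>R v" by blast
    then have "\<theta> ?y (Z ?y) = 0" using \<theta>v linear_scale[OF lin_\<theta>[OF rV]] by simp
    then show "Y r \<in> T\<^sub>1 r" unfolding T[OF r(2)] Y_def using \<theta>[OF rV, of "Z ?y"] by simp
  qed
  show ?thesis
  proof
    show "x \<in> W" using U(1) Zx by (simp add: W_def)
    show "field_on A T\<^sub>1 W Y" using opW sm_Y Y(1) by (simp add: field_on_def)
  qed (fact Y(2))
qed

text \<open>The Lie cyclide is \<open>span {\<sigma>, \<sigma>\<^sub>Y, \<sigma>\<^sub>Y\<^sub>Y}\<close> for one choice of \<open>\<sigma>\<close> and \<open>Y\<close>. Modulo \<open>f\<close> the first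
  derivative is a multiple of \<open>d\<^sub>Y\<ff>\<close>, and the second one is not orthogonal to \<open>\<sigma>\<close>, as
  \<open>(\<sigma>, \<sigma>\<^sub>Y\<^sub>Y) = -(\<sigma>\<^sub>Y, \<sigma>\<^sub>Y)\<close> follows from \<open>(\<sigma>, \<sigma>\<^sub>Y) = 0\<close>.\<close>

lemma cyclide_basis:
  obtains \<sigma> g h u k Y where
    "s\<^sub>1 x = span {\<sigma>}" "\<sigma> \<in> s\<^sub>1 x" "\<sigma> \<in> S\<^sub>1 x" "g \<in> S\<^sub>1 x" "S\<^sub>1 x \<subseteq> span {h, g, \<sigma>}"
    "Y \<in> T\<^sub>2 x" "Y \<noteq> 0" "u \<in> f x" "k \<noteq> 0" "g = u + k *\<^sub>R dd A \<ff> x Y" "\<llangle>\<sigma>, h\<rrangle> \<noteq> 0"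
proof -
  obtain U \<sigma> where U: "x \<in> U" "section_on A s\<^sub>1 U \<sigma>" "\<And>r. r \<in> U \<Longrightarrow> \<sigma> r \<noteq> 0"
    by (rule reference_section[of x]) (rule that)
  obtain V Y where V: "x \<in> V" "field_on A T\<^sub>2 V Y" "\<And>r. r \<in> V \<Longrightarrow> Y r \<noteq> 0"
    by (rule principal_surface.reference_field[OF exchanged, of x]) (rule that)
  define W where "W = U \<inter> V"
  have W: "open W" "x \<in> W" "W \<subseteq> U" "W \<subseteq> V" using U V by (auto simp: W_def section_on_def field_on_def)
  have \<sigma>: "section_on A s\<^sub>1 W \<sigma>"
    using U(2) W smooth_map_subset unfolding section_on_def by blast
  have Y: "field_on A T\<^sub>2 W Y"
    using V(2) W smooth_field_subset unfolding field_on_def by blast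
  have sm: "smooth_map A W \<sigma>" "smooth_field A W Y" using \<sigma> Y by (auto simp: section_on_def field_on_def)
  have \<sigma>0: "\<sigma> r \<noteq> 0" and Y0: "Y r \<noteq> 0" if "r \<in> W" for r using that W U(3) V(3) by auto
  have \<sigma>s: "\<sigma> r \<in> s\<^sub>1 r" and Yt: "Y r \<in> T\<^sub>2 r" if "r \<in> W" for r
    using that \<sigma> Y by (auto simp: section_on_def field_on_def)
  let ?g = "\<lambda>r. dd A \<sigma> r (Y r)"
  have smg: "smooth_map A W ?g" using smooth_map_dd[OF W(1) sm] .
  have f\<sigma>: "section_on A f W \<sigma>" using s1_section_is_f_section[OF \<sigma>] .
  define u where "u = - \<llangle>?g x, \<qq>\<rrangle> *\<^sub>R \<ff> x - \<llangle>?g x, \<pp>\<rrangle> *\<^sub>R \<tt> x"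
  define c where "c = - \<llangle>\<sigma> x, \<pp>\<rrangle>"
  define k where "k = c * (\<kappa>\<^sub>1 x - \<kappa>\<^sub>2 x)"
  have \<sigma>x: "\<sigma> x = c *\<^sub>R (\<tt> x + \<kappa>\<^sub>1 x *\<^sub>R \<ff> x)"
    unfolding c_def by (rule s1_combination[OF \<sigma>s[OF W(2)]])
  have "c \<noteq> 0" using \<sigma>x \<sigma>0[OF W(2)] by auto
  then have k0: "k \<noteq> 0" using curvatures_differ by (simp add: k_def)
  have uf: "u \<in> f x"
    unfolding u_def by (intro subspace_diff[OF subspace_f] subspace_scale[OF subspace_f] ff_in tt_in)
  have "\<llangle>\<sigma> x, \<qq>\<rrangle> = - c * \<kappa>\<^sub>1 x" "\<llangle>\<sigma> x, \<pp>\<rrangle> = - c"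
    by (simp_all add: \<sigma>x lform_linear_simps)
  then have g_eq: "?g x = u + k *\<^sub>R dd A \<ff> x (Y x)"
    using section_derivative[OF f\<sigma> W(2), of "Y x"] T2_tt[OF Yt[OF W(2)]]
    unfolding u_def[symmetric] by (simp add: k_def algebra_simps)
  have perp: "\<llangle>\<sigma> r, ?g r\<rrangle> = 0" if "r \<in> W" for r
    using section_derivative_perp[OF f\<sigma> that, of "\<sigma> r"] \<sigma>s[OF that] s1_subset_f
    by (auto simp: lform_sym[of "\<sigma> r"])
  have "\<llangle>?g x, ?g x\<rrangle> = k\<^sup>2 * \<llangle>dd A \<ff> x (Y x), dd A \<ff> x (Y x)\<rrangle>"
    unfolding g_eq using uf f_isotropic[OF uf uf]
    by (simp add: lform_linear_simps lform_sym[of u "dd A \<ff> x (Y x)"] power2_eq_square)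
  then have gg: "\<llangle>?g x, ?g x\<rrangle> \<noteq> 0" using k0 dd_ff_positive[OF Y0[OF W(2)], of x] by auto
  have "dd A (\<lambda>r. \<llangle>\<sigma> r, ?g r\<rrangle>) x (Y x) = 0"
  proof -
    have "dd A (\<lambda>r. \<llangle>\<sigma> r, ?g r\<rrangle>) x (Y x) = dd A (\<lambda>_. 0 :: real) x (Y x)"
      by (rule dd_cong[OF W(1,2) smooth_map_const]) (simp add: perp)
    then show ?thesis by simp
  qed
  then have "\<llangle>\<sigma> x, dd A ?g x (Y x)\<rrangle> + \<llangle>?g x, ?g x\<rrangle> = 0"
    unfolding dd_bilinear[OF W(1,2) bounded_bilinear_lform sm(1) smg] .
  with gg have h: "\<llangle>\<sigma> x, dd A ?g x (Y x)\<rrangle> \<noteq> 0" by auto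
  have "S\<^sub>1 x \<subseteq> span {\<sigma> x, ?g x, dd A ?g x (Y x)}"
  proof (rule lie_cyclide_subset_span[OF W(1,2) sm(1) \<sigma>0 _ sm(2) Y0])
    show "s\<^sub>1 r \<subseteq> span {\<sigma> r}" if "r \<in> W" for r using s1_eq_span[OF \<sigma>s \<sigma>0] that by blast
    show "T\<^sub>2 r \<subseteq> span {Y r}" if "r \<in> W" for r
      using principal_surface.T1_line[OF exchanged Yt Y0] that by blast
  qed
  also have "{\<sigma> x, ?g x, dd A ?g x (Y x)} = {dd A ?g x (Y x), ?g x, \<sigma> x}" by auto
  finally have "S\<^sub>1 x \<subseteq> span {dd A ?g x (Y x), ?g x, \<sigma> x}" .
  from that[OF s1_eq_span[OF \<sigma>s[OF W(2)] \<sigma>0[OF W(2)]] \<sigma>s[OF W(2)]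
      lie_cyclide_contains[OF W(2) \<sigma> Y] this Yt[OF W(2)] Y0[OF W(2)] uf k0 g_eq h]
  show ?thesis .
qed

text \<open>Pairing a combination of \<open>\<sigma>\<^sub>Y\<^sub>Y, \<sigma>\<^sub>Y, \<sigma>\<close> that lies in \<open>f\<close> first with \<open>\<sigma>\<close> and then with \<open>\<sigma>\<^sub>Y\<close> leaves
  only the multiples of \<open>\<sigma>\<close>. So \<open>S\<^sub>1\<close> meets \<open>f\<close> in \<open>s\<^sub>1\<close>.\<close>

lemma other_sphere_notin_cyclide: "\<tt> x + \<kappa>\<^sub>2 x *\<^sub>R \<ff> x \<notin> S\<^sub>1 x"
proof
  obtain \<sigma> g h u k Y where b: "s\<^sub>1 x = span {\<sigma>}" "\<sigma> \<in> s\<^sub>1 x" "S\<^sub>1 x \<subseteq> span {h, g, \<sigma>}"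
    "Y \<in> T\<^sub>2 x" "Y \<noteq> 0" "u \<in> f x" "k \<noteq> 0" "g = u + k *\<^sub>R dd A \<ff> x Y" "\<llangle>\<sigma>, h\<rrangle> \<noteq> 0"
    by (rule cyclide_basis[of x]) (rule that)
  let ?w = "\<tt> x + \<kappa>\<^sub>2 x *\<^sub>R \<ff> x"
  assume "?w \<in> S\<^sub>1 x"
  with b(3) have "?w \<in> span {h, g, \<sigma>}" by blast
  then obtain c b' a where w: "?w = c *\<^sub>R h + b' *\<^sub>R g + a *\<^sub>R \<sigma>"
    by (auto simp: span_insert span_singleton algebra_simps)
  have wf: "?w \<in> f x" using f_combination[of "\<kappa>\<^sub>2 x" x 1] by (simp add: add.commute)
  have \<sigma>f: "\<sigma> \<in> f x" using b(2) s1_subset_f by blast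
  have fg: "\<llangle>v, g\<rrangle> = 0" if "v \<in> f x" for v
    using that f_isotropic[OF that b(6)] by (simp add: b(8) lform_linear_simps lform_sym[of v "dd A \<ff> x Y"])
  have "\<llangle>\<sigma>, ?w\<rrangle> = c * \<llangle>\<sigma>, h\<rrangle>"
    unfolding w using fg[OF \<sigma>f] f_isotropic[OF \<sigma>f \<sigma>f] by (simp add: lform_linear_simps)
  then have "c = 0" using f_isotropic[OF \<sigma>f wf] b(9) by simp
  have "\<llangle>?w, g\<rrangle> = b' * \<llangle>g, g\<rrangle>"
    unfolding w \<open>c = 0\<close> using fg[OF \<sigma>f] by (simp add: lform_linear_simps)
  moreover have "\<llangle>g, g\<rrangle> \<noteq> 0"
  proof -
    have "\<llangle>g, g\<rrangle> = k\<^sup>2 * \<llangle>dd A \<ff> x Y, dd A \<ff> x Y\<rrangle>"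
      unfolding b(8) using b(6) f_isotropic[OF b(6) b(6)]
      by (simp add: lform_linear_simps lform_sym[of u "dd A \<ff> x Y"] power2_eq_square)
    then show ?thesis using b(7) dd_ff_positive[OF b(5), of x] by auto
  qed
  ultimately have "b' = 0" using fg[OF wf] by simp
  have "?w \<in> s\<^sub>1 x" unfolding w \<open>c = 0\<close> \<open>b' = 0\<close> b(1) by (simp add: span_base span_scale)
  from s1_combination[OF this] have "\<llangle>?w, \<qq>\<rrangle> = \<llangle>(- \<llangle>?w, \<pp>\<rrangle>) *\<^sub>R (\<tt> x + \<kappa>\<^sub>1 x *\<^sub>R \<ff> x), \<qq>\<rrangle>"
    by (rule arg_cong)
  then show False using curvatures_differ[of x] by (simp add: lform_linear_simps)
qed

text \<open>For a section \<open>\<sigma>\<close> of \<open>s\<^sub>2\<close>, pairing with \<open>\<sigma>\<close> removes \<open>\<sigma>\<^sub>X\<^sub>X\<close> from a representation of \<open>d\<^sub>Y\<ff>\<close>; what remains,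
  \<open>f\<close> and \<open>\<sigma>\<^sub>X\<close>, is orthogonal to \<open>d\<^sub>Y\<ff>\<close>.\<close>

lemma transversal_derivative_notin:
  assumes Y: "Y \<in> T\<^sub>2 x" "Y \<noteq> 0"
  shows "dd A \<ff> x Y \<notin> span (S\<^sub>2 x \<union> f x)"
proof
  obtain \<sigma> g h u k X where b: "\<sigma> \<in> s\<^sub>2 x" "S\<^sub>2 x \<subseteq> span {h, g, \<sigma>}"
    "X \<in> T\<^sub>1 x" "u \<in> f x" "g = u + k *\<^sub>R dd A \<ff> x X" "\<llangle>\<sigma>, h\<rrangle> \<noteq> 0"
    by (rule principal_surface.cyclide_basis[OF exchanged, of x]) (rule that)
  have \<sigma>f: "\<sigma> \<in> f x" using b(1) principal_surface.s1_subset_f[OF exchanged] by blast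
  have "{h, g, \<sigma>} \<subseteq> insert h (insert g (f x))" using \<sigma>f by auto
  then have "S\<^sub>2 x \<subseteq> span (insert h (insert g (f x)))" using b(2) span_mono by blast
  moreover have "f x \<subseteq> span (insert h (insert g (f x)))" by (auto intro: span_base)
  ultimately have sub: "span (S\<^sub>2 x \<union> f x) \<subseteq> span (insert h (insert g (f x)))"
    by (intro span_minimal subspace_span) blast
  let ?Y = "dd A \<ff> x Y"
  assume "?Y \<in> span (S\<^sub>2 x \<union> f x)"
  then have "?Y \<in> span (insert h (insert g (f x)))" using sub by blast
  then obtain c b' where "?Y - c *\<^sub>R h - b' *\<^sub>R g \<in> span (f x)" by (auto simp: span_breakdown_eq)
  then have v: "?Y - c *\<^sub>R h - b' *\<^sub>R g \<in> f x" (is "?v \<in> _") using subspace_f by (simp add: span_eq_iff[THEN iffD2])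
  have Y_eq: "?Y = c *\<^sub>R h + b' *\<^sub>R g + ?v" by simp
  have fg: "\<llangle>w, g\<rrangle> = 0" if "w \<in> f x" for w
    using that f_isotropic[OF that b(4)] by (simp add: b(5) lform_linear_simps lform_sym[of w "dd A \<ff> x X"])
  have "\<llangle>\<sigma>, ?Y\<rrangle> = c * \<llangle>\<sigma>, h\<rrangle> + b' * \<llangle>\<sigma>, g\<rrangle> + \<llangle>\<sigma>, ?v\<rrangle>"
    by (subst Y_eq) (simp only: lform_add_right lform_scaleR_right)
  then have "c = 0"
    using fg[OF \<sigma>f] f_isotropic[OF \<sigma>f v] \<sigma>f b(6) by (simp add: lform_sym[of \<sigma> ?Y])
  have "\<llangle>?Y, ?Y\<rrangle> = b' * \<llangle>?Y, g\<rrangle> + \<llangle>?Y, ?v\<rrangle>"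
    by (subst (2) Y_eq) (simp only: \<open>c = 0\<close> lform_add_right lform_scaleR_right scaleR_zero_left lform_zero_right add_0)
  also have "\<llangle>?Y, ?v\<rrangle> = 0" using v by simp
  also have "\<llangle>?Y, g\<rrangle> = 0"
    using b(4) curvature_directions_orthogonal[OF b(3) Y(1)]
    by (simp add: b(5) lform_linear_simps lform_sym[of ?Y "dd A \<ff> x X"])
  finally show False using dd_ff_positive[OF Y(2), of x] by simp
qed

text \<open>A section \<open>\<tau> = h \<ff> \<and> \<tt>\<close> of \<open>\<and>\<^sup>2f\<close> satisfies
  \<open>d\<^sub>Y\<tau> = h d\<^sub>Y\<ff> \<and> (\<tt> + \<kappa>\<^sub>2\<ff>)\<close> modulo \<open>\<and>\<^sup>2f\<close> for \<open>Y \<in> T\<^sub>2\<close>. If \<open>\<tau>\<close> preserves the middle condition, then \<open>d\<^sub>Y\<tau>\<close>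
  lies in \<open>\<and>\<^sup>2f + \<and>\<^sup>2S\<^sub>1 + \<and>\<^sup>2S\<^sub>2\<close>. Evaluation at a vector orthogonal to \<open>S\<^sub>2\<close> and \<open>f\<close>, but not to \<open>d\<^sub>Y\<ff>\<close>,
  then places \<open>h (\<tt> + \<kappa>\<^sub>2\<ff>)\<close> in \<open>S\<^sub>1\<close>, whence \<open>h = 0\<close>.\<close>

lemma middle_condition_unique:
  assumes \<eta>: "middle_condition A f s\<^sub>1 s\<^sub>2 \<eta>"
    and \<nu>: "middle_condition A f s\<^sub>1 s\<^sub>2 (\<lambda>x X. \<eta> x X - dd A \<tau> x X)"
    and \<tau>: "section_on A (\<lambda>x. wedge_space (f x) (f x)) UNIV \<tau>"
  shows "\<tau> x = 0"
proof -
  define h where "h r = - \<llangle>blinfun_apply (\<tau> r) \<pp>, \<qq>\<rrangle>" for r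
  have \<tau>_smooth: "smooth_map A UNIV \<tau>" using \<tau> by (simp add: section_on_def)
  have \<tau>_eq: "\<tau> r = h r *\<^sub>R wedge (\<ff> r) (\<tt> r)" for r
  proof -
    have "\<tau> r \<in> wedge_space (f r) (f r)" using \<tau> by (simp add: section_on_def)
    then obtain c where "\<tau> r = c *\<^sub>R wedge (\<ff> r) (\<tt> r)"
      unfolding f_eq_span wedge_space_eq_line by blast
    then show ?thesis by (simp add: h_def wedge_apply blinfun.scaleR_left lform_linear_simps)
  qed
  have bl: "bounded_linear (\<lambda>\<omega>. - \<llangle>blinfun_apply \<omega> \<pp>, \<qq>\<rrangle>)"
    by (intro bounded_linear_minus bounded_linear_compose[OF bounded_linear_lform_left] blinfun.bounded_linear_left)
  have h_smooth: "smooth_map A UNIV h"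
    unfolding h_def by (rule smooth_map_bounded_linear[OF open_UNIV bl \<tau>_smooth])
  have w_smooth: "smooth_map A UNIV (\<lambda>r. wedge (\<ff> r) (\<tt> r))"
    by (rule smooth_map_bilinear[OF open_UNIV bounded_bilinear_wedge smooth_ff smooth_tt])
  obtain Y where Y: "Y \<in> T\<^sub>2 x" "Y \<noteq> 0" using T2_nontrivial by blast
  let ?Y = "dd A \<ff> x Y"
  have d\<tau>: "dd A \<tau> x Y = h x *\<^sub>R (wedge (\<ff> x) (dd A \<tt> x Y) + wedge ?Y (\<tt> x)) + dd A h x Y *\<^sub>R wedge (\<ff> x) (\<tt> x)"
  proof -
    have "\<tau> = (\<lambda>r. h r *\<^sub>R wedge (\<ff> r) (\<tt> r))" using \<tau>_eq by blast
    then show ?thesis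
      using dd_bilinear[OF open_UNIV UNIV_I bounded_bilinear_scaleR h_smooth w_smooth, of x Y]
        dd_bilinear[OF open_UNIV UNIV_I bounded_bilinear_wedge smooth_ff smooth_tt, of x Y] by simp
  qed
  obtain x0 where x0: "\<And>w. w \<in> span (S\<^sub>2 x \<union> f x) \<Longrightarrow> \<llangle>w, x0\<rrangle> = 0" "\<llangle>?Y, x0\<rrangle> \<noteq> 0"
    by (rule lform_separation[OF subspace_span transversal_derivative_notin[OF Y]]) (rule that)
  have x0_S2: "\<llangle>w, x0\<rrangle> = 0" if "w \<in> S\<^sub>2 x" for w using x0(1) that by (simp add: span_base)
  have x0_f: "\<llangle>w, x0\<rrangle> = 0" if "w \<in> f x" for w using x0(1) that by (simp add: span_base)
  let ?R = "{\<omega>. blinfun_apply \<omega> x0 \<in> S\<^sub>1 x}"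
  have R: "subspace ?R"
    using subspace_lie_cyclide[of s\<^sub>1 T\<^sub>2 x]
    by (auto simp: subspace_def blinfun.add_left blinfun.scaleR_left)
  have "wedge_space (S\<^sub>1 x) (S\<^sub>1 x) \<subseteq> ?R"
    unfolding wedge_space_def
    by (rule span_minimal[OF _ R])
      (auto simp: wedge_apply intro!: subspace_diff[OF subspace_lie_cyclide] subspace_scale[OF subspace_lie_cyclide])
  moreover have "wedge_space (S\<^sub>2 x) (S\<^sub>2 x) \<subseteq> ?R"
    unfolding wedge_space_def
    by (rule span_minimal[OF _ R])
      (auto simp: wedge_apply x0_S2 subspace_0[OF subspace_lie_cyclide])
  ultimately have Z: "span (wedge_space (S\<^sub>1 x) (S\<^sub>1 x) \<union> wedge_space (S\<^sub>2 x) (S\<^sub>2 x)) \<subseteq> ?R"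
    by (intro span_minimal R) blast
  have ff: "wedge_space (f x) (f x) \<subseteq> ?R"
    unfolding wedge_space_def
    by (rule span_minimal[OF _ R])
      (auto simp: wedge_apply x0_f subspace_0[OF subspace_lie_cyclide])
  obtain m where m: "mixed_component (S\<^sub>1 x) (S\<^sub>2 x) (\<eta> x Y) m" "m \<in> wedge_space (f x) (f x)"
    using \<eta> unfolding middle_condition_def Let_def by blast
  obtain n where n: "mixed_component (S\<^sub>1 x) (S\<^sub>2 x) (\<eta> x Y - dd A \<tau> x Y) n" "n \<in> wedge_space (f x) (f x)"
    using \<nu> unfolding middle_condition_def Let_def by blast
  have "\<eta> x Y - m \<in> ?R" "\<eta> x Y - dd A \<tau> x Y - n \<in> ?R" "m \<in> ?R" "n \<in> ?R"
    using m n Z ff unfolding mixed_component_def by blast+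
  then have "(\<eta> x Y - m) - (\<eta> x Y - dd A \<tau> x Y - n) + m - n \<in> ?R"
    using subspace_diff[OF R] subspace_add[OF R] by blast
  then have "blinfun_apply (dd A \<tau> x Y) x0 \<in> S\<^sub>1 x" by simp
  also have "blinfun_apply (dd A \<tau> x Y) x0 = (h x * \<llangle>?Y, x0\<rrangle>) *\<^sub>R (\<tt> x + \<kappa>\<^sub>2 x *\<^sub>R \<ff> x)"
    using x0_f[OF ff_in] x0_f[OF tt_in]
    by (simp add: d\<tau> blinfun.add_left blinfun.scaleR_left wedge_apply T2_tt[OF Y(1)] lform_linear_simps algebra_simps)
  finally have in_S1: "(h x * \<llangle>?Y, x0\<rrangle>) *\<^sub>R (\<tt> x + \<kappa>\<^sub>2 x *\<^sub>R \<ff> x) \<in> S\<^sub>1 x" .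
  have "h x = 0"
  proof (rule ccontr)
    assume "h x \<noteq> 0"
    then have "h x * \<llangle>?Y, x0\<rrangle> \<noteq> 0" using x0(2) by simp
    then have "\<tt> x + \<kappa>\<^sub>2 x *\<^sub>R \<ff> x \<in> S\<^sub>1 x"
      using subspace_scale[OF subspace_lie_cyclide in_S1, of "1 / (h x * \<llangle>?Y, x0\<rrangle>)"] by simp
    with other_sphere_notin_cyclide show False by blast
  qed
  then show ?thesis by (simp add: \<tau>_eq[of x])
qed

end


section \<open>The middle potential of a linear Weingarten surface\<close>

locale weingarten_surface = principal_surface +
  fixes a b c :: real
  assumes weingarten: "linear_weingarten a b c \<kappa>\<^sub>1 \<kappa>\<^sub>2" and non_tubular: "\<not> tubular a b c"
begin

lemma exchanged_weingarten: "weingarten_surface A f s\<^sub>2 s\<^sub>1 \<qq> \<pp> \<ff> \<tt> \<kappa>\<^sub>2 \<kappa>\<^sub>1 a b c"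
proof -
  have "linear_weingarten a b c \<kappa>\<^sub>2 \<kappa>\<^sub>1"
    using weingarten unfolding linear_weingarten_def by (simp add: mult.commute add.commute)
  with exchanged non_tubular show ?thesis
    by (simp add: weingarten_surface_def weingarten_surface_axioms_def)
qed

lemma weingarten_eq: "a * (\<kappa>\<^sub>1 x * \<kappa>\<^sub>2 x) + b * (\<kappa>\<^sub>1 x + \<kappa>\<^sub>2 x) + c = 0"
  using weingarten unfolding linear_weingarten_def Let_def by (simp add: algebra_simps add_divide_distrib)

lemma discriminant: "a * c - b\<^sup>2 \<noteq> 0"
  using non_tubular by (simp add: tubular_def)

text \<open>\<open>\<pp> + t \<pp>\<^sub>1\<close> and \<open>\<qq> + t \<qq>\<^sub>1\<close> will be the conserved quantities.\<close>

definition \<pp>\<^sub>1 :: "'a \<Rightarrow> 'b" where "\<pp>\<^sub>1 r = a *\<^sub>R \<tt> r + (- b) *\<^sub>R \<ff> r"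
definition \<qq>\<^sub>1 :: "'a \<Rightarrow> 'b" where "\<qq>\<^sub>1 r = c *\<^sub>R \<ff> r + (- b) *\<^sub>R \<tt> r"

text \<open>This is the form \<open>\<eta>\<close> of the introduction, equal to
  \<open>c \<ff> \<and> d\<ff> - b (\<ff> \<and> d\<tt> + \<tt> \<and> d\<ff>) + a \<tt> \<and> d\<tt>\<close>.\<close>

definition potential :: "('a, 'b \<Rightarrow>\<^sub>L 'b) form1" where
  "potential x X = wedge (\<ff> x) (dd A \<qq>\<^sub>1 x X) + wedge (\<tt> x) (dd A \<pp>\<^sub>1 x X)"

lemma smooth_combination: "smooth_map A UNIV (\<lambda>r. k *\<^sub>R \<ff> r + l *\<^sub>R \<tt> r)"
  by (intro smooth_map_add smooth_map_bounded_linear[OF _ bounded_linear_scaleR_right] smooth_ff smooth_tt open_UNIV)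

lemma dd_combination: "dd A (\<lambda>r. k *\<^sub>R \<ff> r + l *\<^sub>R \<tt> r) x X = k *\<^sub>R dd A \<ff> x X + l *\<^sub>R dd A \<tt> x X"
proof -
  have "smooth_map A UNIV (\<lambda>r. k *\<^sub>R \<ff> r)" "smooth_map A UNIV (\<lambda>r. l *\<^sub>R \<tt> r)"
    by (intro smooth_map_bounded_linear[OF _ bounded_linear_scaleR_right] smooth_ff smooth_tt open_UNIV)+
  from dd_add[OF open_UNIV UNIV_I this] show ?thesis
    by (simp add: dd_bounded_linear[OF open_UNIV UNIV_I bounded_linear_scaleR_right] smooth_ff smooth_tt)
qed

lemma smooth_pp1: "smooth_map A UNIV \<pp>\<^sub>1" and smooth_qq1: "smooth_map A UNIV \<qq>\<^sub>1"
  using smooth_combination[of "- b" a] smooth_combination[of c "- b"]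
  unfolding \<pp>\<^sub>1_def[abs_def] \<qq>\<^sub>1_def[abs_def] by (simp_all add: add.commute)

lemma dd_pp1: "dd A \<pp>\<^sub>1 x X = a *\<^sub>R dd A \<tt> x X - b *\<^sub>R dd A \<ff> x X"
  and dd_qq1: "dd A \<qq>\<^sub>1 x X = c *\<^sub>R dd A \<ff> x X - b *\<^sub>R dd A \<tt> x X"
  using dd_combination[of "- b" a x X] dd_combination[of c "- b" x X]
  unfolding \<pp>\<^sub>1_def[abs_def] \<qq>\<^sub>1_def[abs_def] by (simp_all add: add.commute)

lemma dd_pp1_perp [simp]: "w \<in> f x \<Longrightarrow> \<llangle>dd A \<pp>\<^sub>1 x X, w\<rrangle> = 0"
  and dd_qq1_perp [simp]: "w \<in> f x \<Longrightarrow> \<llangle>dd A \<qq>\<^sub>1 x X, w\<rrangle> = 0"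
  and dd_pp1_space_form [simp]: "\<llangle>dd A \<pp>\<^sub>1 x X, \<pp>\<rrangle> = 0" "\<llangle>dd A \<pp>\<^sub>1 x X, \<qq>\<rrangle> = 0"
  and dd_qq1_space_form [simp]: "\<llangle>dd A \<qq>\<^sub>1 x X, \<pp>\<rrangle> = 0" "\<llangle>dd A \<qq>\<^sub>1 x X, \<qq>\<rrangle> = 0"
  by (simp_all add: dd_pp1 dd_qq1 lform_linear_simps)

lemma potential_apply: "blinfun_apply (potential x X) v =
    \<llangle>\<ff> x, v\<rrangle> *\<^sub>R dd A \<qq>\<^sub>1 x X - \<llangle>dd A \<qq>\<^sub>1 x X, v\<rrangle> *\<^sub>R \<ff> x +
    (\<llangle>\<tt> x, v\<rrangle> *\<^sub>R dd A \<pp>\<^sub>1 x X - \<llangle>dd A \<pp>\<^sub>1 x X, v\<rrangle> *\<^sub>R \<tt> x)"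
  by (simp add: potential_def blinfun.add_left wedge_apply)

lemma potential_f: "w \<in> f x \<Longrightarrow> blinfun_apply (potential x X) w = 0"
  by (simp add: potential_apply f_isotropic[OF ff_in] f_isotropic[OF tt_in])

lemma potential_smooth_form: "smooth_form1 A potential"
  unfolding potential_def[abs_def]
  by (intro smooth_form1_add smooth_form1_bilinear bounded_bilinear_wedge smooth_ff smooth_tt smooth_pp1 smooth_qq1)

lemma linear_potential: "linear (potential x)"
  using potential_smooth_form unfolding smooth_form1_def by blast

lemma potential_in: "potential x X \<in> wedge_space (f x) (lperp (f x))"
  unfolding potential_def
  by (intro subspace_add[OF subspace_wedge_space] wedge_in_wedge_space) (simp_all add: lperp_def)

text \<open>Curvature directions at a point diagonalise all differentials at once, which reduces the identities
  for the potential to arithmetic with \<open>\<kappa>\<^sub>1, \<kappa>\<^sub>2, a, b, c\<close>.\<close>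

lemma curvature_frame:
  obtains e\<^sub>1 e\<^sub>2 where "e\<^sub>1 \<in> T\<^sub>1 x" "e\<^sub>2 \<in> T\<^sub>2 x" "e\<^sub>1 \<noteq> 0" "e\<^sub>2 \<noteq> 0"
    "\<And>X. \<exists>x\<^sub>1 x\<^sub>2. X = x\<^sub>1 *\<^sub>R e\<^sub>1 + x\<^sub>2 *\<^sub>R e\<^sub>2"
proof -
  obtain e\<^sub>1 e\<^sub>2 where e: "e\<^sub>1 \<in> T\<^sub>1 x" "e\<^sub>1 \<noteq> 0" "e\<^sub>2 \<in> T\<^sub>2 x" "e\<^sub>2 \<noteq> 0"
    using T1_nontrivial T2_nontrivial by blast
  show ?thesis
    by (rule that[OF e(1,3,2,4)]) (rule curvature_directions_span[OF e], blast)
qed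

lemma dd_frame:
  assumes "e\<^sub>1 \<in> T\<^sub>1 x" "e\<^sub>2 \<in> T\<^sub>2 x"
  defines "E\<^sub>1 \<equiv> dd A \<ff> x e\<^sub>1" and "E\<^sub>2 \<equiv> dd A \<ff> x e\<^sub>2"
  shows "dd A \<ff> x (x\<^sub>1 *\<^sub>R e\<^sub>1 + x\<^sub>2 *\<^sub>R e\<^sub>2) = x\<^sub>1 *\<^sub>R E\<^sub>1 + x\<^sub>2 *\<^sub>R E\<^sub>2"
    and "dd A \<tt> x (x\<^sub>1 *\<^sub>R e\<^sub>1 + x\<^sub>2 *\<^sub>R e\<^sub>2) = (- \<kappa>\<^sub>1 x * x\<^sub>1) *\<^sub>R E\<^sub>1 + (- \<kappa>\<^sub>2 x * x\<^sub>2) *\<^sub>R E\<^sub>2"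
    and "dd A \<qq>\<^sub>1 x (x\<^sub>1 *\<^sub>R e\<^sub>1 + x\<^sub>2 *\<^sub>R e\<^sub>2) = ((c + b * \<kappa>\<^sub>1 x) * x\<^sub>1) *\<^sub>R E\<^sub>1 + ((c + b * \<kappa>\<^sub>2 x) * x\<^sub>2) *\<^sub>R E\<^sub>2"
    and "dd A \<pp>\<^sub>1 x (x\<^sub>1 *\<^sub>R e\<^sub>1 + x\<^sub>2 *\<^sub>R e\<^sub>2) = (- (a * \<kappa>\<^sub>1 x + b) * x\<^sub>1) *\<^sub>R E\<^sub>1 + (- (a * \<kappa>\<^sub>2 x + b) * x\<^sub>2) *\<^sub>R E\<^sub>2"
proof -
  show ff: "dd A \<ff> x (x\<^sub>1 *\<^sub>R e\<^sub>1 + x\<^sub>2 *\<^sub>R e\<^sub>2) = x\<^sub>1 *\<^sub>R E\<^sub>1 + x\<^sub>2 *\<^sub>R E\<^sub>2"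
    by (simp add: E\<^sub>1_def E\<^sub>2_def linear_add[OF linear_dd_ff] linear_scale[OF linear_dd_ff])
  show tt: "dd A \<tt> x (x\<^sub>1 *\<^sub>R e\<^sub>1 + x\<^sub>2 *\<^sub>R e\<^sub>2) = (- \<kappa>\<^sub>1 x * x\<^sub>1) *\<^sub>R E\<^sub>1 + (- \<kappa>\<^sub>2 x * x\<^sub>2) *\<^sub>R E\<^sub>2"
    by (simp add: E\<^sub>1_def E\<^sub>2_def linear_add[OF linear_dd_tt] linear_scale[OF linear_dd_tt]
        T1_tt[OF assms(1)] T2_tt[OF assms(2)] mult.commute)
  show "dd A \<qq>\<^sub>1 x (x\<^sub>1 *\<^sub>R e\<^sub>1 + x\<^sub>2 *\<^sub>R e\<^sub>2) = ((c + b * \<kappa>\<^sub>1 x) * x\<^sub>1) *\<^sub>R E\<^sub>1 + ((c + b * \<kappa>\<^sub>2 x) * x\<^sub>2) *\<^sub>R E\<^sub>2"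
    "dd A \<pp>\<^sub>1 x (x\<^sub>1 *\<^sub>R e\<^sub>1 + x\<^sub>2 *\<^sub>R e\<^sub>2) = (- (a * \<kappa>\<^sub>1 x + b) * x\<^sub>1) *\<^sub>R E\<^sub>1 + (- (a * \<kappa>\<^sub>2 x + b) * x\<^sub>2) *\<^sub>R E\<^sub>2"
    unfolding dd_qq1 dd_pp1 ff tt by (simp_all add: algebra_simps)
qed

lemma potential_closed: "closed_form1 A potential"
  unfolding closed_form1_def
proof (intro allI)
  fix x X Y
  obtain e\<^sub>1 e\<^sub>2 where e: "e\<^sub>1 \<in> T\<^sub>1 x" "e\<^sub>2 \<in> T\<^sub>2 x" "\<And>X. \<exists>x\<^sub>1 x\<^sub>2. X = x\<^sub>1 *\<^sub>R e\<^sub>1 + x\<^sub>2 *\<^sub>R e\<^sub>2"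
    by (rule curvature_frame[of x]) (rule that)
  obtain x\<^sub>1 x\<^sub>2 where X: "X = x\<^sub>1 *\<^sub>R e\<^sub>1 + x\<^sub>2 *\<^sub>R e\<^sub>2" using e(3) by blast
  obtain y\<^sub>1 y\<^sub>2 where Y: "Y = y\<^sub>1 *\<^sub>R e\<^sub>1 + y\<^sub>2 *\<^sub>R e\<^sub>2" using e(3) by blast
  let ?E1 = "dd A \<ff> x e\<^sub>1" and ?E2 = "dd A \<ff> x e\<^sub>2"
  have w: "wedge (p *\<^sub>R ?E1 + q *\<^sub>R ?E2) (r *\<^sub>R ?E1 + s *\<^sub>R ?E2) = (p * s - q * r) *\<^sub>R wedge ?E1 ?E2" for p q r s
    by (simp add: wedge_linear_simps wedge_self wedge_swap[of ?E2 ?E1] algebra_simps)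
  have "ext_deriv A potential x X Y =
      (wedge (dd A \<ff> x X) (dd A \<qq>\<^sub>1 x Y) - wedge (dd A \<ff> x Y) (dd A \<qq>\<^sub>1 x X)) +
      (wedge (dd A \<tt> x X) (dd A \<pp>\<^sub>1 x Y) - wedge (dd A \<tt> x Y) (dd A \<pp>\<^sub>1 x X))"
    unfolding potential_def[abs_def]
    by (subst ext_deriv_add)
      (simp_all add: smooth_form1_bilinear ext_deriv_bilinear bounded_bilinear_wedge smooth_ff smooth_tt smooth_pp1 smooth_qq1)
  also have "\<dots> = (2 * (x\<^sub>1 * y\<^sub>2 - x\<^sub>2 * y\<^sub>1) * (a * (\<kappa>\<^sub>1 x * \<kappa>\<^sub>2 x) + b * (\<kappa>\<^sub>1 x + \<kappa>\<^sub>2 x) + c)) *\<^sub>R wedge ?E1 ?E2"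
    unfolding X Y dd_frame[OF e(1,2)] w
    by (simp only: scaleR_diff_left[symmetric] scaleR_add_left[symmetric]) (simp add: algebra_simps)
  finally show "ext_deriv A potential x X Y = 0" by (simp add: weingarten_eq)
qed

text \<open>The product of two values of \<open>\<eta>\<close> maps into \<open>f\<close>, and its coefficients are the pairings of \<open>d\<qq>\<^sub>1\<close> and
  \<open>d\<pp>\<^sub>1\<close> among each other. The symmetry of the second fundamental form makes these symmetric in the
  two tangent vectors, so the values of \<open>\<eta>\<close> commute.\<close>

lemma potential_bracket: "bracket_wedge potential potential x X Y = 0"
proof -
  have sym: "\<llangle>dd A \<qq>\<^sub>1 x X, dd A \<pp>\<^sub>1 x Y\<rrangle> = \<llangle>dd A \<qq>\<^sub>1 x Y, dd A \<pp>\<^sub>1 x X\<rrangle>" for X Y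
    unfolding dd_pp1 dd_qq1
    using second_fundamental_form_symmetric[of x X Y] lform_sym[of "dd A \<ff> x X" "dd A \<tt> x Y"]
      lform_sym[of "dd A \<ff> x X" "dd A \<ff> x Y"] lform_sym[of "dd A \<tt> x X" "dd A \<tt> x Y"]
      lform_sym[of "dd A \<ff> x Y" "dd A \<tt> x X"]
    by (simp add: lform_linear_simps algebra_simps)
  have comp: "blinfun_apply (potential x X) (blinfun_apply (potential x Y) v) =
      - (\<llangle>\<ff> x, v\<rrangle> * \<llangle>dd A \<qq>\<^sub>1 x X, dd A \<qq>\<^sub>1 x Y\<rrangle> + \<llangle>\<tt> x, v\<rrangle> * \<llangle>dd A \<qq>\<^sub>1 x X, dd A \<pp>\<^sub>1 x Y\<rrangle>) *\<^sub>R \<ff> x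
      - (\<llangle>\<ff> x, v\<rrangle> * \<llangle>dd A \<pp>\<^sub>1 x X, dd A \<qq>\<^sub>1 x Y\<rrangle> + \<llangle>\<tt> x, v\<rrangle> * \<llangle>dd A \<pp>\<^sub>1 x X, dd A \<pp>\<^sub>1 x Y\<rrangle>) *\<^sub>R \<tt> x"
    for X Y v
    by (simp add: potential_apply lform_linear_simps f_isotropic[OF ff_in] f_isotropic[OF tt_in]
        lform_sym[of "\<ff> x" "dd A _ x _"] lform_sym[of "\<tt> x" "dd A _ x _"] algebra_simps)
  have "blinfun_apply (potential x X) (blinfun_apply (potential x Y) v) =
      blinfun_apply (potential x Y) (blinfun_apply (potential x X) v)" for v
    unfolding comp sym[of Y X] lform_sym[of "dd A \<pp>\<^sub>1 x Y" "dd A \<qq>\<^sub>1 x X"] lform_sym[of "dd A \<pp>\<^sub>1 x X" "dd A \<qq>\<^sub>1 x Y"]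
      lform_sym[of "dd A \<qq>\<^sub>1 x Y" "dd A \<qq>\<^sub>1 x X"] lform_sym[of "dd A \<pp>\<^sub>1 x Y" "dd A \<pp>\<^sub>1 x X"] ..
  then show ?thesis
    by (intro blinfun_eqI) (simp add: bracket_wedge_def lie_bracket_def blinfun.diff_left)
qed

text \<open>As \<open>\<eta>\<close> annihilates \<open>f\<close>, only the derivatives of \<open>\<ff>\<close> and \<open>\<tt>\<close> in the product rule for the extending
  section matter, and the endomorphism is visibly of the form \<open>l\<^sub>1(v)\<ff> + l\<^sub>2(v)\<tt>\<close>.\<close>

lemma potential_quad_diff:
  "quad_diff A f potential x X Y = - \<llangle>dd A \<qq>\<^sub>1 x X, dd A \<ff> x Y\<rrangle> - \<llangle>dd A \<pp>\<^sub>1 x X, dd A \<tt> x Y\<rrangle>"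
proof -
  let ?l1 = "\<lambda>v. \<llangle>v, \<qq>\<rrangle> * \<llangle>dd A \<qq>\<^sub>1 x X, dd A \<ff> x Y\<rrangle> + \<llangle>v, \<pp>\<rrangle> * \<llangle>dd A \<qq>\<^sub>1 x X, dd A \<tt> x Y\<rrangle>"
  let ?l2 = "\<lambda>v. \<llangle>v, \<qq>\<rrangle> * \<llangle>dd A \<pp>\<^sub>1 x X, dd A \<ff> x Y\<rrangle> + \<llangle>v, \<pp>\<rrangle> * \<llangle>dd A \<pp>\<^sub>1 x X, dd A \<tt> x Y\<rrangle>"
  have "trace_on (f x) (\<lambda>v. blinfun_apply (potential x X) (dd A (extension A f x v) x Y)) = ?l1 (\<ff> x) + ?l2 (\<tt> x)"
  proof (rule trace_on_rank_two[where l\<^sub>1 = ?l1 and l\<^sub>2 = ?l2, OF subspace_f ff_in tt_in])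
    show "linear ?l1" "linear ?l2" by (auto intro!: linearI simp: lform_linear_simps algebra_simps)
    fix v assume v: "v \<in> f x"
    let ?\<sigma> = "extension A f x v"
    let ?s = "\<lambda>r. (- \<llangle>v, \<qq>\<rrangle>) *\<^sub>R \<ff> r + (- \<llangle>v, \<pp>\<rrangle>) *\<^sub>R \<tt> r"
    have "section_on A f UNIV ?s"
      unfolding section_on_def using smooth_combination f_combination by blast
    moreover have "?s x = v" using f_decomposition[OF v] by simp
    ultimately have "\<exists>\<sigma>. (\<exists>U. x \<in> U \<and> section_on A f U \<sigma>) \<and> \<sigma> x = v" by blast
    from someI_ex[OF this] have "(\<exists>U. x \<in> U \<and> section_on A f U ?\<sigma>) \<and> ?\<sigma> x = v"
      unfolding extension_def .
    then obtain U where \<sigma>: "x \<in> U" "section_on A f U ?\<sigma>" "?\<sigma> x = v" by blast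
    let ?u = "- \<llangle>dd A ?\<sigma> x Y, \<qq>\<rrangle> *\<^sub>R \<ff> x - \<llangle>dd A ?\<sigma> x Y, \<pp>\<rrangle> *\<^sub>R \<tt> x"
    have u: "?u \<in> f x" by (intro subspace_diff[OF subspace_f] subspace_scale[OF subspace_f] ff_in tt_in)
    have "blinfun_apply (potential x X) (dd A ?\<sigma> x Y) =
        blinfun_apply (potential x X) ?u - blinfun_apply (potential x X)
          (\<llangle>v, \<qq>\<rrangle> *\<^sub>R dd A \<ff> x Y + \<llangle>v, \<pp>\<rrangle> *\<^sub>R dd A \<tt> x Y)"
      using section_derivative[OF \<sigma>(2,1), of Y] unfolding \<sigma>(3) by (metis blinfun.diff_right)
    also have "\<dots> = ?l1 v *\<^sub>R \<ff> x + ?l2 v *\<^sub>R \<tt> x"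
      unfolding potential_f[OF u]
      by (simp add: potential_apply lform_linear_simps lform_sym[of "\<ff> x" "dd A _ x _"]
          lform_sym[of "\<tt> x" "dd A _ x _"] algebra_simps)
    finally show "blinfun_apply (potential x X) (dd A ?\<sigma> x Y) = ?l1 v *\<^sub>R \<ff> x + ?l2 v *\<^sub>R \<tt> x" .
  qed
  then show ?thesis by (simp add: quad_diff_def)
qed

text \<open>\<open>a\<kappa>\<^sub>1\<^sup>2 + 2b\<kappa>\<^sub>1 + c = (\<kappa>\<^sub>1 - \<kappa>\<^sub>2)(a\<kappa>\<^sub>1 + b)\<close> by the Weingarten equation, and \<open>a\<kappa>\<^sub>1 + b = 0\<close> would
  entail \<open>b\<kappa>\<^sub>1 + c = 0\<close>, so that \<open>(\<kappa>\<^sub>1, 1)\<close> would lie in the kernel of an invertible matrix.\<close>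

lemma weingarten_polynomial_nonzero: "c + 2 * b * \<kappa>\<^sub>1 x + a * (\<kappa>\<^sub>1 x)\<^sup>2 \<noteq> 0"
proof
  assume 0: "c + 2 * b * \<kappa>\<^sub>1 x + a * (\<kappa>\<^sub>1 x)\<^sup>2 = 0"
  have "(\<kappa>\<^sub>1 x - \<kappa>\<^sub>2 x) * (a * \<kappa>\<^sub>1 x + b) = 0"
    using 0 weingarten_eq[of x] by (simp add: algebra_simps power2_eq_square)
  then have 1: "a * \<kappa>\<^sub>1 x + b = 0" using curvatures_differ by simp
  have "b * \<kappa>\<^sub>1 x + c = (c + 2 * b * \<kappa>\<^sub>1 x + a * (\<kappa>\<^sub>1 x)\<^sup>2) - \<kappa>\<^sub>1 x * (a * \<kappa>\<^sub>1 x + b)"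
    by (simp add: algebra_simps power2_eq_square)
  then have 2: "b * \<kappa>\<^sub>1 x + c = 0" using 0 1 by simp
  have "a * c - b\<^sup>2 = a * (b * \<kappa>\<^sub>1 x + c) - b * (a * \<kappa>\<^sub>1 x + b)"
    by (simp add: algebra_simps power2_eq_square)
  then show False using 1 2 discriminant by simp
qed

lemma quad_diff_T1:
  assumes e: "e\<^sub>1 \<in> T\<^sub>1 x" "e\<^sub>2 \<in> T\<^sub>2 x"
  shows "quad_diff A f potential x (x\<^sub>1 *\<^sub>R e\<^sub>1 + x\<^sub>2 *\<^sub>R e\<^sub>2) e\<^sub>1 =
    - x\<^sub>1 * (c + 2 * b * \<kappa>\<^sub>1 x + a * (\<kappa>\<^sub>1 x)\<^sup>2) * \<llangle>dd A \<ff> x e\<^sub>1, dd A \<ff> x e\<^sub>1\<rrangle>"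
  unfolding potential_quad_diff dd_frame[OF e] T1_tt[OF e(1)]
  using curvature_directions_orthogonal[OF e]
  by (simp add: lform_linear_simps lform_sym[of "dd A \<ff> x e\<^sub>2" "dd A \<ff> x e\<^sub>1"] algebra_simps power2_eq_square)

lemma quad_diff_T2:
  assumes e: "e\<^sub>1 \<in> T\<^sub>1 x" "e\<^sub>2 \<in> T\<^sub>2 x"
  shows "quad_diff A f potential x (x\<^sub>1 *\<^sub>R e\<^sub>1 + x\<^sub>2 *\<^sub>R e\<^sub>2) e\<^sub>2 =
    - x\<^sub>2 * (c + 2 * b * \<kappa>\<^sub>2 x + a * (\<kappa>\<^sub>2 x)\<^sup>2) * \<llangle>dd A \<ff> x e\<^sub>2, dd A \<ff> x e\<^sub>2\<rrangle>"
  using weingarten_surface.quad_diff_T1[OF exchanged_weingarten e(2,1), of x\<^sub>2 x\<^sub>1]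
  by (simp add: add.commute)

lemma quad_diff_nondegenerate:
  assumes "\<And>Y. quad_diff A f potential x X Y = 0"
  shows "X = 0"
proof -
  obtain e\<^sub>1 e\<^sub>2 where e: "e\<^sub>1 \<in> T\<^sub>1 x" "e\<^sub>2 \<in> T\<^sub>2 x" "e\<^sub>1 \<noteq> 0" "e\<^sub>2 \<noteq> 0" "\<And>X. \<exists>x\<^sub>1 x\<^sub>2. X = x\<^sub>1 *\<^sub>R e\<^sub>1 + x\<^sub>2 *\<^sub>R e\<^sub>2"
    by (rule curvature_frame[of x]) (rule that)
  obtain x\<^sub>1 x\<^sub>2 where X: "X = x\<^sub>1 *\<^sub>R e\<^sub>1 + x\<^sub>2 *\<^sub>R e\<^sub>2" using e(5) by blast
  have "x\<^sub>1 = 0"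
    using assms[of e\<^sub>1] dd_ff_positive[OF e(3), of x] weingarten_polynomial_nonzero[of x]
    unfolding X quad_diff_T1[OF e(1,2)] by simp
  moreover have "x\<^sub>2 = 0"
    using assms[of e\<^sub>2] dd_ff_positive[OF e(4), of x]
      weingarten_surface.weingarten_polynomial_nonzero[OF exchanged_weingarten, of x]
    unfolding X quad_diff_T2[OF e(1,2)] by simp
  ultimately show ?thesis by (simp add: X)
qed

lemma potential_omega: "omega_potential A f potential"
proof -
  obtain X :: "real^2" where "X \<noteq> 0" using T1_nontrivial by blast
  then have "\<exists>x X Y. quad_diff A f potential x X Y \<noteq> 0" using quad_diff_nondegenerate by blast
  then have "gauge_potential A f potential"
    using potential_smooth_form potential_in potential_closed potential_bracket
    by (auto simp: gauge_potential_def)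
  then show ?thesis
    unfolding omega_potential_def using quad_diff_nondegenerate
    by (intro conjI exI[of _ UNIV]) auto
qed

text \<open>For \<open>X \<in> T\<^sub>1\<close> the Weingarten equation turns the potential into
  \<open>-(a\<kappa>\<^sub>1 + b) (\<tt> + \<kappa>\<^sub>2\<ff>) \<and> d\<^sub>X\<ff>\<close>. Here \<open>\<tt> + \<kappa>\<^sub>2\<ff>\<close> spans \<open>s\<^sub>2\<close>, and \<open>d\<^sub>X\<ff>\<close> is a multiple of the derivative of a section of \<open>s\<^sub>2\<close>
  modulo \<open>f\<close>.\<close>

lemma potential_T1:
  assumes X: "X \<in> T\<^sub>1 x"
  shows "\<exists>m. m \<in> wedge_space (f x) (f x) \<and> potential x X - m \<in> wedge_space (S\<^sub>2 x) (S\<^sub>2 x)"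
proof -
  obtain \<sigma> g h u k X\<^sub>0 where b: "s\<^sub>2 x = span {\<sigma>}" "\<sigma> \<in> s\<^sub>2 x" "\<sigma> \<in> S\<^sub>2 x" "g \<in> S\<^sub>2 x"
    "X\<^sub>0 \<in> T\<^sub>1 x" "X\<^sub>0 \<noteq> 0" "u \<in> f x" "k \<noteq> 0" "g = u + k *\<^sub>R dd A \<ff> x X\<^sub>0"
    by (rule principal_surface.cyclide_basis[OF exchanged, of x]) (rule that)
  obtain d where d: "X = d *\<^sub>R X\<^sub>0" using T1_line[OF b(5,6)] X by (auto simp: span_singleton)
  have "\<tt> x + \<kappa>\<^sub>2 x *\<^sub>R \<ff> x \<in> s\<^sub>2 x" unfolding s2_eq by (simp add: span_base)
  then have "\<tt> x + \<kappa>\<^sub>2 x *\<^sub>R \<ff> x \<in> span {\<sigma>}" unfolding b(1) .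
  then obtain s where s: "\<tt> x + \<kappa>\<^sub>2 x *\<^sub>R \<ff> x = s *\<^sub>R \<sigma>" by (auto simp: span_singleton)
  let ?F = "dd A \<ff> x X" and ?n = "- (a * \<kappa>\<^sub>1 x + b)"
  have q: "dd A \<qq>\<^sub>1 x X = (\<kappa>\<^sub>2 x * ?n) *\<^sub>R ?F"
  proof -
    have "c + b * \<kappa>\<^sub>1 x = \<kappa>\<^sub>2 x * ?n" using weingarten_eq[of x] by (simp add: algebra_simps)
    then show ?thesis by (simp add: dd_qq1 T1_tt[OF X] flip: scaleR_add_left)
  qed
  have p: "dd A \<pp>\<^sub>1 x X = ?n *\<^sub>R ?F" by (simp add: dd_pp1 T1_tt[OF X] algebra_simps)
  have "potential x X = ?n *\<^sub>R wedge (\<tt> x + \<kappa>\<^sub>2 x *\<^sub>R \<ff> x) ?F"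
    unfolding potential_def q p by (simp add: wedge_linear_simps algebra_simps)
  also have "?F = (d / k) *\<^sub>R (g - u)" using b(8,9) by (simp add: d linear_scale[OF linear_dd_ff])
  finally have pot: "potential x X = (?n * s * d / k) *\<^sub>R wedge \<sigma> g - (?n * s * d / k) *\<^sub>R wedge \<sigma> u"
    unfolding s by (simp add: wedge_linear_simps scaleR_diff_right mult.commute mult.left_commute mult.assoc)
  have "\<sigma> \<in> f x" using b(2) principal_surface.s1_subset_f[OF exchanged] by blast
  then have "- ((?n * s * d / k) *\<^sub>R wedge \<sigma> u) \<in> wedge_space (f x) (f x)"
    using b(7) by (intro subspace_neg subspace_scale subspace_wedge_space wedge_in_wedge_space)
  moreover have "(?n * s * d / k) *\<^sub>R wedge \<sigma> g \<in> wedge_space (S\<^sub>2 x) (S\<^sub>2 x)"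
    using b(3,4) by (intro subspace_scale subspace_wedge_space wedge_in_wedge_space)
  ultimately show ?thesis unfolding pot by (intro exI[of _ "- ((?n * s * d / k) *\<^sub>R wedge \<sigma> u)"]) simp
qed

lemma s1_subset_cyclide: "s\<^sub>1 x \<subseteq> S\<^sub>1 x"
proof -
  obtain \<sigma> where "s\<^sub>1 x = span {\<sigma>}" "\<sigma> \<in> S\<^sub>1 x"
    by (rule cyclide_basis[of x]) (rule that)
  then show ?thesis by (simp add: span_minimal subspace_lie_cyclide)
qed

text \<open>\<open>\<and>\<^sup>2f\<close> is spanned by the product of the generators \<open>\<tt> + \<kappa>\<^sub>1\<ff>\<close> of \<open>s\<^sub>1\<close> and \<open>\<tt> + \<kappa>\<^sub>2\<ff>\<close> of \<open>s\<^sub>2\<close>.\<close>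

lemma wedge_f_mixed: "wedge_space (f x) (f x) \<subseteq> wedge_space (S\<^sub>1 x) (S\<^sub>2 x)"
proof -
  have "\<tt> x + \<kappa>\<^sub>1 x *\<^sub>R \<ff> x \<in> S\<^sub>1 x" "\<tt> x + \<kappa>\<^sub>2 x *\<^sub>R \<ff> x \<in> S\<^sub>2 x"
    using s1_subset_cyclide weingarten_surface.s1_subset_cyclide[OF exchanged_weingarten]
    unfolding s1_eq s2_eq by (auto simp: span_base subset_iff)
  then have "wedge (\<tt> x + \<kappa>\<^sub>1 x *\<^sub>R \<ff> x) (\<tt> x + \<kappa>\<^sub>2 x *\<^sub>R \<ff> x) \<in> wedge_space (S\<^sub>1 x) (S\<^sub>2 x)"
    by (rule wedge_in_wedge_space)
  also have "wedge (\<tt> x + \<kappa>\<^sub>1 x *\<^sub>R \<ff> x) (\<tt> x + \<kappa>\<^sub>2 x *\<^sub>R \<ff> x) = (\<kappa>\<^sub>1 x - \<kappa>\<^sub>2 x) *\<^sub>R wedge (\<ff> x) (\<tt> x)"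
    by (simp add: wedge_linear_simps wedge_self wedge_swap[of "\<tt> x" "\<ff> x"] algebra_simps)
  finally have "(h / (\<kappa>\<^sub>1 x - \<kappa>\<^sub>2 x)) *\<^sub>R ((\<kappa>\<^sub>1 x - \<kappa>\<^sub>2 x) *\<^sub>R wedge (\<ff> x) (\<tt> x)) \<in> wedge_space (S\<^sub>1 x) (S\<^sub>2 x)" for h
    by (rule subspace_scale[OF subspace_wedge_space])
  moreover have "(h / (\<kappa>\<^sub>1 x - \<kappa>\<^sub>2 x)) *\<^sub>R ((\<kappa>\<^sub>1 x - \<kappa>\<^sub>2 x) *\<^sub>R wedge (\<ff> x) (\<tt> x)) = h *\<^sub>R wedge (\<ff> x) (\<tt> x)" for h
    using curvatures_differ[of x] by simp
  ultimately have "h *\<^sub>R wedge (\<ff> x) (\<tt> x) \<in> wedge_space (S\<^sub>1 x) (S\<^sub>2 x)" for h by metis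
  then show ?thesis unfolding f_eq_span wedge_space_eq_line by blast
qed

lemma potential_middle: "middle_condition A f s\<^sub>1 s\<^sub>2 potential"
  unfolding middle_condition_def Let_def
proof (intro allI)
  fix x X
  let ?V = "span (wedge_space (S\<^sub>1 x) (S\<^sub>1 x) \<union> wedge_space (S\<^sub>2 x) (S\<^sub>2 x))"
  obtain e\<^sub>1 e\<^sub>2 where e: "e\<^sub>1 \<in> T\<^sub>1 x" "e\<^sub>2 \<in> T\<^sub>2 x" "\<And>X. \<exists>x\<^sub>1 x\<^sub>2. X = x\<^sub>1 *\<^sub>R e\<^sub>1 + x\<^sub>2 *\<^sub>R e\<^sub>2"
    by (rule curvature_frame[of x]) (rule that)
  obtain x\<^sub>1 x\<^sub>2 where X: "X = x\<^sub>1 *\<^sub>R e\<^sub>1 + x\<^sub>2 *\<^sub>R e\<^sub>2" using e(3) by blast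
  obtain m where m: "m \<in> wedge_space (f x) (f x)" "potential x e\<^sub>1 - m \<in> ?V"
    using potential_T1[OF e(1)] by (auto intro: span_base)
  obtain n where n: "n \<in> wedge_space (f x) (f x)" "potential x e\<^sub>2 - n \<in> ?V"
    using weingarten_surface.potential_T1[OF exchanged_weingarten e(2)] by (auto intro: span_base)
  let ?m = "x\<^sub>1 *\<^sub>R m + x\<^sub>2 *\<^sub>R n"
  have mf: "?m \<in> wedge_space (f x) (f x)"
    using m n by (intro subspace_add subspace_scale subspace_wedge_space)
  have "potential x X - ?m = x\<^sub>1 *\<^sub>R (potential x e\<^sub>1 - m) + x\<^sub>2 *\<^sub>R (potential x e\<^sub>2 - n)"
    by (simp add: X linear_add[OF linear_potential] linear_scale[OF linear_potential] algebra_simps)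
  also have "\<dots> \<in> ?V" using m n by (intro span_add span_scale)
  finally show "\<exists>m. mixed_component (S\<^sub>1 x) (S\<^sub>2 x) (potential x X) m \<and> m \<in> wedge_space (f x) (f x)"
    using mf wedge_f_mixed unfolding mixed_component_def by blast
qed

lemma potential_middle_potential: "middle_potential A f s\<^sub>1 s\<^sub>2 potential potential"
  unfolding middle_potential_def
proof (intro conjI ballI impI potential_middle)
  have "section_on A (\<lambda>x. wedge_space (f x) (f x)) UNIV (\<lambda>_. 0)"
    by (simp add: section_on_def smooth_map_const subspace_0[OF subspace_wedge_space])
  then show "potential \<in> gauge_orbit A f potential"
    unfolding gauge_orbit_def by (intro CollectI exI[of _ "\<lambda>_. 0"]) simp
next
  fix \<nu> assume "\<nu> \<in> gauge_orbit A f potential" and mid: "middle_condition A f s\<^sub>1 s\<^sub>2 \<nu>"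
  then obtain \<tau> where \<nu>: "\<nu> = (\<lambda>x X. potential x X - dd A \<tau> x X)"
    and \<tau>: "section_on A (\<lambda>x. wedge_space (f x) (f x)) UNIV \<tau>"
    unfolding gauge_orbit_def by blast
  have "\<tau> = (\<lambda>_. 0)"
    using middle_condition_unique[OF potential_middle mid[unfolded \<nu>] \<tau>] by blast
  then show "\<nu> = potential" unfolding \<nu> by simp
qed

end


section \<open>Conserved quantities and the Weingarten condition\<close>

lemma sym_prod_swap: "x \<odot> y = y \<odot> x"
  by (auto simp: sym_prod_def fun_eq_iff)

lemma sym_prod_combination:
  fixes x y :: "'w::real_vector"
  shows "(p *\<^sub>R x + q *\<^sub>R y) \<odot> (r *\<^sub>R x + s *\<^sub>R y) =
    (p * r) *\<^sub>R (x \<odot> x) + (p * s + q * r) *\<^sub>R (x \<odot> y) + (q * s) *\<^sub>R (y \<odot> y)"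
  by (auto simp: sym_prod_def fun_eq_iff scaleR_fun_def linear_add linear_scale algebra_simps
      add_divide_distrib)

lemma sym_square_plane:
  fixes x y :: "'w::real_vector"
  shows "sym_square (span {x, y}) = {p *\<^sub>R (x \<odot> x) + q *\<^sub>R (x \<odot> y) + r *\<^sub>R (y \<odot> y) |p q r. True}"
    (is "_ = ?R")
proof
  have R: "?R = span {x \<odot> x, x \<odot> y, y \<odot> y}"
    by (auto simp: span_insert span_singleton algebra_simps)
  have "{u \<odot> v |u v. u \<in> span {x, y} \<and> v \<in> span {x, y}} \<subseteq> ?R"
  proof clarify
    fix u v assume "u \<in> span {x, y}" "v \<in> span {x, y}"
    then obtain p q r s where "u = p *\<^sub>R x + q *\<^sub>R y" "v = r *\<^sub>R x + s *\<^sub>R y"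
      by (auto simp: span_insert span_singleton algebra_simps)
    then have "u \<odot> v = (p * r) *\<^sub>R (x \<odot> x) + (p * s + q * r) *\<^sub>R (x \<odot> y) + (q * s) *\<^sub>R (y \<odot> y)"
      by (simp only: sym_prod_combination)
    then show "\<exists>p q r. u \<odot> v = p *\<^sub>R (x \<odot> x) + q *\<^sub>R (x \<odot> y) + r *\<^sub>R (y \<odot> y) \<and> True" by blast
  qed
  then show "sym_square (span {x, y}) \<subseteq> ?R"
    unfolding sym_square_def R by (intro span_minimal subspace_span)
  have "{x \<odot> x, x \<odot> y, y \<odot> y} \<subseteq> {u \<odot> v |u v. u \<in> span {x, y} \<and> v \<in> span {x, y}}"
    by (auto intro: span_base)
  then show "?R \<subseteq> sym_square (span {x, y})"
    unfolding sym_square_def R by (rule span_mono)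
qed

lemma proj_class_scaleR:
  assumes "k \<noteq> 0"
  shows "proj_class (k *\<^sub>R w) = proj_class w"
proof
  show "proj_class (k *\<^sub>R w) \<subseteq> proj_class w"
    unfolding proj_class_def
  proof clarify
    fix c :: real assume "c \<noteq> 0"
    with assms show "\<exists>d. c *\<^sub>R k *\<^sub>R w = d *\<^sub>R w \<and> d \<noteq> 0" by (intro exI[of _ "c * k"]) simp
  qed
  show "proj_class w \<subseteq> proj_class (k *\<^sub>R w)"
    unfolding proj_class_def
  proof clarify
    fix c :: real assume "c \<noteq> 0"
    with assms show "\<exists>d. c *\<^sub>R w = d *\<^sub>R k *\<^sub>R w \<and> d \<noteq> 0" by (intro exI[of _ "c / k"]) simp
  qed
qed

context weingarten_surface
begin

definition \<alpha> :: "('a, 'b) lin_poly" where "\<alpha> = (\<lambda>_. \<pp>, \<pp>\<^sub>1)"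
definition \<beta> :: "('a, 'b) lin_poly" where "\<beta> = (\<lambda>_. \<qq>, \<qq>\<^sub>1)"

definition P :: "('a, 'b) lin_poly set" where "P = span {\<alpha>, \<beta>}"

lemma P_cases:
  assumes "\<gamma> \<in> P"
  obtains u v where "\<gamma> = u *\<^sub>R \<alpha> + v *\<^sub>R \<beta>"
  using assms that unfolding P_def by (auto simp: span_insert span_singleton algebra_simps)

lemma P_in: "u *\<^sub>R \<alpha> + v *\<^sub>R \<beta> \<in> P"
  unfolding P_def by (intro span_add span_scale span_base) auto

lemma fst_combination: "fst (u *\<^sub>R \<alpha> + v *\<^sub>R \<beta>) = (\<lambda>_. u *\<^sub>R \<pp> + v *\<^sub>R \<qq>)"
  and snd_combination: "snd (u *\<^sub>R \<alpha> + v *\<^sub>R \<beta>) =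
    (\<lambda>r. (v * c - u * b) *\<^sub>R \<ff> r + (u * a - v * b) *\<^sub>R \<tt> r)"
  by (auto simp: \<alpha>_def \<beta>_def scaleR_fun_def plus_fun_def fun_eq_iff \<pp>\<^sub>1_def \<qq>\<^sub>1_def algebra_simps)

lemma combination_eq_0:
  assumes "u *\<^sub>R \<alpha> + v *\<^sub>R \<beta> = 0"
  shows "u = 0 \<and> v = 0"
proof -
  obtain x :: 'a where True by simp
  have "u *\<^sub>R \<pp> + v *\<^sub>R \<qq> = 0"
    using arg_cong[OF assms, of fst] unfolding fst_combination by (simp add: zero_fun_def fun_eq_iff)
  then have "\<llangle>u *\<^sub>R \<pp> + v *\<^sub>R \<qq>, \<ff> x\<rrangle> = 0" "\<llangle>u *\<^sub>R \<pp> + v *\<^sub>R \<qq>, \<tt> x\<rrangle> = 0"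
    by (simp_all add: lform_zero_left)
  then show ?thesis by (simp add: lform_linear_simps)
qed

lemma dim_P: "dim P = 2"
proof -
  have \<beta>0: "\<beta> \<noteq> 0" using combination_eq_0[of 0 1] by auto
  have "\<alpha> \<notin> span {\<beta>}"
  proof
    assume "\<alpha> \<in> span {\<beta>}"
    then obtain k where "\<alpha> = k *\<^sub>R \<beta>" by (auto simp: span_singleton)
    then have "1 *\<^sub>R \<alpha> + (- k) *\<^sub>R \<beta> = 0" by simp
    then show False using combination_eq_0 by fastforce
  qed
  with \<beta>0 have "independent {\<alpha>, \<beta>}" "\<alpha> \<noteq> \<beta>" by (auto simp: independent_insert span_base)
  then show ?thesis unfolding P_def by (simp add: dim_eq_card_independent)
qed

lemma linear_system:
  assumes "u * c = v * b" "u * b = v * a"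
  shows "u = 0 \<and> v = 0"
proof -
  have "(a * c - b\<^sup>2) * u = a * (u * c) - b * (u * b)" by (simp add: algebra_simps power2_eq_square)
  also have "\<dots> = 0" unfolding assms by simp
  finally have u: "u = 0" using discriminant by simp
  have "(a * c - b\<^sup>2) * v = c * (v * a) - b * (v * b)" by (simp add: algebra_simps power2_eq_square)
  also have "\<dots> = 0" unfolding assms[symmetric] u by simp
  finally show ?thesis using u discriminant by simp
qed

lemma potential_pp: "blinfun_apply (potential x X) \<pp> = - dd A \<pp>\<^sub>1 x X"
  and potential_qq: "blinfun_apply (potential x X) \<qq> = - dd A \<qq>\<^sub>1 x X"
  by (simp_all add: potential_apply)

lemma combination_conserved:
  assumes "u *\<^sub>R \<alpha> + v *\<^sub>R \<beta> \<noteq> 0"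
  shows "linear_conserved_quantity A potential (u *\<^sub>R \<alpha> + v *\<^sub>R \<beta>)"
  unfolding linear_conserved_quantity_def
proof (intro conjI allI)
  let ?k = "v * c - u * b" and ?l = "u * a - v * b"
  let ?p1 = "\<lambda>r. ?k *\<^sub>R \<ff> r + ?l *\<^sub>R \<tt> r"
  show "smooth_map A UNIV (fst (u *\<^sub>R \<alpha> + v *\<^sub>R \<beta>))" "smooth_map A UNIV (snd (u *\<^sub>R \<alpha> + v *\<^sub>R \<beta>))"
    unfolding fst_combination snd_combination by (rule smooth_map_const smooth_combination)+
  show "snd (u *\<^sub>R \<alpha> + v *\<^sub>R \<beta>) \<noteq> (\<lambda>_. 0)"
  proof
    assume 0: "snd (u *\<^sub>R \<alpha> + v *\<^sub>R \<beta>) = (\<lambda>_. 0)"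
    obtain x :: 'a where True by simp
    have p0: "?p1 x = 0" using 0 unfolding snd_combination by (rule fun_cong)
    have "\<llangle>?p1 x, \<qq>\<rrangle> = 0" "\<llangle>?p1 x, \<pp>\<rrangle> = 0" unfolding p0 by (simp_all add: lform_zero_left)
    then have "v * c = u * b" "v * b = u * a" by (simp_all add: lform_linear_simps)
    then have "u = 0 \<and> v = 0" using linear_system[of v u] by auto
    with assms show False by simp
  qed
  fix t x X
  have "dd A (\<lambda>y. poly_at t y (u *\<^sub>R \<alpha> + v *\<^sub>R \<beta>)) x X = t *\<^sub>R dd A ?p1 x X"
  proof -
    have "smooth_map A UNIV (\<lambda>r. t *\<^sub>R ?p1 r)"
      by (intro smooth_map_bounded_linear[OF open_UNIV bounded_linear_scaleR_right] smooth_combination)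
    from dd_add[OF open_UNIV UNIV_I smooth_map_const this]
    show ?thesis
      unfolding poly_at_def fst_combination snd_combination
      by (simp only: dd_const dd_bounded_linear[OF open_UNIV UNIV_I bounded_linear_scaleR_right smooth_combination] add_0)
  qed
  moreover have "blinfun_apply (potential x X) (poly_at t x (u *\<^sub>R \<alpha> + v *\<^sub>R \<beta>)) = - dd A ?p1 x X"
    unfolding poly_at_def fst_combination snd_combination blinfun.add_right blinfun.scaleR_right
      potential_pp potential_qq dd_combination potential_f[OF ff_in] potential_f[OF tt_in] dd_pp1 dd_qq1
    by (simp add: algebra_simps)
  ultimately show "dd A (\<lambda>y. poly_at t y (u *\<^sub>R \<alpha> + v *\<^sub>R \<beta>)) x X +
      t *\<^sub>R blinfun_apply (potential x X) (poly_at t x (u *\<^sub>R \<alpha> + v *\<^sub>R \<beta>)) = 0"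
    by simp
qed

lemma P_conserved: "conserved_plane A potential P"
proof -
  have "subspace P" by (simp add: P_def)
  then show ?thesis
    unfolding conserved_plane_def using dim_P combination_conserved by (metis P_cases)
qed

lemma g_0_nonzero: "g_at 0 x \<alpha> \<alpha> \<noteq> 0"
  using space_form_data by (auto simp: g_at_def poly_at_def \<alpha>_def space_form_data_def)

lemma g_inf_\<alpha>: "g_inf x \<alpha> (u *\<^sub>R \<alpha> + v *\<^sub>R \<beta>) = 2 * (v * b - u * a)"
  and g_inf_\<beta>: "g_inf x \<beta> (u *\<^sub>R \<alpha> + v *\<^sub>R \<beta>) = 2 * (u * b - v * c)"
  unfolding g_inf_def fst_combination snd_combination
  by (simp_all add: \<alpha>_def \<beta>_def \<pp>\<^sub>1_def \<qq>\<^sub>1_def lform_linear_simps)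

lemma g_inf_combination:
  "g_inf x (p *\<^sub>R \<alpha> + q *\<^sub>R \<beta>) \<gamma> = p * g_inf x \<alpha> \<gamma> + q * g_inf x \<beta> \<gamma>"
  by (simp add: linear_add[OF linear_g_inf] linear_scale[OF linear_g_inf])

lemma g_inf_sym: "g_inf x \<gamma> \<delta> = g_inf x \<delta> \<gamma>"
  by (simp add: g_inf_def add.commute)

lemma g_inf_nondegenerate: "nondegenerate_on P (g_inf x)"
  unfolding nondegenerate_on_def
proof (intro ballI impI)
  fix \<gamma> assume \<gamma>: "\<gamma> \<in> P" "\<forall>\<delta>\<in>P. g_inf x \<gamma> \<delta> = 0"
  obtain u v where uv: "\<gamma> = u *\<^sub>R \<alpha> + v *\<^sub>R \<beta>" using P_cases[OF \<gamma>(1)] .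
  have "\<alpha> \<in> P" "\<beta> \<in> P" by (simp_all add: P_def span_base)
  then have "g_inf x \<alpha> \<gamma> = 0" "g_inf x \<beta> \<gamma> = 0" using \<gamma>(2) by (simp_all add: g_inf_sym[of x _ \<gamma>])
  then have "u = 0 \<and> v = 0" unfolding uv g_inf_\<alpha> g_inf_\<beta> using linear_system[of v u] by auto
  then show "\<gamma> = 0" by (simp add: uv)
qed

lemma phi_inf_combination:
  assumes "\<gamma> \<in> P" "\<delta> \<in> P"
  shows "phi_inf P x (p *\<^sub>R (\<alpha> \<odot> \<alpha>) + q *\<^sub>R (\<alpha> \<odot> \<beta>) + r *\<^sub>R (\<beta> \<odot> \<beta>)) \<gamma> \<delta> =
    p * (g_inf x \<alpha> \<gamma> * g_inf x \<alpha> \<delta>) +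
    q * ((g_inf x \<alpha> \<gamma> * g_inf x \<beta> \<delta> + g_inf x \<alpha> \<delta> * g_inf x \<beta> \<gamma>) / 2) +
    r * (g_inf x \<beta> \<gamma> * g_inf x \<beta> \<delta>)"
  unfolding linear_add[OF linear_phi_inf] linear_scale[OF linear_phi_inf] phi_inf_sym_prod
  using assms by (simp add: form_on_def scaleR_fun_def plus_fun_def)

text \<open>The coefficients of an element of \<open>S\<^sup>2P\<close> are read off by evaluation on the basis of \<open>P\<close> that is dual to
  \<open>\<alpha>, \<beta>\<close> with respect to \<open>g\<^sub>\<infinity>\<close>.\<close>

lemma phi_inf_inj: "inj_on (phi_inf P x) (sym_square P)"
proof (rule inj_onI)
  fix Q R assume "Q \<in> sym_square P" "R \<in> sym_square P" and eq: "phi_inf P x Q = phi_inf P x R"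
  then obtain p q r p' q' r' where
    Q: "Q = p *\<^sub>R (\<alpha> \<odot> \<alpha>) + q *\<^sub>R (\<alpha> \<odot> \<beta>) + r *\<^sub>R (\<beta> \<odot> \<beta>)" and
    R: "R = p' *\<^sub>R (\<alpha> \<odot> \<alpha>) + q' *\<^sub>R (\<alpha> \<odot> \<beta>) + r' *\<^sub>R (\<beta> \<odot> \<beta>)"
    unfolding P_def sym_square_plane by blast
  define D where "D = a * c - b\<^sup>2"
  have D: "D \<noteq> 0" using discriminant by (simp add: D_def)
  define \<gamma> where "\<gamma> = (- c / (2 * D)) *\<^sub>R \<alpha> + (- b / (2 * D)) *\<^sub>R \<beta>"
  define \<delta> where "\<delta> = (- b / (2 * D)) *\<^sub>R \<alpha> + (- a / (2 * D)) *\<^sub>R \<beta>"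
  have in_P: "\<gamma> \<in> P" "\<delta> \<in> P" unfolding \<gamma>_def \<delta>_def by (rule P_in)+
  have dual: "g_inf x \<alpha> \<gamma> = 1" "g_inf x \<beta> \<gamma> = 0" "g_inf x \<alpha> \<delta> = 0" "g_inf x \<beta> \<delta> = 1"
    unfolding \<gamma>_def \<delta>_def g_inf_\<alpha> g_inf_\<beta> using D
    by (simp_all add: field_simps) (simp_all add: D_def power2_eq_square)
  have "p = p'" "q = q'" "r = r'"
    using phi_inf_combination[OF in_P(1,1), of x p q r] phi_inf_combination[OF in_P(1,1), of x p' q' r']
      phi_inf_combination[OF in_P(1,2), of x p q r] phi_inf_combination[OF in_P(1,2), of x p' q' r']
      phi_inf_combination[OF in_P(2,2), of x p q r] phi_inf_combination[OF in_P(2,2), of x p' q' r']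
      eq unfolding Q[symmetric] R[symmetric] dual by simp_all
  then show "Q = R" using Q R by simp
qed

text \<open>The Gram matrix of \<open>g\<^sub>\<infinity>\<close> with respect to \<open>\<alpha>, \<beta>\<close> is \<open>-2 (a, -b; -b, c)\<close>. Its inverse, a multiple of
  \<open>(c, b; b, a)\<close>, contains the coefficients of the preimage of \<open>g\<^sub>\<infinity>\<close>.\<close>

lemma conserved_weingarten_eq:
  "conserved_weingarten P x = (- 1 / (2 * (a * c - b\<^sup>2))) *\<^sub>R
    (a *\<^sub>R (\<qq> \<odot> \<qq>) + (2 * b) *\<^sub>R (\<qq> \<odot> \<pp>) + c *\<^sub>R (\<pp> \<odot> \<pp>))"
proof -
  define k where "k = - 1 / (2 * (a * c - b\<^sup>2))"
  have k: "k * (2 * (b\<^sup>2 - a * c)) = 1" using discriminant by (simp add: k_def field_simps)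
  define Q where "Q = (k * c) *\<^sub>R (\<alpha> \<odot> \<alpha>) + (k * (2 * b)) *\<^sub>R (\<alpha> \<odot> \<beta>) + (k * a) *\<^sub>R (\<beta> \<odot> \<beta>)"
  have Q: "Q \<in> sym_square P" unfolding Q_def P_def sym_square_plane by blast
  have "phi_inf P x Q = form_on P (g_inf x)"
  proof (intro ext)
    fix \<gamma> \<delta>
    show "phi_inf P x Q \<gamma> \<delta> = form_on P (g_inf x) \<gamma> \<delta>"
    proof (cases "\<gamma> \<in> P \<and> \<delta> \<in> P")
      case True
      obtain u v where uv: "\<gamma> = u *\<^sub>R \<alpha> + v *\<^sub>R \<beta>" using P_cases True by blast
      let ?A = "g_inf x \<alpha> \<delta>" and ?B = "g_inf x \<beta> \<delta>"
      have "phi_inf P x Q \<gamma> \<delta> = k * (2 * (b\<^sup>2 - a * c)) * (u * ?A + v * ?B)"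
        unfolding Q_def phi_inf_combination[OF True[THEN conjunct1] True[THEN conjunct2]]
        unfolding uv g_inf_\<alpha> g_inf_\<beta> by (simp add: field_simps power2_eq_square)
      also have "\<dots> = g_inf x \<gamma> \<delta>" unfolding k uv g_inf_combination by simp
      finally show ?thesis using True by (simp add: form_on_def)
    qed (auto simp: phi_inf_def form_on_def)
  qed
  then have "inv_into (sym_square P) (phi_inf P x) (form_on P (g_inf x)) = Q"
    using inv_into_f_eq[OF phi_inf_inj Q] by blast
  moreover have "poly_at 0 x \<alpha> = \<pp>" "poly_at 0 x \<beta> = \<qq>" by (simp_all add: poly_at_def \<alpha>_def \<beta>_def)
  ultimately have "conserved_weingarten P x =
      (k * c) *\<^sub>R (\<pp> \<odot> \<pp>) + (k * (2 * b)) *\<^sub>R (\<pp> \<odot> \<qq>) + (k * a) *\<^sub>R (\<qq> \<odot> \<qq>)"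
    unfolding conserved_weingarten_def Q_def
    by (simp add: linear_add[OF linear_phi_at] linear_scale[OF linear_phi_at] phi_at_sym_prod)
  then show ?thesis
    unfolding k_def[symmetric] sym_prod_swap[of \<qq> \<pp>] by (simp add: scaleR_add_right add.commute add.left_commute)
qed

lemma weingarten_class:
  "proj_class (a *\<^sub>R (\<qq> \<odot> \<qq>) + (2 * b) *\<^sub>R (\<qq> \<odot> \<pp>) + c *\<^sub>R (\<pp> \<odot> \<pp>)) =
   proj_class (conserved_weingarten P x)"
  unfolding conserved_weingarten_eq
  by (rule proj_class_scaleR[symmetric]) (use discriminant in simp)

end

theorem proposition6p7:
  fixes A :: "'a::{t2_space,second_countable_topology} atlas"
    and f s\<^sub>1 s\<^sub>2 :: "'a \<Rightarrow> 'v::lie_space set"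
    and \<qq> \<pp> :: 'v
    and \<ff> \<tt> :: "'a \<Rightarrow> 'v"
    and \<kappa>\<^sub>1 \<kappa>\<^sub>2 :: "'a \<Rightarrow> real"
    and a b c :: real
  assumes "smooth_atlas A"
    and "legendre_map A f"
    and "space_form_data \<qq> \<pp>"
    and "space_form_projection A f \<qq> \<pp> \<ff>"
    and "tangent_plane_congruence A f \<qq> \<pp> \<tt>"
    and "immersed A \<ff>"
    and "umbilic_free A f s\<^sub>1 s\<^sub>2"
    and "principal_curvature A (curvature_subbundle A f s\<^sub>1) \<ff> \<tt> \<kappa>\<^sub>1"
    and "principal_curvature A (curvature_subbundle A f s\<^sub>2) \<ff> \<tt> \<kappa>\<^sub>2"
    and "linear_weingarten a b c \<kappa>\<^sub>1 \<kappa>\<^sub>2"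
    and "\<not> tubular a b c"
  shows "\<exists>\<eta> \<eta>\<^sub>m\<^sub>i\<^sub>d P.
    omega_potential A f \<eta> \<and> middle_potential A f s\<^sub>1 s\<^sub>2 \<eta> \<eta>\<^sub>m\<^sub>i\<^sub>d \<and>
    conserved_plane A \<eta>\<^sub>m\<^sub>i\<^sub>d P \<and>
    (\<forall>x. (\<exists>\<alpha>\<in>P. \<exists>\<beta>\<in>P. g_at 0 x \<alpha> \<beta> \<noteq> 0) \<and> nondegenerate_on P (g_inf x)) \<and>
    (\<forall>x. proj_class (a *\<^sub>R (\<qq> \<odot> \<qq>) + (2 * b) *\<^sub>R (\<qq> \<odot> \<pp>) + c *\<^sub>R (\<pp> \<odot> \<pp>)) =
         proj_class (conserved_weingarten P x))"
proof -
  interpret weingarten_surface A f s\<^sub>1 s\<^sub>2 \<qq> \<pp> \<ff> \<tt> \<kappa>\<^sub>1 \<kappa>\<^sub>2 a b c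
    by unfold_locales (fact assms)+
  have "\<alpha> \<in> P" by (simp add: P_def span_base)
  then show ?thesis
    using potential_omega potential_middle_potential P_conserved g_0_nonzero g_inf_nondegenerate
      weingarten_class
    by (intro exI[of _ potential] exI[of _ P]) blast
qed

end
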